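(* $\mathrm{Ext}^3_{H_\beta^{op}}(\mathbf{K}_{H_\beta},{H_\beta}_{H_\beta})\simeq \mathrm{Ext}^3_{H_\beta}({}_{H_\beta}\mathbf{K},{}_{H_\beta}H_\beta)\simeq\mathbf{K}$ as two-sided $H_\beta$-modules.
   Context: Let $\mathbf{K}$ be an algebraically closed field of characteristic zero, $n\ge 2$ an integer, $q\in\mathbf{K}$ a primitive $n$-th root of unity, and $n_1$ an integer with $1\le n_1\le n$ and $2\nmid (n,n_1)$, where $(\cdot,\cdot)$ is the greatest common divisor. For $\beta=(\beta_1,\beta_2,\beta_3)\in\mathbf{K}^3$, $H_\beta$ is the Hopf algebra over $\mathbf{K}$ generated by invertible elements $a,b,c$ and elements $x,y$ with relations $ab=ba$, $ac=ca$, $bc=cb$, $xa=qax$, $ya=q^{-1}ay$, $bx=xb$, $cx=xc$, $by=yb$, $cy=yc$, $yx-q^{-n_1}xy=\beta_3(a^{2n_1}-bc)$, $x^n=\beta_1(a^{nn_1}-b^n)$, $y^n=\beta_2(a^{nn_1}-c^n)$, with $\Delta(a)=a\otimes a$, $\Delta(b)=b\otimes b$, $\Delta(c)=c\otimes c$, $\Delta(x)=x\otimes a^{n_1}+b\otimes x$, $\Delta(y)=y\otimes a^{n_1}+c\otimes y$, $\varepsilon(a)=\varepsilon(b)=\varepsilon(c)=1$, $\varepsilon(x)=\varepsilon(y)=0$, and antipode $s(a)=a^{-1}$, $s(b)=b^{-1}$, $s(c)=c^{-1}$, $s(x)=-q^{-n_1}a^{-n_1}b^{-1}x$, $s(y)=-q^{n_1}a^{-n_1}c^{-1}y$.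 Here ${}_{H_\beta}\mathbf{K}$ and $\mathbf{K}_{H_\beta}$ are the trivial left and right modules via $\varepsilon$, and $\mathbf{K}$ on the right-hand side is the trivial bimodule. The left and right homological integrals of $H_\beta$ are $\mathrm{Ext}^3_{H_\beta}({}_{H_\beta}\mathbf{K},{}_{H_\beta}H_\beta)$ and $\mathrm{Ext}^3_{H_\beta^{op}}(\mathbf{K}_{H_\beta},{H_\beta}_{H_\beta})$, with their natural bimodule structures (one side from the remaining action on $H_\beta$, the other from the trivial action on $\mathbf{K}$).
   Formalization: The formal statement assumes explicitly that the given comultiplication, counit and antipode respect the relations of H_β; this forces (n,n_1)=1, since for odd (n,n_1)>1 (e.g. n=n_1=3) the comultiplication of x^n is incompatible with the relations and the Hopf algebra H_β does not exist. *)

theory Defs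
  imports "HOL-Algebra.Algebra" "HOL-Algebra.Algebraic_Closure_Type" "HOL-Library.Poly_Mapping"
begin

section \<open>Free algebras and presentations\<close>

text \<open>Words form a monoid under concatenation, written additively because the product of
  finitely supported functions in \<^theory>\<open>HOL-Library.Poly_Mapping\<close> is convolution over an
  additive monoid.\<close>

datatype 'x fword = Word (letters: "'x list")

instantiation fword :: (type) monoid_add
begin

definition zero_fword :: "'a fword" where "0 = Word []"

definition plus_fword :: "'a fword \<Rightarrow> 'a fword \<Rightarrow> 'a fword"
  where "u + v = Word (letters u @ letters v)"

instance by intro_classes (simp_all add: zero_fword_def plus_fword_def)

end

type_synonym ('x, 'k) free_algebra = "'x fword \<Rightarrow>\<^sub>0 'k"

definition fgen :: "'x \<Rightarrow> ('x, 'k::field) free_algebra"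
  where "fgen s = Poly_Mapping.single (Word [s]) 1"

definition fscalar :: "'k::field \<Rightarrow> ('x, 'k) free_algebra"
  where "fscalar k = Poly_Mapping.single 0 k"

text \<open>The algebra homomorphism (respectively anti-homomorphism) sending each letter \<open>s\<close> to
  \<open>g s\<close> and each scalar \<open>k\<close> to \<open>\<eta> k\<close>.\<close>

definition free_lift :: "('k::field \<Rightarrow> 'r::ring_1) \<Rightarrow> ('x \<Rightarrow> 'r) \<Rightarrow> ('x, 'k) free_algebra \<Rightarrow> 'r"
  where "free_lift \<eta> g f =
    (\<Sum>w\<in>Poly_Mapping.keys f. \<eta> (Poly_Mapping.lookup f w) * prod_list (map g (letters w)))"

definition free_antilift ::
    "('k::field \<Rightarrow> 'r::ring_1) \<Rightarrow> ('x \<Rightarrow> 'r) \<Rightarrow> ('x, 'k) free_algebra \<Rightarrow> 'r"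
  where "free_antilift \<eta> g f =
    (\<Sum>w\<in>Poly_Mapping.keys f. \<eta> (Poly_Mapping.lookup f w) * prod_list (map g (rev (letters w))))"

definition relation_ideal :: "('x, 'k::field) free_algebra set \<Rightarrow> ('x, 'k) free_algebra set"
  where "relation_ideal S = Idl\<^bsub>ring_of_type_algebra\<^esub> S"

definition presented_algebra ::
    "('x, 'k::field) free_algebra set \<Rightarrow> ('x, 'k) free_algebra set ring"
  where "presented_algebra S = ring_of_type_algebra Quot (relation_ideal S)"

definition presented_unit ::
    "('x, 'k::field) free_algebra set \<Rightarrow> 'k \<Rightarrow> ('x, 'k) free_algebra set"
  where "presented_unit S k = relation_ideal S +>\<^bsub>ring_of_type_algebra\<^esub> fscalar k"


section \<open>The Hopf algebra \<open>H\<^sub>\<beta>\<close>\<close>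

definition primitive_root_of_unity :: "nat \<Rightarrow> 'k::field \<Rightarrow> bool"
  where "primitive_root_of_unity n q \<longleftrightarrow> 0 < n \<and> q ^ n = 1 \<and> (\<forall>k. 0 < k \<and> k < n \<longrightarrow> q ^ k \<noteq> 1)"

text \<open>\<open>GAi\<close>, \<open>GBi\<close>, \<open>GCi\<close> stand for the inverses of \<open>a\<close>, \<open>b\<close>, \<open>c\<close>.\<close>

datatype hgen = GA | GAi | GB | GBi | GC | GCi | GX | GY

text \<open>The relations are written for an arbitrary family \<open>v\<close> in place of the generators, so that they
  can also be imposed on each of the two tensor factors of \<open>H\<^sub>\<beta> \<otimes> H\<^sub>\<beta>\<close>.\<close>

definition H_relations_at ::
    "nat \<Rightarrow> nat \<Rightarrow> 'k::field \<Rightarrow> 'k \<Rightarrow> 'k \<Rightarrow> 'k \<Rightarrow>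
     (hgen \<Rightarrow> ('x, 'k) free_algebra) \<Rightarrow> ('x, 'k) free_algebra set"
  where "H_relations_at n n1 q \<beta>1 \<beta>2 \<beta>3 v =
    (let a = v GA; a' = v GAi; b = v GB; b' = v GBi; c = v GC; c' = v GCi; x = v GX; y = v GY in
     {a * a' - 1, a' * a - 1, b * b' - 1, b' * b - 1, c * c' - 1, c' * c - 1,
      a * b - b * a, a * c - c * a, b * c - c * b,
      x * a - fscalar q * a * x,
      y * a - fscalar (inverse q) * a * y,
      b * x - x * b, c * x - x * c, b * y - y * b, c * y - y * c,
      (y * x - fscalar (inverse q ^ n1) * x * y) - fscalar \<beta>3 * (a ^ (2 * n1) - b * c),
      x ^ n - fscalar \<beta>1 * (a ^ (n * n1) - b ^ n),
      y ^ n - fscalar \<beta>2 * (a ^ (n * n1) - c ^ n)})"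

abbreviation H_relations ::
    "nat \<Rightarrow> nat \<Rightarrow> 'k::field \<Rightarrow> 'k \<Rightarrow> 'k \<Rightarrow> 'k \<Rightarrow> (hgen, 'k) free_algebra set"
  where "H_relations n n1 q \<beta>1 \<beta>2 \<beta>3 \<equiv> H_relations_at n n1 q \<beta>1 \<beta>2 \<beta>3 fgen"

type_synonym 'k H_elem = "(hgen, 'k) free_algebra set"

definition H_alg :: "nat \<Rightarrow> nat \<Rightarrow> 'k::field \<Rightarrow> 'k \<Rightarrow> 'k \<Rightarrow> 'k \<Rightarrow> 'k H_elem ring"
  where "H_alg n n1 q \<beta>1 \<beta>2 \<beta>3 = presented_algebra (H_relations n n1 q \<beta>1 \<beta>2 \<beta>3)"

definition H_unit :: "nat \<Rightarrow> nat \<Rightarrow> 'k::field \<Rightarrow> 'k \<Rightarrow> 'k \<Rightarrow> 'k \<Rightarrow> 'k \<Rightarrow> 'k H_elem"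
  where "H_unit n n1 q \<beta>1 \<beta>2 \<beta>3 = presented_unit (H_relations n n1 q \<beta>1 \<beta>2 \<beta>3)"

text \<open>\<open>H\<^sub>\<beta> \<otimes> H\<^sub>\<beta>\<close> is generated by two copies of the generators (\<open>Inl s\<close> for \<open>s \<otimes> 1\<close>, \<open>Inr s\<close> for
  \<open>1 \<otimes> s\<close>), each subject to the relations of \<open>H\<^sub>\<beta>\<close>, and commuting with each other.\<close>

definition HH_relations ::
    "nat \<Rightarrow> nat \<Rightarrow> 'k::field \<Rightarrow> 'k \<Rightarrow> 'k \<Rightarrow> 'k \<Rightarrow> (hgen + hgen, 'k) free_algebra set"
  where "HH_relations n n1 q \<beta>1 \<beta>2 \<beta>3 =
    H_relations_at n n1 q \<beta>1 \<beta>2 \<beta>3 (\<lambda>s. fgen (Inl s)) \<union>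
    H_relations_at n n1 q \<beta>1 \<beta>2 \<beta>3 (\<lambda>s. fgen (Inr s)) \<union>
    {fgen (Inl s) * fgen (Inr t) - fgen (Inr t) * fgen (Inl s) | s t. True}"

fun H_comult_gen :: "nat \<Rightarrow> hgen \<Rightarrow> (hgen + hgen, 'k::field) free_algebra"
  where
    "H_comult_gen n1 GX = fgen (Inl GX) * fgen (Inr GA) ^ n1 + fgen (Inl GB) * fgen (Inr GX)"
  | "H_comult_gen n1 GY = fgen (Inl GY) * fgen (Inr GA) ^ n1 + fgen (Inl GC) * fgen (Inr GY)"
  | "H_comult_gen n1 s = fgen (Inl s) * fgen (Inr s)"

fun H_counit_gen :: "hgen \<Rightarrow> 'k::field"
  where
    "H_counit_gen GX = 0"
  | "H_counit_gen GY = 0"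
  | "H_counit_gen _ = 1"

fun H_antipode_gen :: "nat \<Rightarrow> 'k::field \<Rightarrow> hgen \<Rightarrow> (hgen, 'k) free_algebra"
  where
    "H_antipode_gen n1 q GA = fgen GAi"
  | "H_antipode_gen n1 q GAi = fgen GA"
  | "H_antipode_gen n1 q GB = fgen GBi"
  | "H_antipode_gen n1 q GBi = fgen GB"
  | "H_antipode_gen n1 q GC = fgen GCi"
  | "H_antipode_gen n1 q GCi = fgen GC"
  | "H_antipode_gen n1 q GX = - (fscalar (inverse q ^ n1) * fgen GAi ^ n1 * fgen GBi * fgen GX)"
  | "H_antipode_gen n1 q GY = - (fscalar (q ^ n1) * fgen GAi ^ n1 * fgen GCi * fgen GY)"

definition free_comult ::
    "nat \<Rightarrow> (hgen, 'k::field) free_algebra \<Rightarrow> (hgen + hgen, 'k) free_algebra"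
  where "free_comult n1 = free_lift fscalar (H_comult_gen n1)"

definition free_counit :: "(hgen, 'k::field) free_algebra \<Rightarrow> 'k"
  where "free_counit = free_lift id H_counit_gen"

definition free_antipode :: "nat \<Rightarrow> 'k::field \<Rightarrow> (hgen, 'k) free_algebra \<Rightarrow> (hgen, 'k) free_algebra"
  where "free_antipode n1 q = free_antilift fscalar (H_antipode_gen n1 q)"

text \<open>The prescribed values define a Hopf algebra structure on \<open>H\<^sub>\<beta>\<close>: the maps
  \<open>\<Delta> : H\<^sub>\<beta> \<rightarrow> H\<^sub>\<beta> \<otimes> H\<^sub>\<beta>\<close>, \<open>\<epsilon> : H\<^sub>\<beta> \<rightarrow> K\<close> and (anti-multiplicative) \<open>s : H\<^sub>\<beta> \<rightarrow> H\<^sub>\<beta>\<close> they determine on the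
  free algebra factor through the relations.  The coalgebra and antipode identities need not be
  listed: they hold on the generators, hence everywhere once the three maps are well defined.
  This is a genuine condition on the parameters: applied to the relation for \<open>x\<^sup>n\<close>, \<open>\<Delta>\<close> produces mixed terms
  whose coefficients are Gaussian binomials at \<open>q\<close> to the power \<open>n\<^sub>1\<close>, and these must cancel.\<close>

definition H_is_Hopf_algebra :: "nat \<Rightarrow> nat \<Rightarrow> 'k::field \<Rightarrow> 'k \<Rightarrow> 'k \<Rightarrow> 'k \<Rightarrow> bool"
  where "H_is_Hopf_algebra n n1 q \<beta>1 \<beta>2 \<beta>3 \<longleftrightarrow>
    (\<forall>r \<in> H_relations n n1 q \<beta>1 \<beta>2 \<beta>3.
       free_comult n1 r \<in> relation_ideal (HH_relations n n1 q \<beta>1 \<beta>2 \<beta>3) \<and>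
       free_counit r = 0 \<and>
       free_antipode n1 q r \<in> relation_ideal (H_relations n n1 q \<beta>1 \<beta>2 \<beta>3))"

text \<open>An element of \<open>H\<^sub>\<beta>\<close> is a coset, on which \<^const>\<open>free_counit\<close> is constant.\<close>

definition H_counit :: "'k::field H_elem \<Rightarrow> 'k"
  where "H_counit h = the_elem (free_counit ` h)"


section \<open>Modules over noncommutative rings and Ext\<close>

text \<open>The library locale \<^locale>\<open>module\<close> requires a commutative ring; its record type is reused.
  Right modules are left modules over the opposite ring.\<close>

locale left_module = R?: ring R + M?: abelian_group M
  for R :: "('r, 'c) ring_scheme" (structure) and M :: "('r, 'm, 'd) module_scheme" (structure) +
  assumes smult_closed: "\<lbrakk>r \<in> carrier R; x \<in> carrier M\<rbrakk> \<Longrightarrow> r \<odot>\<^bsub>M\<^esub> x \<in> carrier M"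
    and smult_l_distr: "\<lbrakk>r \<in> carrier R; s \<in> carrier R; x \<in> carrier M\<rbrakk> \<Longrightarrow>
      (r \<oplus>\<^bsub>R\<^esub> s) \<odot>\<^bsub>M\<^esub> x = r \<odot>\<^bsub>M\<^esub> x \<oplus>\<^bsub>M\<^esub> s \<odot>\<^bsub>M\<^esub> x"
    and smult_r_distr: "\<lbrakk>r \<in> carrier R; x \<in> carrier M; y \<in> carrier M\<rbrakk> \<Longrightarrow>
      r \<odot>\<^bsub>M\<^esub> (x \<oplus>\<^bsub>M\<^esub> y) = r \<odot>\<^bsub>M\<^esub> x \<oplus>\<^bsub>M\<^esub> r \<odot>\<^bsub>M\<^esub> y"
    and smult_assoc: "\<lbrakk>r \<in> carrier R; s \<in> carrier R; x \<in> carrier M\<rbrakk> \<Longrightarrow>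
      (r \<otimes>\<^bsub>R\<^esub> s) \<odot>\<^bsub>M\<^esub> x = r \<odot>\<^bsub>M\<^esub> (s \<odot>\<^bsub>M\<^esub> x)"
    and smult_one: "x \<in> carrier M \<Longrightarrow> \<one>\<^bsub>R\<^esub> \<odot>\<^bsub>M\<^esub> x = x"

definition opposite_ring :: "'r ring \<Rightarrow> 'r ring"
  where "opposite_ring R = R\<lparr>monoid.mult := (\<lambda>r s. s \<otimes>\<^bsub>R\<^esub> r)\<rparr>"

definition regular_module :: "'r ring \<Rightarrow> ('r, 'r) module"
  where "regular_module R =
    \<lparr>carrier = carrier R, monoid.mult = monoid.mult R, one = monoid.one R,
     ring.zero = ring.zero R, add = ring.add R, module.smult = monoid.mult R\<rparr>"

text \<open>\<open>K\<close> with \<open>r\<close> acting by \<open>\<epsilon> r\<close>; since \<open>K\<close> is commutative this serves as trivial module on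
  either side.\<close>

definition trivial_module :: "('r \<Rightarrow> 'k::field) \<Rightarrow> ('r, 'k) module"
  where "trivial_module \<epsilon> =
    \<lparr>carrier = UNIV, monoid.mult = (*), one = 1, ring.zero = 0, add = (+), module.smult = (\<lambda>r k. \<epsilon> r * k)\<rparr>"

text \<open>Homomorphisms are extensional functions, so that equality of elements of \<open>Hom\<close> is
  equality on the carrier.\<close>

definition module_hom ::
    "'r ring \<Rightarrow> ('r, 'm) module \<Rightarrow> ('r, 'n) module \<Rightarrow> ('m \<Rightarrow> 'n) set"
  where "module_hom R M N =
    {f \<in> carrier M \<rightarrow>\<^sub>E carrier N.
       (\<forall>x\<in>carrier M. \<forall>y\<in>carrier M. f (x \<oplus>\<^bsub>M\<^esub> y) = f x \<oplus>\<^bsub>N\<^esub> f y) \<and>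
       (\<forall>r\<in>carrier R. \<forall>x\<in>carrier M. f (r \<odot>\<^bsub>M\<^esub> x) = r \<odot>\<^bsub>N\<^esub> f x)}"

text \<open>The free module with basis indexed by \<open>I\<close>: finitely supported families.\<close>

definition free_module :: "'r ring \<Rightarrow> 'i set \<Rightarrow> ('r, 'i \<Rightarrow> 'r) module"
  where "free_module R I =
    \<lparr>carrier = {f \<in> I \<rightarrow>\<^sub>E carrier R. finite {i \<in> I. f i \<noteq> \<zero>\<^bsub>R\<^esub>}},
     monoid.mult = undefined, one = undefined,
     ring.zero = (\<lambda>i\<in>I. \<zero>\<^bsub>R\<^esub>),
     add = (\<lambda>f g. \<lambda>i\<in>I. f i \<oplus>\<^bsub>R\<^esub> g i),
     module.smult = (\<lambda>r f. \<lambda>i\<in>I. r \<otimes>\<^bsub>R\<^esub> f i)\<rparr>"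

text \<open>Projective: isomorphic to a direct summand of a free module.  Index sets within the type of \<open>P\<close>
  suffice, as \<open>P\<close> is then a summand of the free module on its own carrier.\<close>

definition projective_module :: "'r ring \<Rightarrow> ('r, 'p) module \<Rightarrow> bool"
  where "projective_module R P \<longleftrightarrow> left_module R P \<and>
    (\<exists>(I::'p set). \<exists>s \<in> module_hom R P (free_module R I). \<exists>p \<in> module_hom R (free_module R I) P.
       \<forall>x\<in>carrier P. p (s x) = x)"

text \<open>An exact complex \<open>\<dots> \<rightarrow> P\<^sub>2 \<rightarrow> P\<^sub>1 \<rightarrow> P\<^sub>0 \<rightarrow> M \<rightarrow> 0\<close> with \<open>d i : P\<^sub>i\<^sub>+\<^sub>1 \<rightarrow> P\<^sub>i\<close>.\<close>

definition projective_resolution ::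
    "'r ring \<Rightarrow> ('r, 'm) module \<Rightarrow> (nat \<Rightarrow> ('r, 'p) module) \<Rightarrow> (nat \<Rightarrow> 'p \<Rightarrow> 'p) \<Rightarrow> ('p \<Rightarrow> 'm) \<Rightarrow> bool"
  where "projective_resolution R M P d aug \<longleftrightarrow>
    (\<forall>i. projective_module R (P i)) \<and>
    (\<forall>i. d i \<in> module_hom R (P (Suc i)) (P i)) \<and>
    aug \<in> module_hom R (P 0) M \<and>
    aug ` carrier (P 0) = carrier M \<and>
    d 0 ` carrier (P (Suc 0)) = {x \<in> carrier (P 0). aug x = \<zero>\<^bsub>M\<^esub>} \<and>
    (\<forall>i. d (Suc i) ` carrier (P (Suc (Suc i))) = {x \<in> carrier (P (Suc i)). d i x = \<zero>\<^bsub>P i\<^esub>})"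

text \<open>The group of \<open>i\<close>-cocycles of \<open>Hom\<^sub>R(P, N)\<close>.  Here and below only the additive part of the record
  is meaningful.\<close>

definition Ext_cocycles ::
    "'r ring \<Rightarrow> (nat \<Rightarrow> ('r, 'p) module) \<Rightarrow> (nat \<Rightarrow> 'p \<Rightarrow> 'p) \<Rightarrow> ('r, 'n) module \<Rightarrow> nat \<Rightarrow> ('p \<Rightarrow> 'n) ring"
  where "Ext_cocycles R P d N i =
    \<lparr>carrier = {f \<in> module_hom R (P i) N. \<forall>x\<in>carrier (P (Suc i)). f (d i x) = \<zero>\<^bsub>N\<^esub>},
     monoid.mult = undefined, one = undefined,
     ring.zero = (\<lambda>x\<in>carrier (P i). \<zero>\<^bsub>N\<^esub>),
     add = (\<lambda>f g. \<lambda>x\<in>carrier (P i). f x \<oplus>\<^bsub>N\<^esub> g x)\<rparr>"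

fun Ext_coboundaries ::
    "'r ring \<Rightarrow> (nat \<Rightarrow> ('r, 'p) module) \<Rightarrow> (nat \<Rightarrow> 'p \<Rightarrow> 'p) \<Rightarrow> ('r, 'n) module \<Rightarrow> nat \<Rightarrow> ('p \<Rightarrow> 'n) set"
  where
    "Ext_coboundaries R P d N 0 = {\<lambda>x\<in>carrier (P 0). \<zero>\<^bsub>N\<^esub>}"
  | "Ext_coboundaries R P d N (Suc i) =
      (\<lambda>g. compose (carrier (P (Suc i))) g (d i)) ` module_hom R (P i) N"


section \<open>Bimodules and homological integrals\<close>

record ('r, 'm) bimodule = "('r, 'm) module" +
  rsmult :: "'m \<Rightarrow> 'r \<Rightarrow> 'm"

definition bimodule_isomorphic ::
    "'r ring \<Rightarrow> ('r, 'm) bimodule \<Rightarrow> ('r, 'n) bimodule \<Rightarrow> bool"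
  where "bimodule_isomorphic R M N \<longleftrightarrow>
    (\<exists>\<phi>. bij_betw \<phi> (carrier M) (carrier N) \<and>
      (\<forall>x\<in>carrier M. \<forall>y\<in>carrier M. \<phi> (x \<oplus>\<^bsub>M\<^esub> y) = \<phi> x \<oplus>\<^bsub>N\<^esub> \<phi> y) \<and>
      (\<forall>r\<in>carrier R. \<forall>x\<in>carrier M. \<phi> (r \<odot>\<^bsub>M\<^esub> x) = r \<odot>\<^bsub>N\<^esub> \<phi> x) \<and>
      (\<forall>r\<in>carrier R. \<forall>x\<in>carrier M. \<phi> (rsmult M x r) = rsmult N (\<phi> x) r))"

definition trivial_bimodule :: "('r \<Rightarrow> 'k::field) \<Rightarrow> ('r, 'k) bimodule"
  where "trivial_bimodule \<epsilon> =
    \<lparr>carrier = UNIV, monoid.mult = (*), one = 1, ring.zero = 0, add = (+),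
     module.smult = (\<lambda>r k. \<epsilon> r * k), rsmult = (\<lambda>k r. k * \<epsilon> r)\<rparr>"

text \<open>\<open>Ext\<^sup>i\<^sub>R(M, N)\<close> computed from a resolution \<open>P\<close> of \<open>M\<close>, as cocycles modulo coboundaries, with the two
  actions of \<open>'h\<close> induced by actions \<open>lact\<close>, \<open>ract\<close> on cochains.\<close>

definition Ext_bimodule ::
    "'r ring \<Rightarrow> (nat \<Rightarrow> ('r, 'p) module) \<Rightarrow> (nat \<Rightarrow> 'p \<Rightarrow> 'p) \<Rightarrow> ('r, 'n) module \<Rightarrow> nat \<Rightarrow>
     ('h \<Rightarrow> ('p \<Rightarrow> 'n) \<Rightarrow> ('p \<Rightarrow> 'n)) \<Rightarrow> ('h \<Rightarrow> ('p \<Rightarrow> 'n) \<Rightarrow> ('p \<Rightarrow> 'n)) \<Rightarrow>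
     ('h, ('p \<Rightarrow> 'n) set) bimodule"
  where "Ext_bimodule R P d N i lact ract =
    (let Z = Ext_cocycles R P d N i; B = Ext_coboundaries R P d N i in
     \<lparr>carrier = a_rcosets\<^bsub>Z\<^esub> B, monoid.mult = undefined, one = undefined,
      ring.zero = B, add = set_add Z,
      module.smult = (\<lambda>h C. \<Union>f\<in>C. B +>\<^bsub>Z\<^esub> lact h f),
      rsmult = (\<lambda>C h. \<Union>f\<in>C. B +>\<^bsub>Z\<^esub> ract h f)\<rparr>)"

text \<open>For an algebra \<open>A\<close> with unit map \<open>\<eta> : K \<rightarrow> A\<close> and augmentation \<open>\<epsilon>\<close>, and a resolution \<open>P\<close> of the
  trivial module, the bimodules \<open>Ext\<^sup>i\<^sub>A(K, A)\<close> (left) and \<open>Ext\<^sup>i(K, A)\<close> over the opposite of \<open>A\<close>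
  (right).  One action is multiplication in \<open>A\<close> on the remaining side.  The other comes by
  functoriality from the action of \<open>A\<close> on \<open>K\<close>: \<open>h\<close> acts on \<open>K\<close> by the scalar \<open>\<epsilon> h\<close>, which lifts to the
  resolution as multiplication by the central element \<open>\<eta> (\<epsilon> h)\<close>.\<close>

definition Ext_left_trivial ::
    "'a ring \<Rightarrow> ('k::field \<Rightarrow> 'a) \<Rightarrow> ('a \<Rightarrow> 'k) \<Rightarrow> nat \<Rightarrow>
     (nat \<Rightarrow> ('a, 'p) module) \<Rightarrow> (nat \<Rightarrow> 'p \<Rightarrow> 'p) \<Rightarrow> ('a, ('p \<Rightarrow> 'a) set) bimodule"
  where "Ext_left_trivial A \<eta> \<epsilon> i P d =
    Ext_bimodule A P d (regular_module A) i
      (\<lambda>h f. \<lambda>x\<in>carrier (P i). f (\<eta> (\<epsilon> h) \<odot>\<^bsub>P i\<^esub> x))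
      (\<lambda>h f. \<lambda>x\<in>carrier (P i). f x \<otimes>\<^bsub>A\<^esub> h)"

definition Ext_right_trivial ::
    "'a ring \<Rightarrow> ('k::field \<Rightarrow> 'a) \<Rightarrow> ('a \<Rightarrow> 'k) \<Rightarrow> nat \<Rightarrow>
     (nat \<Rightarrow> ('a, 'p) module) \<Rightarrow> (nat \<Rightarrow> 'p \<Rightarrow> 'p) \<Rightarrow> ('a, ('p \<Rightarrow> 'a) set) bimodule"
  where "Ext_right_trivial A \<eta> \<epsilon> i P d =
    Ext_bimodule (opposite_ring A) P d (regular_module (opposite_ring A)) i
      (\<lambda>h f. \<lambda>x\<in>carrier (P i). h \<otimes>\<^bsub>A\<^esub> f x)
      (\<lambda>h f. \<lambda>x\<in>carrier (P i). f (\<eta> (\<epsilon> h) \<odot>\<^bsub>P i\<^esub> x))"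

end

theory Submission
  imports Defs "HOL-Library.Function_Algebras" "HOL-Library.Product_Plus"
begin

text \<open>The elements \<open>c - 1\<close>, \<open>b - 1\<close>, \<open>a\<^sup>n - 1\<close> form a central regular sequence in \<open>H\<^sub>\<beta>\<close> that acts as zero on the
  trivial module.  Three applications of Rees's change of rings therefore identify \<open>Ext\<^sup>3(K, H\<^sub>\<beta>)\<close> with the left
  integrals of the quotient \<open>u\<close> of \<open>H\<^sub>\<beta>\<close> by this sequence.  In the basis \<open>x\<^sup>l a\<^sup>i y\<^sup>m\<close> of \<open>u\<close> the integrals are found to
  be the multiples of \<open>x\<^sup>n\<^sup>-\<^sup>1 e y\<^sup>n\<^sup>-\<^sup>1\<close>, where \<open>e\<close> is the idempotent of \<open>K[a]/(a\<^sup>n - 1)\<close> with \<open>a e = q\<^sup>-\<^sup>1 e\<close>; this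
  element commutes with \<open>a\<close>, so right multiplication acts on it through the counit as well.
  That the monomials form a basis of \<open>H\<^sub>\<beta>\<close> needs \<open>q\<close> to the power \<open>n\<^sub>1\<close> to be a primitive \<open>n\<close>-th root of unity, which is
  forced by the coproduct of \<open>x\<^sup>n\<close>: otherwise the mixed terms do not cancel.\<close>

section \<open>Linear maps out of projective modules\<close>

text \<open>A central \<open>t\<close> with \<open>\<epsilon> t = 0\<close> kills the trivial
  module, so multiplication by \<open>t\<close> on a projective resolution is null-homotopic.
  Composing a cocycle with the homotopy lowers its degree by one and passes to coefficients modulo
  \<open>t\<close>: this is Rees's isomorphism made explicit. After three steps the isomorphism is
  evaluation at one element of the resolution, and both actions can be read off there. Quotient
  rings are never formed: cochains keep their values in the algebra, and the conditions on them hold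
  modulo a left ideal.

  The obstacle is regularity of the sequence, which needs a basis of an algebra given by generators
  and relations. Spanning is rewriting; independence comes from an action on the would-be
  coordinates. There every relation is checked directly except the one for \<open>y^n\<close>, whose
  defect commutes with the action and kills a cyclic vector. In these coordinates the ideals of the
  sequence are kernels of the specialisations \<open>c = 1\<close>, \<open>b = c = 1\<close> and
  \<open>a = q^s\<close>, \<open>b = c = 1\<close>, so divisibility and regularity become statements
  about Laurent polynomials.\<close>

definition linear_map ::
    "'r ring \<Rightarrow> ('r, 'm) module \<Rightarrow> ('r, 'n) module \<Rightarrow> ('m \<Rightarrow> 'n) \<Rightarrow> bool"
  where "linear_map R M N f \<longleftrightarrow>
    (\<forall>x\<in>carrier M. f x \<in> carrier N) \<and>
    (\<forall>x\<in>carrier M. \<forall>y\<in>carrier M. f (x \<oplus>\<^bsub>M\<^esub> y) = f x \<oplus>\<^bsub>N\<^esub> f y) \<and>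
    (\<forall>r\<in>carrier R. \<forall>x\<in>carrier M. f (r \<odot>\<^bsub>M\<^esub> x) = r \<odot>\<^bsub>N\<^esub> f x)"

lemma linear_map_closed: "linear_map R M N f \<Longrightarrow> x \<in> carrier M \<Longrightarrow> f x \<in> carrier N"
  and linear_map_add: "linear_map R M N f \<Longrightarrow> x \<in> carrier M \<Longrightarrow> y \<in> carrier M \<Longrightarrow>
    f (x \<oplus>\<^bsub>M\<^esub> y) = f x \<oplus>\<^bsub>N\<^esub> f y"
  and linear_map_smult: "linear_map R M N f \<Longrightarrow> r \<in> carrier R \<Longrightarrow> x \<in> carrier M \<Longrightarrow>
    f (r \<odot>\<^bsub>M\<^esub> x) = r \<odot>\<^bsub>N\<^esub> f x"
  by (simp_all add: linear_map_def)

text \<open>Dropping extensionality lets composites be used as they stand; it is restored only where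
  cocycles become elements of \<open>Ext\<close>.\<close>

lemma module_hom_iff:
  "f \<in> module_hom R M N \<longleftrightarrow> linear_map R M N f \<and> f \<in> extensional (carrier M)"
  by (auto simp: module_hom_def linear_map_def PiE_def Pi_def)

lemma linear_map_comp:
  "linear_map R M N f \<Longrightarrow> linear_map R N L g \<Longrightarrow> linear_map R M L (\<lambda>x. g (f x))"
  by (simp add: linear_map_def)

lemma linear_map_cong:
  assumes "left_module R M" "\<And>x. x \<in> carrier M \<Longrightarrow> f x = g x" "linear_map R M N f"
  shows "linear_map R M N g"
proof -
  interpret M: left_module R M by fact
  show ?thesis
    using assms(3) unfolding linear_map_def
    by (simp add: assms(2)[symmetric] M.smult_closed)
qed

context left_module
begin

lemma smult_zero_left: "x \<in> carrier M \<Longrightarrow> \<zero>\<^bsub>R\<^esub> \<odot>\<^bsub>M\<^esub> x = \<zero>\<^bsub>M\<^esub>"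
  by (metis R.r_zero R.zero_closed smult_l_distr smult_closed M.r_zero M.add.l_cancel M.zero_closed)

lemma smult_zero_right: "r \<in> carrier R \<Longrightarrow> r \<odot>\<^bsub>M\<^esub> \<zero>\<^bsub>M\<^esub> = \<zero>\<^bsub>M\<^esub>"
  by (metis smult_r_distr smult_closed M.r_zero M.add.l_cancel M.zero_closed)

lemma smult_finsum:
  assumes "finite S" "r \<in> carrier R" "f \<in> S \<rightarrow> carrier M"
  shows "r \<odot>\<^bsub>M\<^esub> finsum M f S = finsum M (\<lambda>i. r \<odot>\<^bsub>M\<^esub> f i) S"
  using assms
  by (induction S rule: finite_induct)
     (simp_all add: smult_zero_right smult_r_distr Pi_def M.finsum_insert smult_closed)

end

lemma linear_map_zero:
  assumes "left_module R M" "left_module R N" "linear_map R M N f"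
  shows "f \<zero>\<^bsub>M\<^esub> = \<zero>\<^bsub>N\<^esub>"
proof -
  interpret M: left_module R M by fact
  interpret N: left_module R N by fact
  have "f (\<zero>\<^bsub>R\<^esub> \<odot>\<^bsub>M\<^esub> \<zero>\<^bsub>M\<^esub>) = \<zero>\<^bsub>R\<^esub> \<odot>\<^bsub>N\<^esub> f \<zero>\<^bsub>M\<^esub>"
    using assms(3) by (simp add: linear_map_smult)
  then show ?thesis
    using assms(3) by (simp add: M.smult_zero_left N.smult_zero_left linear_map_closed)
qed

text \<open>A relation \<open>T\<close> stands for a submodule of \<open>P \<times> M\<close> that surjects onto \<open>P\<close>; a section of this
  surjection is the graph of \<open>h\<close>.\<close>

lemma projective_linear_selection:
  fixes P :: "('r, 'p) module" and M :: "('r, 'm) module"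
  assumes proj: "projective_module R P" and M: "left_module R M"
    and sub: "T \<subseteq> carrier P \<times> carrier M"
    and add: "\<And>x m x' m'. (x, m) \<in> T \<Longrightarrow> (x', m') \<in> T \<Longrightarrow> (x \<oplus>\<^bsub>P\<^esub> x', m \<oplus>\<^bsub>M\<^esub> m') \<in> T"
    and smult: "\<And>r x m. r \<in> carrier R \<Longrightarrow> (x, m) \<in> T \<Longrightarrow> (r \<odot>\<^bsub>P\<^esub> x, r \<odot>\<^bsub>M\<^esub> m) \<in> T"
    and total: "\<And>x. x \<in> carrier P \<Longrightarrow> \<exists>m. (x, m) \<in> T"
  shows "\<exists>h. linear_map R P M h \<and> (\<forall>x\<in>carrier P. (x, h x) \<in> T)"
proof -
  interpret P: left_module R P using proj by (simp add: projective_module_def)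
  interpret M: left_module R M by fact
  obtain I :: "'p set" and s p where s: "s \<in> module_hom R P (free_module R I)"
    and p: "p \<in> module_hom R (free_module R I) P" and ps: "\<forall>x\<in>carrier P. p (s x) = x"
    using proj unfolding projective_module_def by blast
  let ?F = "free_module R I"
  have sl: "linear_map R P ?F s" and pl: "linear_map R ?F P p"
    using s p by (simp_all add: module_hom_iff)
  have F_carrier: "u \<in> carrier ?F \<longleftrightarrow> u \<in> I \<rightarrow>\<^sub>E carrier R \<and> finite {i \<in> I. u i \<noteq> \<zero>\<^bsub>R\<^esub>}" for u
    by (simp add: free_module_def)
  define e where "e i = (\<lambda>j\<in>I. if j = i then \<one>\<^bsub>R\<^esub> else \<zero>\<^bsub>R\<^esub>)" for i
  have e: "e i \<in> carrier ?F" if "i \<in> I" for i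
    unfolding F_carrier e_def by (auto intro: finite_subset[of _ "{i}"])
  have "\<forall>i\<in>I. \<exists>m. (p (e i), m) \<in> T"
    using total linear_map_closed[OF pl e] by blast
  then obtain m where m: "\<And>i. i \<in> I \<Longrightarrow> (p (e i), m i) \<in> T" by metis
  have mM: "m i \<in> carrier M" if "i \<in> I" for i using m[OF that] sub by auto
  \<comment> \<open>\<open>P\<close> is split into the free module by \<open>s\<close>, and the
    basis vector \<open>e i\<close> is sent to the partner \<open>m i\<close> chosen for its image.
    Choices on a basis are free, so linearity costs nothing.\<close>
  define h where "h x = finsum M (\<lambda>i. s x i \<odot>\<^bsub>M\<^esub> m i) {i \<in> I. s x i \<noteq> \<zero>\<^bsub>R\<^esub>}" for x
  have sR: "s x i \<in> carrier R" if "x \<in> carrier P" "i \<in> I" for x i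
    using linear_map_closed[OF sl that(1)] that(2) by (auto simp: F_carrier)
  have sfin: "finite {i \<in> I. s x i \<noteq> \<zero>\<^bsub>R\<^esub>}" if "x \<in> carrier P" for x
    using linear_map_closed[OF sl that] by (simp add: F_carrier)
  have h_eq: "h x = finsum M (\<lambda>i. s x i \<odot>\<^bsub>M\<^esub> m i) S"
    if "x \<in> carrier P" "finite S" "S \<subseteq> I" "{i \<in> I. s x i \<noteq> \<zero>\<^bsub>R\<^esub>} \<subseteq> S" for x S
    unfolding h_def
    by (rule M.add.finprod_mono_neutral_cong_left)
       (use that sR mM in \<open>auto intro!: M.smult_closed simp: M.smult_zero_left\<close>)
  have in_T: "(p v, finsum M (\<lambda>i. v i \<odot>\<^bsub>M\<^esub> m i) S) \<in> T"
    if "finite S" "S \<subseteq> I" "v \<in> carrier ?F" "{i \<in> I. v i \<noteq> \<zero>\<^bsub>R\<^esub>} \<subseteq> S" for v S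
    using that
  proof (induction S arbitrary: v rule: finite_induct)
    case empty
    have "v = (\<lambda>i\<in>I. \<zero>\<^bsub>R\<^esub> \<otimes>\<^bsub>R\<^esub> v i)"
      using empty by (fastforce simp: F_carrier PiE_def extensional_def restrict_def)
    then have "v = \<zero>\<^bsub>R\<^esub> \<odot>\<^bsub>?F\<^esub> v" by (simp add: free_module_def)
    then have "p v = \<zero>\<^bsub>R\<^esub> \<odot>\<^bsub>P\<^esub> p v"
      using linear_map_smult[OF pl, of "\<zero>\<^bsub>R\<^esub>" v] empty by simp
    then have pv: "p v = \<zero>\<^bsub>P\<^esub>"
      using linear_map_closed[OF pl] empty by (simp add: P.smult_zero_left)
    \<comment> \<open>\<open>T\<close> is only assumed closed under sums and scalars; the pair of
      zeros arises by multiplying some pair over zero by zero.\<close>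
    obtain m0 where "(\<zero>\<^bsub>P\<^esub>, m0) \<in> T" using total by blast
    then have "(\<zero>\<^bsub>R\<^esub> \<odot>\<^bsub>P\<^esub> \<zero>\<^bsub>P\<^esub>, \<zero>\<^bsub>R\<^esub> \<odot>\<^bsub>M\<^esub> m0) \<in> T" "m0 \<in> carrier M" using smult sub by auto
    then show ?case by (simp add: pv P.smult_zero_left M.smult_zero_left)
  next
    case (insert j S)
    \<comment> \<open>With coordinate \<open>j\<close> deleted, the rest is supported in
      \<open>S\<close> and falls under the induction hypothesis; the deleted part is a multiple of a
      basis vector.\<close>
    define w where "w = (\<lambda>i\<in>I. if i = j then \<zero>\<^bsub>R\<^esub> else v i)"
    have j: "j \<in> I" and vj: "v j \<in> carrier R" using insert by (auto simp: F_carrier)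
    have "{i \<in> I. w i \<noteq> \<zero>\<^bsub>R\<^esub>} \<subseteq> {i \<in> I. v i \<noteq> \<zero>\<^bsub>R\<^esub>}" by (auto simp: w_def)
    then have "finite {i \<in> I. w i \<noteq> \<zero>\<^bsub>R\<^esub>}"
      using insert.prems(2) unfolding F_carrier by (blast intro: finite_subset)
    moreover have "w \<in> I \<rightarrow>\<^sub>E carrier R"
      using insert.prems(2) by (auto simp: F_carrier w_def)
    ultimately have w: "w \<in> carrier ?F" by (simp add: F_carrier)
    have wT: "(p w, finsum M (\<lambda>i. w i \<odot>\<^bsub>M\<^esub> m i) S) \<in> T"
    proof (rule insert.IH)
      show "S \<subseteq> I" using insert.prems by auto
      show "{i \<in> I. w i \<noteq> \<zero>\<^bsub>R\<^esub>} \<subseteq> S" using insert.prems by (auto simp: w_def)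
    qed (rule w)
    have ve: "v j \<odot>\<^bsub>?F\<^esub> e j \<in> carrier ?F"
      using j vj by (auto simp: free_module_def e_def intro: finite_subset[of _ "{j}"])
    have "v = w \<oplus>\<^bsub>?F\<^esub> (v j \<odot>\<^bsub>?F\<^esub> e j)"
      using insert.prems(2) j vj unfolding F_carrier
      by (auto simp: free_module_def w_def e_def fun_eq_iff PiE_def extensional_def Pi_def)
    then have pv: "p v = p w \<oplus>\<^bsub>P\<^esub> (v j \<odot>\<^bsub>P\<^esub> p (e j))"
      using linear_map_add[OF pl w ve] linear_map_smult[OF pl vj e[OF j]] by simp
    have vS: "v i \<in> carrier R" if "i \<in> S" for i
      using insert.prems that by (auto simp: F_carrier)
    have "finsum M (\<lambda>i. v i \<odot>\<^bsub>M\<^esub> m i) (insert j S)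
        = (v j \<odot>\<^bsub>M\<^esub> m j) \<oplus>\<^bsub>M\<^esub> finsum M (\<lambda>i. v i \<odot>\<^bsub>M\<^esub> m i) S"
      using insert.hyps insert.prems vj vS mM j
      by (subst M.finsum_insert) (auto intro!: M.smult_closed)
    also have "finsum M (\<lambda>i. v i \<odot>\<^bsub>M\<^esub> m i) S = finsum M (\<lambda>i. w i \<odot>\<^bsub>M\<^esub> m i) S"
      by (rule M.add.finprod_cong')
         (use insert.hyps insert.prems vS mM in \<open>auto simp: w_def intro!: M.smult_closed\<close>)
    finally have fs: "finsum M (\<lambda>i. v i \<odot>\<^bsub>M\<^esub> m i) (insert j S)
        = (v j \<odot>\<^bsub>M\<^esub> m j) \<oplus>\<^bsub>M\<^esub> finsum M (\<lambda>i. w i \<odot>\<^bsub>M\<^esub> m i) S" .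
    have c1: "p w \<in> carrier P" "p (e j) \<in> carrier P" using pl w e[OF j] by (simp_all add: linear_map_closed)
    have "(v j \<odot>\<^bsub>P\<^esub> p (e j) \<oplus>\<^bsub>P\<^esub> p w, v j \<odot>\<^bsub>M\<^esub> m j \<oplus>\<^bsub>M\<^esub> finsum M (\<lambda>i. w i \<odot>\<^bsub>M\<^esub> m i) S) \<in> T"
      using add[OF smult[OF vj m[OF j]] wT] .
    then show ?case
      using c1 vj by (simp add: pv fs P.a_comm P.smult_closed)
  qed
  have "(x, h x) \<in> T" if "x \<in> carrier P" for x
    using in_T[of "{i \<in> I. s x i \<noteq> \<zero>\<^bsub>R\<^esub>}" "s x"] sfin[OF that] linear_map_closed[OF sl that] ps that
    by (simp add: h_def)
  moreover have "linear_map R P M h"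
    unfolding linear_map_def
  proof (intro conjI ballI)
    fix x assume "x \<in> carrier P"
    then show "h x \<in> carrier M"
      unfolding h_def by (intro M.finsum_closed) (auto intro!: M.smult_closed sR mM)
  next
    fix x y assume xy: "x \<in> carrier P" "y \<in> carrier P"
    let ?S = "{i \<in> I. s x i \<noteq> \<zero>\<^bsub>R\<^esub>} \<union> {i \<in> I. s y i \<noteq> \<zero>\<^bsub>R\<^esub>}"
    have sxy: "s (x \<oplus>\<^bsub>P\<^esub> y) i = s x i \<oplus>\<^bsub>R\<^esub> s y i" if "i \<in> I" for i
      using linear_map_add[OF sl xy] that by (simp add: free_module_def)
    have S: "finite ?S" "?S \<subseteq> I" using sfin xy by auto
    have "h (x \<oplus>\<^bsub>P\<^esub> y) = finsum M (\<lambda>i. s (x \<oplus>\<^bsub>P\<^esub> y) i \<odot>\<^bsub>M\<^esub> m i) ?S"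
      by (rule h_eq) (use xy S sxy in auto)
    also have "\<dots> = finsum M (\<lambda>i. (s x i \<odot>\<^bsub>M\<^esub> m i) \<oplus>\<^bsub>M\<^esub> (s y i \<odot>\<^bsub>M\<^esub> m i)) ?S"
      by (rule M.add.finprod_cong')
         (use xy sR mM sxy in \<open>auto simp: M.smult_l_distr intro!: M.smult_closed\<close>)
    also have "\<dots> = finsum M (\<lambda>i. s x i \<odot>\<^bsub>M\<^esub> m i) ?S \<oplus>\<^bsub>M\<^esub> finsum M (\<lambda>i. s y i \<odot>\<^bsub>M\<^esub> m i) ?S"
      by (rule M.finsum_addf) (use xy sR mM in \<open>auto intro!: M.smult_closed\<close>)
    also have "\<dots> = h x \<oplus>\<^bsub>M\<^esub> h y"
      using h_eq[OF xy(1) S] h_eq[OF xy(2) S] by simp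
    finally show "h (x \<oplus>\<^bsub>P\<^esub> y) = h x \<oplus>\<^bsub>M\<^esub> h y" .
  next
    fix r x assume r: "r \<in> carrier R" and x: "x \<in> carrier P"
    let ?S = "{i \<in> I. s x i \<noteq> \<zero>\<^bsub>R\<^esub>}"
    have sx: "s (r \<odot>\<^bsub>P\<^esub> x) i = r \<otimes>\<^bsub>R\<^esub> s x i" if "i \<in> I" for i
      using linear_map_smult[OF sl r x] that by (simp add: free_module_def)
    have "h (r \<odot>\<^bsub>P\<^esub> x) = finsum M (\<lambda>i. s (r \<odot>\<^bsub>P\<^esub> x) i \<odot>\<^bsub>M\<^esub> m i) ?S"
      by (rule h_eq) (use r x sfin sx in \<open>auto intro!: P.smult_closed\<close>)
    also have "\<dots> = finsum M (\<lambda>i. r \<odot>\<^bsub>M\<^esub> (s x i \<odot>\<^bsub>M\<^esub> m i)) ?S"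
      by (rule M.add.finprod_cong')
         (use x r sR mM sx in \<open>auto simp: M.smult_assoc intro!: M.smult_closed\<close>)
    also have "\<dots> = r \<odot>\<^bsub>M\<^esub> h x"
      unfolding h_def
      by (rule M.smult_finsum[symmetric]) (use x r sR mM sfin in \<open>auto intro!: M.smult_closed\<close>)
    finally show "h (r \<odot>\<^bsub>P\<^esub> x) = r \<odot>\<^bsub>M\<^esub> h x" .
  qed
  ultimately show ?thesis by blast
qed

section \<open>Resolutions of the trivial module\<close>

locale augmented_ring = ring A for A :: "'a ring" (structure) +
  fixes \<eta> :: "'k::field \<Rightarrow> 'a" and \<epsilon> :: "'a \<Rightarrow> 'k"
  assumes unit_closed [simp]: "\<eta> k \<in> carrier A"
    and unit_central: "r \<in> carrier A \<Longrightarrow> \<eta> k \<otimes> r = r \<otimes> \<eta> k"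
    and unit_add: "\<eta> (k + l) = \<eta> k \<oplus> \<eta> l"
    and unit_mult: "\<eta> (k * l) = \<eta> k \<otimes> \<eta> l"
    and unit_one: "\<eta> 1 = \<one>"
    and counit_add: "r \<in> carrier A \<Longrightarrow> s \<in> carrier A \<Longrightarrow> \<epsilon> (r \<oplus> s) = \<epsilon> r + \<epsilon> s"
    and counit_mult: "r \<in> carrier A \<Longrightarrow> s \<in> carrier A \<Longrightarrow> \<epsilon> (r \<otimes> s) = \<epsilon> r * \<epsilon> s"
    and counit_unit: "\<epsilon> (\<eta> k) = k"

lemma regular_left_module:
  assumes "ring R" shows "left_module R (regular_module R)"
proof -
  interpret ring R by fact
  have "abelian_group (regular_module R)"
    by (rule abelian_groupI)
       (auto simp: regular_module_def a_ac intro: bexI[of _ "\<ominus>\<^bsub>R\<^esub> _"] l_neg)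
  then show ?thesis
    by (intro left_module.intro left_module_axioms.intro ring_axioms)
       (auto simp: regular_module_def l_distr r_distr m_assoc)
qed

section \<open>Congruence modulo left ideals, and one step of a regular sequence\<close>

context ring
begin

definition left_ideal :: "'a set \<Rightarrow> bool"
  where "left_ideal I \<longleftrightarrow> I \<subseteq> carrier R \<and> \<zero> \<in> I \<and>
    (\<forall>x\<in>I. \<forall>y\<in>I. x \<oplus> y \<in> I) \<and> (\<forall>r\<in>carrier R. \<forall>x\<in>I. r \<otimes> x \<in> I)"

text \<open>Equality in the quotient by \<open>I\<close> without forming it. Membership of both
  sides is built in, so that chains of congruences need no side conditions.\<close>

definition left_cong :: "'a set \<Rightarrow> 'a \<Rightarrow> 'a \<Rightarrow> bool"
  where "left_cong I x y \<longleftrightarrow> x \<in> carrier R \<and> y \<in> carrier R \<and> x \<ominus> y \<in> I"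

lemma left_ideal_zero_set: "left_ideal {\<zero>}"
  by (simp add: left_ideal_def)

lemma left_ideal_uminus: "left_ideal I \<Longrightarrow> x \<in> I \<Longrightarrow> \<ominus> x \<in> I"
  unfolding left_ideal_def by (metis l_minus l_one one_closed add.inv_closed subsetD)

context
  fixes I assumes I: "left_ideal I"
begin

lemma left_cong_refl: "x \<in> carrier R \<Longrightarrow> left_cong I x x"
  using I by (simp add: left_cong_def left_ideal_def minus_eq r_neg)

lemma left_cong_sym: "left_cong I x y \<Longrightarrow> left_cong I y x"
  using left_ideal_uminus[OF I, of "x \<ominus> y"]
  by (auto simp: left_cong_def minus_eq minus_add a_comm)

lemma left_cong_add:
  assumes "left_cong I x y" "left_cong I x' y'" shows "left_cong I (x \<oplus> x') (y \<oplus> y')"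
proof -
  have "x \<oplus> x' \<ominus> (y \<oplus> y') = (x \<ominus> y) \<oplus> (x' \<ominus> y')"
    using assms by (simp add: left_cong_def minus_eq minus_add a_ac)
  then show ?thesis using assms I by (simp add: left_cong_def left_ideal_def)
qed

lemma left_cong_uminus:
  assumes "left_cong I x y" shows "left_cong I (\<ominus> x) (\<ominus> y)"
proof -
  have "\<ominus> x \<ominus> (\<ominus> y) = \<ominus> (x \<ominus> y)"
    using assms by (simp add: left_cong_def minus_eq minus_add)
  then show ?thesis using assms left_ideal_uminus[OF I] by (simp add: left_cong_def)
qed

lemma left_cong_minus:
  "left_cong I x y \<Longrightarrow> left_cong I x' y' \<Longrightarrow> left_cong I (x \<ominus> x') (y \<ominus> y')"
  by (simp add: minus_eq left_cong_add left_cong_uminus)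

lemma left_cong_trans:
  assumes "left_cong I x y" "left_cong I y z" shows "left_cong I x z"
proof -
  have c: "x \<in> carrier R" "y \<in> carrier R" "z \<in> carrier R" using assms by (auto simp: left_cong_def)
  then have "x \<ominus> z = (x \<ominus> y) \<oplus> (y \<ominus> z)"
    by (simp add: minus_eq a_assoc r_neg2 add.inv_solve_left' r_neg1)
  then show ?thesis using assms I by (simp add: left_cong_def left_ideal_def)
qed

lemma left_cong_mult:
  assumes "left_cong I x y" "r \<in> carrier R" shows "left_cong I (r \<otimes> x) (r \<otimes> y)"
proof -
  have "r \<otimes> x \<ominus> r \<otimes> y = r \<otimes> (x \<ominus> y)"
    using assms by (simp add: left_cong_def minus_eq r_distr r_minus)
  then show ?thesis using assms I by (simp add: left_cong_def left_ideal_def)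
qed

lemma left_cong_zero_iff: "x \<in> carrier R \<Longrightarrow> left_cong I x \<zero> \<longleftrightarrow> x \<in> I"
  by (simp add: left_cong_def minus_eq)

lemma left_ideal_mem: "x \<in> I \<Longrightarrow> x \<in> carrier R"
  using I by (auto simp: left_ideal_def)

lemma left_cong_mem: "left_cong I x y \<Longrightarrow> y \<in> I \<Longrightarrow> x \<in> I"
  by (meson left_cong_zero_iff left_cong_def left_cong_trans left_ideal_mem)

end

lemma left_cong_mono: "I \<subseteq> J \<Longrightarrow> left_cong I x y \<Longrightarrow> left_cong J x y"
  by (auto simp: left_cong_def)

lemma left_cong_mult_right:
  assumes right: "\<And>x r. x \<in> I \<Longrightarrow> r \<in> carrier R \<Longrightarrow> x \<otimes> r \<in> I"
    and "left_cong I x y" "r \<in> carrier R"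
  shows "left_cong I (x \<otimes> r) (y \<otimes> r)"
proof -
  have "x \<otimes> r \<ominus> y \<otimes> r = (x \<ominus> y) \<otimes> r"
    using assms(2,3) by (simp add: left_cong_def minus_eq l_distr l_minus)
  then show ?thesis using assms(2,3) right by (simp add: left_cong_def)
qed

text \<open>Elementwise form of: \<open>t\<close> is central, regular on the quotient by
  \<open>I\<close>, and \<open>I' = I + t R\<close>. A regular sequence is thus a chain of ideals
  inside one fixed ring.\<close>

definition regular_extension :: "'a set \<Rightarrow> 'a \<Rightarrow> 'a set \<Rightarrow> bool"
  where "regular_extension I t I' \<longleftrightarrow> left_ideal I \<and> left_ideal I' \<and> I \<subseteq> I' \<and>
    t \<in> carrier R \<and> (\<forall>r\<in>carrier R. t \<otimes> r = r \<otimes> t) \<and>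
    (\<forall>r\<in>carrier R. t \<otimes> r \<in> I') \<and>
    (\<forall>x\<in>I'. \<exists>r\<in>carrier R. x \<ominus> t \<otimes> r \<in> I) \<and>
    (\<forall>r\<in>carrier R. t \<otimes> r \<in> I \<longrightarrow> r \<in> I)"

end

lemma (in abelian_group) add_minus_cancel:
  "x \<in> carrier G \<Longrightarrow> y \<in> carrier G \<Longrightarrow> (x \<ominus> y) \<oplus> y = x"
  by (simp add: minus_eq a_assoc l_neg)

lemma (in abelian_group) add_eq_iff_eq_minus:
  "x \<in> carrier G \<Longrightarrow> y \<in> carrier G \<Longrightarrow> z \<in> carrier G \<Longrightarrow> x \<oplus> y = z \<longleftrightarrow> x = z \<ominus> y"
  by (metis add_minus_cancel minus_eq add.m_assoc r_neg r_zero a_inv_closed)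

section \<open>Null-homotopies on a resolution of the trivial module\<close>

locale trivial_resolution = augmented_ring A \<eta> \<epsilon>
  for A :: "'a ring" (structure) and \<eta> :: "'k::field \<Rightarrow> 'a" and \<epsilon> :: "'a \<Rightarrow> 'k" +
  fixes P :: "nat \<Rightarrow> ('a, 'p) module" and d :: "nat \<Rightarrow> 'p \<Rightarrow> 'p" and aug :: "'p \<Rightarrow> 'k"
  assumes resolution: "projective_resolution A (trivial_module \<epsilon>) P d aug"
begin

lemma P_projective: "projective_module A (P i)"
  and d_linear: "linear_map A (P (Suc i)) (P i) (d i)"
  and aug_surj: "\<exists>x\<in>carrier (P 0). aug x = k"
  and exact_0: "x \<in> carrier (P 0) \<Longrightarrow> aug x = 0 \<Longrightarrow> \<exists>y\<in>carrier (P (Suc 0)). d 0 y = x"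
  and exact: "x \<in> carrier (P (Suc i)) \<Longrightarrow> d i x = \<zero>\<^bsub>P i\<^esub> \<Longrightarrow>
    \<exists>y\<in>carrier (P (Suc (Suc i))). d (Suc i) y = x"
  and aug_d: "y \<in> carrier (P (Suc 0)) \<Longrightarrow> aug (d 0 y) = 0"
  and d_d: "y \<in> carrier (P (Suc (Suc i))) \<Longrightarrow> d i (d (Suc i) y) = \<zero>\<^bsub>P i\<^esub>"
  and aug_add: "x \<in> carrier (P 0) \<Longrightarrow> x' \<in> carrier (P 0) \<Longrightarrow>
    aug (x \<oplus>\<^bsub>P 0\<^esub> x') = aug x + aug x'"
  and aug_smult: "r \<in> carrier A \<Longrightarrow> x \<in> carrier (P 0) \<Longrightarrow> aug (r \<odot>\<^bsub>P 0\<^esub> x) = \<epsilon> r * aug x"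
proof -
  note r = resolution[unfolded projective_resolution_def module_hom_iff]
  show "projective_module A (P i)" "linear_map A (P (Suc i)) (P i) (d i)" using r by auto
  have "linear_map A (P 0) (trivial_module \<epsilon>) aug" using r by auto
  then show "x \<in> carrier (P 0) \<Longrightarrow> x' \<in> carrier (P 0) \<Longrightarrow> aug (x \<oplus>\<^bsub>P 0\<^esub> x') = aug x + aug x'"
    "r \<in> carrier A \<Longrightarrow> x \<in> carrier (P 0) \<Longrightarrow> aug (r \<odot>\<^bsub>P 0\<^esub> x) = \<epsilon> r * aug x"
    by (simp_all add: linear_map_def trivial_module_def)
  have im: "aug ` carrier (P 0) = UNIV"
    "d 0 ` carrier (P (Suc 0)) = {x \<in> carrier (P 0). aug x = 0}"
    "d (Suc i) ` carrier (P (Suc (Suc i))) = {x \<in> carrier (P (Suc i)). d i x = \<zero>\<^bsub>P i\<^esub>}"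
    using r by (auto simp: trivial_module_def)
  show "\<exists>x\<in>carrier (P 0). aug x = k" using im(1) by (metis UNIV_I imageE)
  note im_iff = im(2,3)[unfolded set_eq_iff image_iff mem_Collect_eq]
  show "x \<in> carrier (P 0) \<Longrightarrow> aug x = 0 \<Longrightarrow> \<exists>y\<in>carrier (P (Suc 0)). d 0 y = x"
    using im_iff(1) by metis
  show "y \<in> carrier (P (Suc 0)) \<Longrightarrow> aug (d 0 y) = 0"
    using im_iff(1) by metis
  show "x \<in> carrier (P (Suc i)) \<Longrightarrow> d i x = \<zero>\<^bsub>P i\<^esub> \<Longrightarrow>
      \<exists>y\<in>carrier (P (Suc (Suc i))). d (Suc i) y = x"
    using im_iff(2) by metis
  show "y \<in> carrier (P (Suc (Suc i))) \<Longrightarrow> d i (d (Suc i) y) = \<zero>\<^bsub>P i\<^esub>"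
    using im_iff(2) by metis
qed

lemma P_module: "left_module A (P i)"
  using P_projective by (simp add: projective_module_def)

lemma P_abelian_group: "abelian_group (P i)"
  using P_module by (simp add: left_module_def)

lemmas P_add_closed [simp] = abelian_groupE(1)[OF P_abelian_group]
lemmas P_smult_closed [simp] = left_module.smult_closed[OF P_module]
lemmas d_closed [simp] = linear_map_closed[OF d_linear]
lemmas P_minus_closed [simp] = abelian_group.minus_closed[OF P_abelian_group]

text \<open>A homotopy \<open>d s + s d = t\<close> between multiplication by \<open>t\<close> and
  the zero map.\<close>

definition contraction :: "'a \<Rightarrow> (nat \<Rightarrow> 'p \<Rightarrow> 'p) \<Rightarrow> bool"
  where "contraction t s \<longleftrightarrow>
    (\<forall>i. linear_map A (P i) (P (Suc i)) (s i)) \<and>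
    (\<forall>x\<in>carrier (P 0). d 0 (s 0 x) = t \<odot>\<^bsub>P 0\<^esub> x) \<and>
    (\<forall>i. \<forall>x\<in>carrier (P (Suc i)).
       d (Suc i) (s (Suc i) x) \<oplus>\<^bsub>P (Suc i)\<^esub> s i (d i x) = t \<odot>\<^bsub>P (Suc i)\<^esub> x)"

lemma linear_map_minus:
  assumes "left_module A M" "left_module A N" "linear_map A M N f" "x \<in> carrier M" "y \<in> carrier M"
  shows "f (x \<ominus>\<^bsub>M\<^esub> y) = f x \<ominus>\<^bsub>N\<^esub> f y"
proof -
  interpret M: left_module A M by fact
  interpret N: left_module A N by fact
  have "f (x \<ominus>\<^bsub>M\<^esub> y) \<oplus>\<^bsub>N\<^esub> f y = f x"
    using assms M.add_minus_cancel[of x y] by (metis linear_map_add M.minus_closed)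
  then show ?thesis
    using assms by (simp add: N.add_eq_iff_eq_minus linear_map_closed)
qed

text \<open>Multiplication by \<open>t\<close> and the zero map both lift the zero map of the
  trivial module, so they are homotopic. In each degree exactness solves the homotopy equation
  pointwise, and projectivity makes the solution linear.\<close>

lemma contraction_exists:
  assumes t: "t \<in> carrier A" and central: "\<And>r. r \<in> carrier A \<Longrightarrow> t \<otimes> r = r \<otimes> t" and \<epsilon>t: "\<epsilon> t = 0"
  shows "\<exists>s. contraction t s"
proof -
  \<comment> \<open>The last clause is the invariant that lets the recursion continue: it says that
    \<open>t x - s (d x)\<close> is a cycle in the next degree.\<close>
  let ?key = "\<lambda>i s. linear_map A (P i) (P (Suc i)) s \<and>
    (i = 0 \<longrightarrow> (\<forall>x\<in>carrier (P 0). d 0 (s x) = t \<odot>\<^bsub>P 0\<^esub> x)) \<and>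
    (\<forall>x\<in>carrier (P (Suc i)). d i (s (d i x)) = t \<odot>\<^bsub>P i\<^esub> d i x)"
  let ?step = "\<lambda>i s s'. \<forall>x\<in>carrier (P (Suc i)).
       d (Suc i) (s' x) \<oplus>\<^bsub>P (Suc i)\<^esub> s (d i x) = t \<odot>\<^bsub>P (Suc i)\<^esub> x"
  have t_comm: "r \<odot>\<^bsub>P i\<^esub> (t \<odot>\<^bsub>P i\<^esub> x) = t \<odot>\<^bsub>P i\<^esub> (r \<odot>\<^bsub>P i\<^esub> x)"
    if "r \<in> carrier A" "x \<in> carrier (P i)" for r x i
    using that t by (simp add: left_module.smult_assoc[OF P_module, symmetric] central)
  have "\<exists>s. \<forall>i. ?key i (s i) \<and> ?step i (s i) (s (Suc i))"
  proof (rule dependent_nat_choice)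
    interpret P0: left_module A "P 0" by (rule P_module)
    interpret P1: left_module A "P 1" by (rule P_module)
    let ?T = "{(x, m). x \<in> carrier (P 0) \<and> m \<in> carrier (P 1) \<and> d 0 m = t \<odot>\<^bsub>P 0\<^esub> x}"
    have "\<exists>s. linear_map A (P 0) (P 1) s \<and> (\<forall>x\<in>carrier (P 0). (x, s x) \<in> ?T)"
    proof (rule projective_linear_selection[OF P_projective P_module])
      fix x assume x: "x \<in> carrier (P 0)"
      then have "aug (t \<odot>\<^bsub>P 0\<^esub> x) = 0" using t by (simp add: aug_smult \<epsilon>t)
      then show "\<exists>m. (x, m) \<in> ?T" using exact_0[of "t \<odot>\<^bsub>P 0\<^esub> x"] x t by auto
    next
      fix r x m assume r: "r \<in> carrier A" and "(x, m) \<in> ?T"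
      then show "(r \<odot>\<^bsub>P 0\<^esub> x, r \<odot>\<^bsub>P 1\<^esub> m) \<in> ?T"
        using linear_map_smult[OF d_linear r, of m 0] t_comm[OF r, of x 0] by simp
    next
      fix x m x' m' assume "(x, m) \<in> ?T" "(x', m') \<in> ?T"
      then show "(x \<oplus>\<^bsub>P 0\<^esub> x', m \<oplus>\<^bsub>P 1\<^esub> m') \<in> ?T"
        using linear_map_add[OF d_linear, of m 0 m'] t by (simp add: P0.smult_r_distr)
    qed auto
    then obtain s where s: "linear_map A (P 0) (P 1) s"
      "\<And>x. x \<in> carrier (P 0) \<Longrightarrow> d 0 (s x) = t \<odot>\<^bsub>P 0\<^esub> x" by auto
    then have "?key 0 s" by simp
    then show "\<exists>s. ?key 0 s" by blast
  next
    fix s i assume key: "?key i s"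
    interpret P0: left_module A "P i" by (rule P_module)
    interpret P1: left_module A "P (Suc i)" by (rule P_module)
    interpret P2: left_module A "P (Suc (Suc i))" by (rule P_module)
    have s: "linear_map A (P i) (P (Suc i)) s"
      and sd: "\<And>x. x \<in> carrier (P (Suc i)) \<Longrightarrow> d i (s (d i x)) = t \<odot>\<^bsub>P i\<^esub> d i x"
      using key by auto
    note [simp] = linear_map_closed[OF s]
    let ?T = "{(x, m). x \<in> carrier (P (Suc i)) \<and> m \<in> carrier (P (Suc (Suc i))) \<and>
       d (Suc i) m \<oplus>\<^bsub>P (Suc i)\<^esub> s (d i x) = t \<odot>\<^bsub>P (Suc i)\<^esub> x}"
    have "\<exists>s'. linear_map A (P (Suc i)) (P (Suc (Suc i))) s' \<and> (\<forall>x\<in>carrier (P (Suc i)). (x, s' x) \<in> ?T)"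
    proof (rule projective_linear_selection[OF P_projective P_module])
      fix x assume x: "x \<in> carrier (P (Suc i))"
      \<comment> \<open>The value that \<open>d (Suc i) (s' x)\<close> must take; by the invariant
        it is a cycle, hence a boundary.\<close>
      let ?y = "t \<odot>\<^bsub>P (Suc i)\<^esub> x \<ominus>\<^bsub>P (Suc i)\<^esub> s (d i x)"
      have "d i ?y = \<zero>\<^bsub>P i\<^esub>"
        using x t sd[OF x] linear_map_minus[OF P_module P_module d_linear, of "t \<odot>\<^bsub>P (Suc i)\<^esub> x" i "s (d i x)"]
        by (simp add: linear_map_smult[OF d_linear] P0.minus_eq P0.r_neg)
      then obtain m where "m \<in> carrier (P (Suc (Suc i)))" "d (Suc i) m = ?y"
        using exact[of ?y i] x t by auto
      then show "\<exists>m. (x, m) \<in> ?T" using x t by (auto simp: P1.add_minus_cancel)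
    next
      fix r x m assume r: "r \<in> carrier A" and "(x, m) \<in> ?T"
      then have x: "x \<in> carrier (P (Suc i))" and m: "m \<in> carrier (P (Suc (Suc i)))"
        and e: "d (Suc i) m \<oplus>\<^bsub>P (Suc i)\<^esub> s (d i x) = t \<odot>\<^bsub>P (Suc i)\<^esub> x" by auto
      have "d (Suc i) (r \<odot>\<^bsub>P (Suc (Suc i))\<^esub> m) \<oplus>\<^bsub>P (Suc i)\<^esub> s (d i (r \<odot>\<^bsub>P (Suc i)\<^esub> x))
          = r \<odot>\<^bsub>P (Suc i)\<^esub> (d (Suc i) m \<oplus>\<^bsub>P (Suc i)\<^esub> s (d i x))"
        using r x m by (simp add: linear_map_smult[OF d_linear] linear_map_smult[OF s] P1.smult_r_distr)
      then show "(r \<odot>\<^bsub>P (Suc i)\<^esub> x, r \<odot>\<^bsub>P (Suc (Suc i))\<^esub> m) \<in> ?T"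
        using r x m e t_comm by simp
    next
      fix x m x' m' assume "(x, m) \<in> ?T" "(x', m') \<in> ?T"
      then have x: "x \<in> carrier (P (Suc i))" and m: "m \<in> carrier (P (Suc (Suc i)))"
        and x': "x' \<in> carrier (P (Suc i))" and m': "m' \<in> carrier (P (Suc (Suc i)))"
        and e: "d (Suc i) m \<oplus>\<^bsub>P (Suc i)\<^esub> s (d i x) = t \<odot>\<^bsub>P (Suc i)\<^esub> x"
        and e': "d (Suc i) m' \<oplus>\<^bsub>P (Suc i)\<^esub> s (d i x') = t \<odot>\<^bsub>P (Suc i)\<^esub> x'" by auto
      have "d (Suc i) (m \<oplus>\<^bsub>P (Suc (Suc i))\<^esub> m') \<oplus>\<^bsub>P (Suc i)\<^esub> s (d i (x \<oplus>\<^bsub>P (Suc i)\<^esub> x'))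
        = (d (Suc i) m \<oplus>\<^bsub>P (Suc i)\<^esub> s (d i x)) \<oplus>\<^bsub>P (Suc i)\<^esub> (d (Suc i) m' \<oplus>\<^bsub>P (Suc i)\<^esub> s (d i x'))"
        using x x' m m'
        by (simp add: linear_map_add[OF d_linear] linear_map_add[OF s] P1.a_ac)
      then show "(x \<oplus>\<^bsub>P (Suc i)\<^esub> x', m \<oplus>\<^bsub>P (Suc (Suc i))\<^esub> m') \<in> ?T"
        using x x' m m' t by (simp add: e e' P1.smult_r_distr)
    qed auto
    then obtain s' where s': "linear_map A (P (Suc i)) (P (Suc (Suc i))) s'"
      "\<And>x. x \<in> carrier (P (Suc i)) \<Longrightarrow>
         d (Suc i) (s' x) \<oplus>\<^bsub>P (Suc i)\<^esub> s (d i x) = t \<odot>\<^bsub>P (Suc i)\<^esub> x" by auto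
    \<comment> \<open>On boundaries the correction \<open>s (d i x)\<close> drops out because
      \<open>d d = 0\<close>, which restores the invariant.\<close>
    have "d (Suc i) (s' (d (Suc i) x)) = t \<odot>\<^bsub>P (Suc i)\<^esub> d (Suc i) x"
      if x: "x \<in> carrier (P (Suc (Suc i)))" for x
      using s'(2)[OF d_closed[OF x]] linear_map_zero[OF P_module P_module s] x
      by (simp add: d_d linear_map_closed[OF s'(1)])
    then have "?key (Suc i) s' \<and> ?step i s s'" using s' by simp
    then show "\<exists>s'. ?key (Suc i) s' \<and> ?step i s s'" by blast
  qed
  then show ?thesis unfolding contraction_def by (metis (no_types, lifting))
qed

end

context ring
begin

lemma regular_extensionD:
  assumes "regular_extension I t I'"
  shows "left_ideal I" "left_ideal I'" "I \<subseteq> I'" "t \<in> carrier R"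
    "r \<in> carrier R \<Longrightarrow> t \<otimes> r = r \<otimes> t" "r \<in> carrier R \<Longrightarrow> t \<otimes> r \<in> I'"
    "x \<in> I' \<Longrightarrow> \<exists>r\<in>carrier R. x \<ominus> t \<otimes> r \<in> I"
    "r \<in> carrier R \<Longrightarrow> t \<otimes> r \<in> I \<Longrightarrow> r \<in> I"
  using assms unfolding regular_extension_def by blast+

end

context augmented_ring
begin

text \<open>Equivalently, \<open>\<Lambda>\<close> represents the image of \<open>1\<close> under a
  module map from the trivial module to the quotient of \<open>A\<close> by
  \<open>I\<close>.\<close>

definition left_integral :: "'a set \<Rightarrow> 'a \<Rightarrow> bool"
  where "left_integral I \<Lambda> \<longleftrightarrow> \<Lambda> \<in> carrier A \<and> (\<forall>r\<in>carrier A. left_cong I (r \<otimes> \<Lambda>) (\<eta> (\<epsilon> r) \<otimes> \<Lambda>))"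

end

section \<open>Rees's change of rings, one degree at a time\<close>

context trivial_resolution
begin

abbreviation (input) cochain :: "nat \<Rightarrow> ('p \<Rightarrow> 'a) \<Rightarrow> bool"
  where "cochain i f \<equiv> linear_map A (P i) (regular_module A) f"

lemma cochain_iff:
  "cochain i f \<longleftrightarrow> (\<forall>x\<in>carrier (P i). f x \<in> carrier A) \<and>
    (\<forall>x\<in>carrier (P i). \<forall>y\<in>carrier (P i). f (x \<oplus>\<^bsub>P i\<^esub> y) = f x \<oplus> f y) \<and>
    (\<forall>r\<in>carrier A. \<forall>x\<in>carrier (P i). f (r \<odot>\<^bsub>P i\<^esub> x) = r \<otimes> f x)"
  by (simp add: linear_map_def regular_module_def)

lemma cochain_closed: "cochain i f \<Longrightarrow> x \<in> carrier (P i) \<Longrightarrow> f x \<in> carrier A"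
  and cochain_add: "cochain i f \<Longrightarrow> x \<in> carrier (P i) \<Longrightarrow> y \<in> carrier (P i) \<Longrightarrow>
    f (x \<oplus>\<^bsub>P i\<^esub> y) = f x \<oplus> f y"
  and cochain_smult: "cochain i f \<Longrightarrow> r \<in> carrier A \<Longrightarrow> x \<in> carrier (P i) \<Longrightarrow>
    f (r \<odot>\<^bsub>P i\<^esub> x) = r \<otimes> f x"
  by (simp_all add: cochain_iff)

lemma cochain_zero: "cochain i f \<Longrightarrow> f \<zero>\<^bsub>P i\<^esub> = \<zero>"
  using linear_map_zero[OF P_module regular_left_module[OF ring_axioms]]
  by (simp add: regular_module_def)

lemma cochain_minus:
  assumes "cochain i f" "x \<in> carrier (P i)" "y \<in> carrier (P i)"
  shows "f (x \<ominus>\<^bsub>P i\<^esub> y) = f x \<ominus> f y"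
proof -
  interpret M: left_module A "P i" by (rule P_module)
  have "f (x \<ominus>\<^bsub>P i\<^esub> y) \<oplus> f y = f x"
    using assms M.add_minus_cancel[of x y] by (metis cochain_add M.minus_closed)
  then show ?thesis
    using assms by (simp add: add_eq_iff_eq_minus cochain_closed)
qed

lemma cochain_diff: "cochain i f \<Longrightarrow> cochain i g \<Longrightarrow> cochain i (\<lambda>x. f x \<ominus> g x)"
  by (simp add: cochain_iff minus_eq minus_add a_ac r_distr r_minus)

text \<open>A cochain with values in the quotient by \<open>I\<close> lifts to \<open>A\<close>
  because the terms of the resolution are projective; hence \<open>A\<close>-valued maps with
  conditions modulo \<open>I\<close> compute the same cohomology.\<close>

definition cocycle :: "'a set \<Rightarrow> nat \<Rightarrow> ('p \<Rightarrow> 'a) \<Rightarrow> bool"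
  where "cocycle I i f \<longleftrightarrow> cochain i f \<and> (\<forall>x\<in>carrier (P (Suc i)). f (d i x) \<in> I)"

fun coboundary :: "'a set \<Rightarrow> nat \<Rightarrow> ('p \<Rightarrow> 'a) \<Rightarrow> bool"
  where
    "coboundary I 0 f \<longleftrightarrow> (\<forall>x\<in>carrier (P 0). f x \<in> I)"
  | "coboundary I (Suc i) f \<longleftrightarrow>
      (\<exists>g. cochain i g \<and> (\<forall>x\<in>carrier (P (Suc i)). left_cong I (f x) (g (d i x))))"

text \<open>Each value is divisible by \<open>t\<close> modulo \<open>I\<close>; projectivity
  selects the quotients linearly.\<close>

lemma decompose_cochain:
  assumes ext: "regular_extension I t I'" and f: "cochain i f"
    and f_mem: "\<And>x. x \<in> carrier (P i) \<Longrightarrow> f x \<in> I'"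
  shows "\<exists>v. cochain i v \<and> (\<forall>x\<in>carrier (P i). left_cong I (f x) (t \<otimes> v x))"
proof -
  note I = regular_extensionD(1)[OF ext] and t = regular_extensionD(4)[OF ext]
    and central = regular_extensionD(5)[OF ext] and dec = regular_extensionD(7)[OF ext]
  let ?T = "{(x, m). x \<in> carrier (P i) \<and> m \<in> carrier A \<and> left_cong I (f x) (t \<otimes> m)}"
  have "\<exists>v. cochain i v \<and> (\<forall>x\<in>carrier (P i). (x, v x) \<in> ?T)"
  proof (rule projective_linear_selection[OF P_projective regular_left_module[OF ring_axioms]])
    show "?T \<subseteq> carrier (P i) \<times> carrier (regular_module A)" by (auto simp: regular_module_def)
  next
    fix x assume x: "x \<in> carrier (P i)"
    then show "\<exists>m. (x, m) \<in> ?T"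
      using dec[OF f_mem[OF x]] cochain_closed[OF f] t by (auto simp: left_cong_def)
  next
    fix r x m assume r: "r \<in> carrier A" and "(x, m) \<in> ?T"
    then have xm: "x \<in> carrier (P i)" "m \<in> carrier A" "left_cong I (f x) (t \<otimes> m)" by auto
    have "r \<otimes> (t \<otimes> m) = t \<otimes> (r \<otimes> m)"
      using r xm t by (metis central m_assoc)
    then show "(r \<odot>\<^bsub>P i\<^esub> x, r \<odot>\<^bsub>regular_module A\<^esub> m) \<in> ?T"
      using left_cong_mult[OF I xm(3) r] r xm by (simp add: regular_module_def cochain_smult[OF f])
  next
    fix x m x' m' assume "(x, m) \<in> ?T" "(x', m') \<in> ?T"
    then have xm: "x \<in> carrier (P i)" "m \<in> carrier A" "left_cong I (f x) (t \<otimes> m)"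
      "x' \<in> carrier (P i)" "m' \<in> carrier A" "left_cong I (f x') (t \<otimes> m')" by auto
    then show "(x \<oplus>\<^bsub>P i\<^esub> x', m \<oplus>\<^bsub>regular_module A\<^esub> m') \<in> ?T"
      using left_cong_add[OF I xm(3) xm(6)] t by (simp add: regular_module_def cochain_add[OF f] r_distr)
  qed
  then show ?thesis by auto
qed

text \<open>Modulo \<open>I'\<close> the cochain \<open>w\<close> has the form \<open>g d\<close>.
  The difference \<open>w - g d\<close> is divisible by \<open>t\<close> modulo \<open>I\<close>,
  and \<open>g d\<close> dies on boundaries, so there \<open>w\<close> itself is divisible. In
  degree zero there is no \<open>g\<close>.\<close>

lemma divide_coboundary:
  assumes ext: "regular_extension I t I'" and w: "cochain i w" and cob: "coboundary I' i w"
  shows "\<exists>v. cochain i v \<and> (\<forall>x\<in>carrier (P (Suc i)). left_cong I (w (d i x)) (t \<otimes> v (d i x)))"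
proof (cases i)
  case 0
  then show ?thesis using decompose_cochain[OF ext w] cob by auto
next
  case (Suc j)
  then obtain g where g: "cochain j g"
    and wg: "\<And>x. x \<in> carrier (P i) \<Longrightarrow> left_cong I' (w x) (g (d j x))" using cob by auto
  have gd: "cochain i (\<lambda>x. g (d j x))" using linear_map_comp[OF d_linear g] Suc by simp
  obtain v where v: "cochain i v"
    and e: "\<And>x. x \<in> carrier (P i) \<Longrightarrow> left_cong I (w x \<ominus> g (d j x)) (t \<otimes> v x)"
    using decompose_cochain[OF ext cochain_diff[OF w gd]] wg by (auto simp: left_cong_def)
  have "left_cong I (w (d i x)) (t \<otimes> v (d i x))" if x: "x \<in> carrier (P (Suc i))" for x
    using e[of "d i x"] x cochain_zero[OF g] d_d[of x j] cochain_closed[OF w, of "d i x"]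
    by (simp add: Suc minus_eq)
  then show ?thesis using v by blast
qed

context
  fixes I t I' s
  assumes ext: "regular_extension I t I'" and contr: "contraction t s"
begin

lemmas I_ideal = regular_extensionD(1)[OF ext] and I'_ideal = regular_extensionD(2)[OF ext]
  and I_sub = regular_extensionD(3)[OF ext] and t_closed = regular_extensionD(4)[OF ext]
  and t_mem = regular_extensionD(6)[OF ext]
  and t_regular = regular_extensionD(8)[OF ext]

lemma s_linear: "linear_map A (P i) (P (Suc i)) (s i)"
  and s_0: "x \<in> carrier (P 0) \<Longrightarrow> d 0 (s 0 x) = t \<odot>\<^bsub>P 0\<^esub> x"
  and s_Suc: "x \<in> carrier (P (Suc i)) \<Longrightarrow>
       d (Suc i) (s (Suc i) x) \<oplus>\<^bsub>P (Suc i)\<^esub> s i (d i x) = t \<odot>\<^bsub>P (Suc i)\<^esub> x"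
  using contr by (auto simp: contraction_def)

lemmas s_closed = linear_map_closed[OF s_linear]

lemma t_left_cong_cancel:
  assumes "x \<in> carrier A" "y \<in> carrier A" "left_cong I (t \<otimes> x) (t \<otimes> y)"
  shows "left_cong I x y"
proof -
  have "t \<otimes> (x \<ominus> y) = t \<otimes> x \<ominus> t \<otimes> y"
    using assms t_closed by (simp add: minus_eq r_distr r_minus)
  then show ?thesis using assms t_regular[of "x \<ominus> y"] by (simp add: left_cong_def)
qed

lemma cochain_s_Suc:
  assumes "cochain (Suc i) f" "x \<in> carrier (P (Suc i))"
  shows "f (d (Suc i) (s (Suc i) x)) \<oplus> f (s i (d i x)) = t \<otimes> f x"
  using arg_cong[OF s_Suc[OF assms(2)], of f] assms t_closed
  by (simp add: cochain_add[OF assms(1)] cochain_smult[OF assms(1)] s_closed)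

text \<open>\<open>f s d = t f - f d s\<close>, and both terms on the right have values in
  \<open>I'\<close>.\<close>

lemma cocycle_step:
  assumes f: "cocycle I (Suc i) f"
  shows "cocycle I' i (\<lambda>x. f (s i x))"
  unfolding cocycle_def
proof (intro conjI ballI)
  have fc: "cochain (Suc i) f" using f by (simp add: cocycle_def)
  show "cochain i (\<lambda>x. f (s i x))" using linear_map_comp[OF s_linear fc] .
  fix x assume x: "x \<in> carrier (P (Suc i))"
  have "f (d (Suc i) (s (Suc i) x)) \<in> I'"
    using f x I_sub by (auto simp: cocycle_def s_closed)
  moreover have "f (s i (d i x)) = t \<otimes> f x \<ominus> f (d (Suc i) (s (Suc i) x))"
    using cochain_s_Suc[OF fc x] x fc t_closed
    by (metis a_comm add_eq_iff_eq_minus cochain_closed d_closed s_closed m_closed)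
  moreover have "t \<otimes> f x \<in> I'" using t_mem x fc by (simp add: cochain_closed)
  ultimately show "f (s i (d i x)) \<in> I'"
    using I'_ideal left_ideal_uminus[OF I'_ideal] by (simp add: minus_eq left_ideal_def)
qed

text \<open>If \<open>f\<close> is \<open>g d\<close> modulo \<open>I\<close>, then
  \<open>f s\<close> is \<open>g d s = t g - g s d\<close>, so \<open>- g s\<close> is a primitive
  modulo \<open>I'\<close>. In degree zero the last term is absent.\<close>

lemma coboundary_step:
  assumes fc: "cochain (Suc i) f" and f: "coboundary I (Suc i) f"
  shows "coboundary I' i (\<lambda>x. f (s i x))"
proof -
  obtain g where g: "cochain i g"
    and fg: "\<And>x. x \<in> carrier (P (Suc i)) \<Longrightarrow> left_cong I (f x) (g (d i x))" using f by auto
  have fsg: "left_cong I' (f (s i x)) (g (d i (s i x)))" if "x \<in> carrier (P i)" for x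
    using left_cong_mono[OF I_sub fg] that by (simp add: s_closed)
  show ?thesis
  proof (cases i)
    case 0
    have "f (s i x) \<in> I'" if x: "x \<in> carrier (P i)" for x
    proof (rule left_cong_mem[OF I'_ideal fsg[OF x]])
      show "g (d i (s i x)) \<in> I'"
        using x s_0[of x] g t_closed t_mem
        by (simp add: 0 cochain_smult[of 0] cochain_closed[of 0])
    qed
    then show ?thesis by (simp add: 0)
  next
    case (Suc j)
    have gs: "cochain j (\<lambda>x. \<ominus> g (s j x))"
      using linear_map_comp[OF s_linear, of j] g Suc s_closed
      by (simp add: cochain_iff minus_add r_minus linear_map_add[OF s_linear] linear_map_smult[OF s_linear])
    have "left_cong I' (f (s i x)) (\<ominus> g (s j (d j x)))" if x: "x \<in> carrier (P i)" for x
    proof (rule left_cong_trans[OF I'_ideal fsg[OF x]])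
      have c: "g (d i (s i x)) \<in> carrier A" "g (s j (d j x)) \<in> carrier A" "t \<otimes> g x \<in> I'" "t \<otimes> g x \<in> carrier A"
        using x g t_closed t_mem by (simp_all add: Suc cochain_closed[of "Suc j"] s_closed)
      have "g (d i (s i x)) \<ominus> (\<ominus> g (s j (d j x))) = t \<otimes> g x"
        using cochain_s_Suc[of j g x] g x c by (simp add: Suc minus_eq)
      then show "left_cong I' (g (d i (s i x))) (\<ominus> g (s j (d j x)))"
        using c by (simp add: left_cong_def)
    qed
    then show ?thesis using gs by (auto simp: Suc)
  qed
qed

text \<open>In \<open>t f = f d s + f s d\<close> the first term lies in \<open>I\<close> and the
  second is \<open>t v d\<close> modulo \<open>I\<close>; cancelling \<open>t\<close> makes
  \<open>v\<close> a primitive of \<open>f\<close>.\<close>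

lemma step_injective:
  assumes f: "cocycle I (Suc i) f" and cob: "coboundary I' i (\<lambda>x. f (s i x))"
  shows "coboundary I (Suc i) f"
proof -
  have fc: "cochain (Suc i) f" using f by (simp add: cocycle_def)
  obtain v where v: "cochain i v"
    and e: "\<And>x. x \<in> carrier (P (Suc i)) \<Longrightarrow> left_cong I (f (s i (d i x))) (t \<otimes> v (d i x))"
    using divide_coboundary[OF ext linear_map_comp[OF s_linear fc] cob] by auto
  have "left_cong I (f x) (v (d i x))" if x: "x \<in> carrier (P (Suc i))" for x
  proof (rule t_left_cong_cancel)
    show "f x \<in> carrier A" "v (d i x) \<in> carrier A" using x fc v by (simp_all add: cochain_closed)
    have c: "f (d (Suc i) (s (Suc i) x)) \<in> I" "f (d (Suc i) (s (Suc i) x)) \<in> carrier A"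
      "v (d i x) \<in> carrier A"
      using f x v fc by (auto simp: cocycle_def s_closed cochain_closed)
    have "left_cong I (f (d (Suc i) (s (Suc i) x)) \<oplus> f (s i (d i x))) (\<zero> \<oplus> t \<otimes> v (d i x))"
      by (intro left_cong_add I_ideal e x) (use c in \<open>simp add: left_cong_zero_iff[OF I_ideal]\<close>)
    then show "left_cong I (t \<otimes> f x) (t \<otimes> v (d i x))"
      using c t_closed by (simp add: cochain_s_Suc[OF fc x])
  qed
  then show ?thesis using v by auto
qed

text \<open>The preimage \<open>f\<close> is \<open>h d\<close> divided by \<open>t\<close>, as for
  a connecting homomorphism. Then \<open>t (h - f s)\<close> is \<open>h s d\<close> modulo
  \<open>I\<close>, where \<open>h s\<close> is a cocycle one degree lower. The vanishing assumption
  makes it a coboundary, so \<open>h s d\<close> is \<open>t\<close> times some \<open>v d\<close>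
  and \<open>t\<close> cancels.\<close>

lemma step_surjective:
  assumes h: "cocycle I' i h"
    and vanish: "\<And>j w. i = Suc j \<Longrightarrow> cocycle I' j w \<Longrightarrow> coboundary I' j w"
  shows "\<exists>f. cocycle I (Suc i) f \<and> coboundary I' i (\<lambda>x. h x \<ominus> f (s i x))"
proof -
  have hc: "cochain i h" using h by (simp add: cocycle_def)
  obtain f where fc: "cochain (Suc i) f"
    and hf: "\<And>x. x \<in> carrier (P (Suc i)) \<Longrightarrow> left_cong I (h (d i x)) (t \<otimes> f x)"
    using decompose_cochain[OF ext linear_map_comp[OF d_linear hc]] h by (auto simp: cocycle_def)
  have "cocycle I (Suc i) f"
    unfolding cocycle_def
  proof (intro conjI ballI fc)
    fix x assume x: "x \<in> carrier (P (Suc (Suc i)))"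
    then have c: "f (d (Suc i) x) \<in> carrier A" using fc by (simp add: cochain_closed)
    have "left_cong I \<zero> (t \<otimes> f (d (Suc i) x))"
      using hf[of "d (Suc i) x"] x d_d[OF x] cochain_zero[OF hc] by simp
    then have "t \<otimes> f (d (Suc i) x) \<in> I"
      using left_cong_sym[OF I_ideal] c t_closed by (metis left_cong_zero_iff[OF I_ideal] m_closed)
    then show "f (d (Suc i) x) \<in> I" using t_regular c by simp
  qed
  moreover have "coboundary I' i (\<lambda>x. h x \<ominus> f (s i x))"
  proof (cases i)
    case 0
    have "left_cong I (h x) (f (s i x))" if x: "x \<in> carrier (P i)" for x
    proof (rule t_left_cong_cancel)
      show c: "h x \<in> carrier A" "f (s i x) \<in> carrier A" using x hc fc by (simp_all add: cochain_closed s_closed)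
      show "left_cong I (t \<otimes> h x) (t \<otimes> f (s i x))"
        using hf[of "s i x"] x s_0[of x] hc t_closed by (simp add: 0 s_closed cochain_smult[of 0])
    qed
    then show ?thesis using I_sub by (auto simp: 0 left_cong_def)
  next
    case (Suc j)
    let ?w = "\<lambda>x. h (s j x)"
    have hc': "cochain (Suc j) h" using hc Suc by simp
    have wc: "cochain j ?w" using linear_map_comp[OF s_linear hc'] .
    have hds: "h (s j (d j x)) = t \<otimes> h x \<ominus> h (d i (s i x))" if x: "x \<in> carrier (P i)" for x
      using cochain_s_Suc[OF hc', of x] x hc t_closed unfolding Suc
      by (metis a_comm add_eq_iff_eq_minus cochain_closed d_closed s_closed m_closed)
    have "cocycle I' j ?w"
      unfolding cocycle_def
    proof (intro conjI ballI wc)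
      fix x assume x: "x \<in> carrier (P (Suc j))"
      then have "t \<otimes> h x \<in> I'" "h (d i (s i x)) \<in> I'"
        using h hc' t_mem by (auto simp: Suc cocycle_def cochain_closed s_closed)
      then show "h (s j (d j x)) \<in> I'"
        using hds[of x] x I'_ideal left_ideal_uminus[OF I'_ideal]
        by (simp add: Suc minus_eq left_ideal_def)
    qed
    then obtain v where v: "cochain j v"
      and e: "\<And>x. x \<in> carrier (P (Suc j)) \<Longrightarrow> left_cong I (h (s j (d j x))) (t \<otimes> v (d j x))"
      using divide_coboundary[OF ext wc vanish[OF Suc]] by auto
    have "left_cong I (h x \<ominus> f (s i x)) (v (d j x))" if x: "x \<in> carrier (P i)" for x
    proof (rule t_left_cong_cancel)
      have x': "x \<in> carrier (P (Suc j))" using x Suc by simp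
      have c: "h x \<in> carrier A" "f (s i x) \<in> carrier A" "v (d j x) \<in> carrier A" "h (d i (s i x)) \<in> carrier A"
        using x x' v hc fc by (simp_all add: cochain_closed s_closed)
      then show "h x \<ominus> f (s i x) \<in> carrier A" "v (d j x) \<in> carrier A" by simp_all
      have "left_cong I (h (d i (s i x))) (t \<otimes> f (s i x))"
        using hf[of "s i x"] x by (simp add: s_closed)
      then have "left_cong I (t \<otimes> h x \<ominus> h (d i (s i x))) (t \<otimes> h x \<ominus> t \<otimes> f (s i x))"
        using c t_closed by (intro left_cong_minus left_cong_refl I_ideal) simp_all
      moreover have "t \<otimes> h x \<ominus> t \<otimes> f (s i x) = t \<otimes> (h x \<ominus> f (s i x))"
        using c t_closed by (simp add: minus_eq r_distr r_minus)
      ultimately have "left_cong I (h (s j (d j x))) (t \<otimes> (h x \<ominus> f (s i x)))"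
        using hds[OF x] by simp
      then show "left_cong I (t \<otimes> (h x \<ominus> f (s i x))) (t \<otimes> v (d j x))"
        using left_cong_trans[OF I_ideal left_cong_sym[OF I_ideal]] e[OF x'] by blast
    qed
    then show ?thesis using v left_cong_mono[OF I_sub] by (auto simp: Suc)
  qed
  ultimately show ?thesis by blast
qed

text \<open>The trivial module is killed by \<open>t\<close>, which is regular modulo
  \<open>I\<close>; concretely \<open>t h = h d s\<close> has values in \<open>I\<close>.\<close>

lemma cocycle_0_vanish:
  assumes "cocycle I 0 h" shows "coboundary I 0 h"
proof -
  have hc: "cochain 0 h" using assms by (simp add: cocycle_def)
  have "h x \<in> I" if x: "x \<in> carrier (P 0)" for x
  proof (rule t_regular)
    have "h (d 0 (s 0 x)) \<in> I" using assms x by (simp add: cocycle_def s_closed)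
    then show "t \<otimes> h x \<in> I" using x t_closed by (simp add: s_0 cochain_smult[OF hc])
  qed (use x hc in \<open>simp add: cochain_closed\<close>)
  then show ?thesis by simp
qed

end

text \<open>Three steps of Rees's change of rings turn \<open>Ext\<^sup>3(K, A)\<close> into \<open>Hom(K, A/I\<^sub>3)\<close>; the resulting
  isomorphism is evaluation at one element \<open>z\<close> of the third term of the resolution.\<close>

theorem Ext3_eq_integrals:
  assumes e1: "regular_extension {\<zero>} t1 I1" and e2: "regular_extension I1 t2 I2"
    and e3: "regular_extension I2 t3 I3"
    and \<epsilon>: "\<epsilon> t1 = 0" "\<epsilon> t2 = 0" "\<epsilon> t3 = 0"
  shows "\<exists>z\<in>carrier (P 3).
    (\<forall>f. cocycle {\<zero>} 3 f \<longrightarrow> left_integral I3 (f z) \<and> (f z \<in> I3 \<longleftrightarrow> coboundary {\<zero>} 3 f)) \<and>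
    (\<forall>\<Lambda>. left_integral I3 \<Lambda> \<longrightarrow> (\<exists>f. cocycle {\<zero>} 3 f \<and> left_cong I3 (f z) \<Lambda>))"
proof -
  obtain s1 where s1: "contraction t1 s1" using contraction_exists[OF regular_extensionD(4,5)[OF e1] \<epsilon>(1)] by blast
  obtain s2 where s2: "contraction t2 s2" using contraction_exists[OF regular_extensionD(4,5)[OF e2] \<epsilon>(2)] by blast
  obtain s3 where s3: "contraction t3 s3" using contraction_exists[OF regular_extensionD(4,5)[OF e3] \<epsilon>(3)] by blast
  note I = regular_extensionD(1)[OF e2] regular_extensionD(1,2)[OF e3]
  obtain p0 where p0: "p0 \<in> carrier (P 0)" "aug p0 = 1" using aug_surj by blast
  \<comment> \<open>Each step replaces a cocycle by its composite with a homotopy, beginning with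
    \<open>t1\<close>; on the element \<open>p0\<close> of augmentation one the homotopies therefore
    stack up in reverse order.\<close>
  define z where "z = s1 2 (s2 1 (s3 0 p0))"
  have z: "z \<in> carrier (P 3)"
    using p0(1) s_closed[OF e1 s1, of _ 2] s_closed[OF e2 s2, of _ 1] s_closed[OF e3 s3, of _ 0]
    by (simp add: z_def numeral_2_eq_2 numeral_3_eq_3)
  \<comment> \<open>Modulo boundaries every element of \<open>P 0\<close> is a scalar multiple of
    \<open>p0\<close>, so a cocycle of degree zero is determined by its value there.\<close>
  have diff_aug: "x \<ominus>\<^bsub>P 0\<^esub> \<eta> (aug x) \<odot>\<^bsub>P 0\<^esub> p0 \<in> d 0 ` carrier (P 1)" if x: "x \<in> carrier (P 0)" for x
  proof -
    interpret M: left_module A "P 0" by (rule P_module)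
    let ?y = "x \<ominus>\<^bsub>P 0\<^esub> \<eta> (aug x) \<odot>\<^bsub>P 0\<^esub> p0"
    have y: "?y \<in> carrier (P 0)" using x p0 by simp
    have "aug (?y \<oplus>\<^bsub>P 0\<^esub> \<eta> (aug x) \<odot>\<^bsub>P 0\<^esub> p0) = aug ?y + aug x"
      using y p0 by (simp add: aug_add aug_smult counit_unit)
    then have "aug ?y = 0" using x p0 by (simp add: M.add_minus_cancel)
    then obtain u where "u \<in> carrier (P 1)" "d 0 u = ?y" using exact_0[OF y] by auto
    then show ?thesis by (metis image_eqI)
  qed
  have h_cong: "left_cong I3 (h x) (\<eta> (aug x) \<otimes> h p0)" if "cocycle I3 0 h" "x \<in> carrier (P 0)" for h x
  proof -
    have hc: "cochain 0 h" using that by (simp add: cocycle_def)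
    have "h (x \<ominus>\<^bsub>P 0\<^esub> \<eta> (aug x) \<odot>\<^bsub>P 0\<^esub> p0) \<in> I3"
      using diff_aug[OF that(2)] that(1) by (auto simp: cocycle_def)
    then show ?thesis
      using that p0 hc
      by (simp add: cochain_minus[OF hc] cochain_smult[OF hc] left_cong_def cochain_closed)
  qed
  have h_integral: "left_integral I3 (h p0)" if "cocycle I3 0 h" for h
    unfolding left_integral_def
  proof (intro conjI ballI)
    have hc: "cochain 0 h" using that by (simp add: cocycle_def)
    show "h p0 \<in> carrier A" using hc p0 by (simp add: cochain_closed)
    fix r assume r: "r \<in> carrier A"
    show "left_cong I3 (r \<otimes> h p0) (\<eta> (\<epsilon> r) \<otimes> h p0)"
      using h_cong[OF that, of "r \<odot>\<^bsub>P 0\<^esub> p0"] r p0 by (simp add: cochain_smult[OF hc] aug_smult)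
  qed
  have h_cob: "h p0 \<in> I3 \<longleftrightarrow> coboundary I3 0 h" if "cocycle I3 0 h" for h
  proof
    assume "h p0 \<in> I3"
    then have "\<eta> (aug x) \<otimes> h p0 \<in> I3" for x using I(3) by (simp add: left_ideal_def)
    then show "coboundary I3 0 h" using h_cong[OF that] left_cong_mem[OF I(3)] by auto
  qed (use p0 in simp)
  have h_exists: "\<exists>h. cocycle I3 0 h \<and> left_cong I3 (h p0) \<Lambda>" if "left_integral I3 \<Lambda>" for \<Lambda>
  proof -
    have \<Lambda>: "\<Lambda> \<in> carrier A" and int: "\<And>r. r \<in> carrier A \<Longrightarrow> left_cong I3 (r \<otimes> \<Lambda>) (\<eta> (\<epsilon> r) \<otimes> \<Lambda>)"
      using that by (auto simp: left_integral_def)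
    \<comment> \<open>The map taking \<open>x\<close> to
      \<open>\<eta> (aug x) \<otimes> \<Lambda>\<close> is linear only modulo \<open>I3\<close>,
      since \<open>\<Lambda>\<close> is an integral only modulo \<open>I3\<close>; projectivity
      replaces it by a linear map congruent to it.\<close>
    let ?T = "{(x, m). x \<in> carrier (P 0) \<and> m \<in> carrier A \<and> left_cong I3 m (\<eta> (aug x) \<otimes> \<Lambda>)}"
    have "\<exists>h. cochain 0 h \<and> (\<forall>x\<in>carrier (P 0). (x, h x) \<in> ?T)"
    proof (rule projective_linear_selection[OF P_projective regular_left_module[OF ring_axioms]])
      show "?T \<subseteq> carrier (P 0) \<times> carrier (regular_module A)" by (auto simp: regular_module_def)
    next
      fix x assume "x \<in> carrier (P 0)"
      then have "(x, \<eta> (aug x) \<otimes> \<Lambda>) \<in> ?T" using \<Lambda> left_cong_refl[OF I(3)] by simp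
      then show "\<exists>m. (x, m) \<in> ?T" ..
    next
      fix r x m assume r: "r \<in> carrier A" and "(x, m) \<in> ?T"
      then have xm: "x \<in> carrier (P 0)" "m \<in> carrier A" "left_cong I3 m (\<eta> (aug x) \<otimes> \<Lambda>)" by auto
      have "left_cong I3 (r \<otimes> m) (r \<otimes> (\<eta> (aug x) \<otimes> \<Lambda>))" using left_cong_mult[OF I(3) xm(3) r] .
      also have "r \<otimes> (\<eta> (aug x) \<otimes> \<Lambda>) = \<eta> (aug x) \<otimes> (r \<otimes> \<Lambda>)"
        using r \<Lambda> by (metis unit_central unit_closed m_assoc)
      finally have 1: "left_cong I3 (r \<otimes> m) (\<eta> (aug x) \<otimes> (r \<otimes> \<Lambda>))" .
      have 2: "left_cong I3 (\<eta> (aug x) \<otimes> (r \<otimes> \<Lambda>)) (\<eta> (aug x) \<otimes> (\<eta> (\<epsilon> r) \<otimes> \<Lambda>))"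
        using left_cong_mult[OF I(3) int[OF r]] by simp
      have "\<eta> (aug x) \<otimes> (\<eta> (\<epsilon> r) \<otimes> \<Lambda>) = \<eta> (\<epsilon> r * aug x) \<otimes> \<Lambda>"
        using \<Lambda> by (simp add: m_assoc[symmetric] unit_mult[symmetric] mult.commute)
      then show "(r \<odot>\<^bsub>P 0\<^esub> x, r \<odot>\<^bsub>regular_module A\<^esub> m) \<in> ?T"
        using left_cong_trans[OF I(3) 1 2] r xm by (simp add: regular_module_def aug_smult)
    next
      fix x m x' m' assume "(x, m) \<in> ?T" "(x', m') \<in> ?T"
      then have xm: "x \<in> carrier (P 0)" "m \<in> carrier A" "left_cong I3 m (\<eta> (aug x) \<otimes> \<Lambda>)"
        "x' \<in> carrier (P 0)" "m' \<in> carrier A" "left_cong I3 m' (\<eta> (aug x') \<otimes> \<Lambda>)" by auto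
      then show "(x \<oplus>\<^bsub>P 0\<^esub> x', m \<oplus>\<^bsub>regular_module A\<^esub> m') \<in> ?T"
        using left_cong_add[OF I(3) xm(3) xm(6)] \<Lambda>
        by (simp add: regular_module_def aug_add unit_add l_distr)
    qed
    then obtain h where h: "cochain 0 h"
      "\<And>x. x \<in> carrier (P 0) \<Longrightarrow> left_cong I3 (h x) (\<eta> (aug x) \<otimes> \<Lambda>)" by auto
    have "\<eta> 0 = \<zero>" using unit_add[of 0 0] by (metis add.right_neutral r_zero add.l_cancel zero_closed unit_closed)
    then have "h (d 0 x) \<in> I3" if "x \<in> carrier (P (Suc 0))" for x
      using h(2)[of "d 0 x"] that \<Lambda> h(1) by (simp add: aug_d cochain_closed left_cong_zero_iff[OF I(3)])
    then have "cocycle I3 0 h" using h(1) by (simp add: cocycle_def)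
    moreover have "left_cong I3 (h p0) \<Lambda>" using h(2)[OF p0(1)] p0 \<Lambda> by (simp add: unit_one)
    ultimately show ?thesis by blast
  qed
  \<comment> \<open>Surjectivity of the step for \<open>t1\<close> in degree two needs this
    vanishing in degree one. A step with \<open>t2\<close> lowers it to degree zero, where
    regularity of \<open>t3\<close> applies.\<close>
  have vanish1: "coboundary I1 1 w" if "cocycle I1 1 w" for w
  proof -
    have "cocycle I2 0 (\<lambda>x. w (s2 0 x))" using cocycle_step[OF e2 s2, of 0 w] that by simp
    then have "coboundary I2 0 (\<lambda>x. w (s2 0 x))" using cocycle_0_vanish[OF e3 s3] by blast
    then show ?thesis using step_injective[OF e2 s2, of 0 w] that by simp
  qed
  let ?c1 = "\<lambda>f x. f (s1 2 x)" let ?c2 = "\<lambda>f x. f (s2 1 x)" let ?c3 = "\<lambda>f x. f (s3 0 x)"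
  have down: "cocycle I1 2 (?c1 f)" "coboundary {\<zero>} 3 f \<longleftrightarrow> coboundary I1 2 (?c1 f)"
    if "cocycle {\<zero>} 3 f" for f
    using that cocycle_step[OF e1 s1, of 2 f] coboundary_step[OF e1 s1, of 2 f] step_injective[OF e1 s1, of 2 f]
    by (auto simp: cocycle_def numeral_3_eq_3 numeral_2_eq_2)
  have down2: "cocycle I2 1 (?c2 f)" "coboundary I1 2 f \<longleftrightarrow> coboundary I2 1 (?c2 f)"
    if "cocycle I1 2 f" for f
    using that cocycle_step[OF e2 s2, of 1 f] coboundary_step[OF e2 s2, of 1 f] step_injective[OF e2 s2, of 1 f]
    by (auto simp: cocycle_def numeral_2_eq_2)
  have down3: "cocycle I3 0 (?c3 f)" "coboundary I2 1 f \<longleftrightarrow> coboundary I3 0 (?c3 f)"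
    if "cocycle I2 1 f" for f
    using that cocycle_step[OF e3 s3, of 0 f] coboundary_step[OF e3 s3, of 0 f] step_injective[OF e3 s3, of 0 f]
    by (auto simp: cocycle_def)
  have A: "left_integral I3 (f z) \<and> (f z \<in> I3 \<longleftrightarrow> coboundary {\<zero>} 3 f)" if "cocycle {\<zero>} 3 f" for f
  proof -
    note 1 = down[OF that] note 2 = down2[OF 1(1)] note 3 = down3[OF 2(1)]
    have "f z = ?c3 (?c2 (?c1 f)) p0" by (simp add: z_def)
    then show ?thesis
      using h_integral[OF 3(1)] h_cob[OF 3(1)] 1(2) 2(2) 3(2) by simp
  qed
  have B: "\<exists>f. cocycle {\<zero>} 3 f \<and> left_cong I3 (f z) \<Lambda>" if "left_integral I3 \<Lambda>" for \<Lambda>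
  proof -
    obtain h where h: "cocycle I3 0 h" "left_cong I3 (h p0) \<Lambda>" using h_exists \<open>left_integral I3 \<Lambda>\<close> by blast
    obtain f2 where f2: "cocycle I2 1 f2" "coboundary I3 0 (\<lambda>x. h x \<ominus> f2 (s3 0 x))"
      using step_surjective[OF e3 s3 h(1)] by auto
    obtain f1 where f1: "cocycle I1 2 f1" "coboundary I2 1 (\<lambda>x. f2 x \<ominus> f1 (s2 1 x))"
      using step_surjective[OF e2 s2 f2(1)] cocycle_0_vanish[OF e3 s3] by (auto simp: numeral_2_eq_2)
    obtain f where f: "cocycle {\<zero>} 3 f" "coboundary I1 2 (\<lambda>x. f1 x \<ominus> f (s1 2 x))"
    proof -
      have "coboundary I1 j w" if "2 = Suc j" "cocycle I1 j w" for j w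
        using vanish1 that by (simp del: coboundary.simps add: numeral_2_eq_2)
      then have "\<exists>f. cocycle {\<zero>} (Suc 2) f \<and> coboundary I1 2 (\<lambda>x. f1 x \<ominus> f (s1 2 x))"
        by (rule step_surjective[OF e1 s1 f1(1)])
      then show ?thesis using that by (auto simp del: coboundary.simps)
    qed
    have c: "cochain 2 f1" "cochain 2 (?c1 f)" "cochain 1 f2" "cochain 1 (?c2 f1)"
      using f1 f2 down[OF f(1)] down2[OF f1(1)] by (auto simp: cocycle_def)
    have "coboundary I2 1 (?c2 (\<lambda>x. f1 x \<ominus> f (s1 2 x)))"
      using coboundary_step[OF e2 s2, of 1 "\<lambda>x. f1 x \<ominus> f (s1 2 x)"] f(2) cochain_diff[OF c(1,2)]
      by (simp add: numeral_2_eq_2)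
    then have b2: "coboundary I3 0 (?c3 (?c2 (\<lambda>x. f1 x \<ominus> f (s1 2 x))))"
      using coboundary_step[OF e3 s3, of 0 "?c2 (\<lambda>x. f1 x \<ominus> f (s1 2 x))"]
        linear_map_comp[OF s_linear[OF e2 s2, of 1], of "regular_module A" "\<lambda>x. f1 x \<ominus> f (s1 2 x)"] cochain_diff[OF c(1,2)]
      by (simp add: numeral_2_eq_2)
    have b1: "coboundary I3 0 (?c3 (\<lambda>x. f2 x \<ominus> f1 (s2 1 x)))"
      using coboundary_step[OF e3 s3, of 0 "\<lambda>x. f2 x \<ominus> f1 (s2 1 x)"] f1(2) cochain_diff[OF c(3,4)]
      by simp
    let ?y = "s3 0 p0"
    have y: "?y \<in> carrier (P 1)" "s2 1 ?y \<in> carrier (P 2)"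
      using p0(1) s_closed[OF e2 s2, of _ 1] s_closed[OF e3 s3, of _ 0] by (simp_all add: numeral_2_eq_2)
    have fc: "h p0 \<in> carrier A" "f2 ?y \<in> carrier A" "f1 (s2 1 ?y) \<in> carrier A" "f z \<in> carrier A"
      using h(2) y c f(1) z by (auto simp: left_cong_def cocycle_def cochain_closed)
    have "left_cong I3 (h p0) (f2 ?y)" "left_cong I3 (f2 ?y) (f1 (s2 1 ?y))" "left_cong I3 (f1 (s2 1 ?y)) (f z)"
      using f2(2) b1 b2 p0(1) fc by (simp_all add: left_cong_def z_def)
    then have "left_cong I3 (h p0) (f z)" using left_cong_trans[OF I(3)] by blast
    then show ?thesis
      using f(1) h(2) left_cong_trans[OF I(3)] left_cong_sym[OF I(3)] by blast
  qed
  show ?thesis using z A B by blast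
qed

end

section \<open>From a one-dimensional space of integrals to the bimodule \<open>Ext\<close>\<close>

locale unimodular_ring = augmented_ring A \<eta> \<epsilon>
  for A :: "'a ring" (structure) and \<eta> :: "'k::field \<Rightarrow> 'a" and \<epsilon> :: "'a \<Rightarrow> 'k" +
  fixes t1 t2 t3 :: 'a and I1 I2 I3 :: "'a set" and \<Lambda> :: 'a
  assumes extension1: "regular_extension {\<zero>} t1 I1"
    and extension2: "regular_extension I1 t2 I2"
    and extension3: "regular_extension I2 t3 I3"
    and counit_t: "\<epsilon> t1 = 0" "\<epsilon> t2 = 0" "\<epsilon> t3 = 0"
    and right_ideal: "x \<in> I3 \<Longrightarrow> r \<in> carrier A \<Longrightarrow> x \<otimes> r \<in> I3"
    and integral: "left_integral I3 \<Lambda>" and integral_nonzero: "\<Lambda> \<notin> I3"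
    and integral_unique: "left_integral I3 \<Gamma> \<Longrightarrow> \<exists>k. left_cong I3 \<Gamma> (\<eta> k \<otimes> \<Lambda>)"
    and integral_right: "r \<in> carrier A \<Longrightarrow> left_cong I3 (\<Lambda> \<otimes> r) (\<eta> (\<epsilon> r) \<otimes> \<Lambda>)"
begin

lemma I3_ideal: "left_ideal I3"
  using regular_extensionD(2)[OF extension3] .

lemma \<Lambda>_closed [simp]: "\<Lambda> \<in> carrier A"
  using integral by (simp add: left_integral_def)

lemma unit_zero: "\<eta> 0 = \<zero>"
  using unit_add[of 0 0] by (metis add.right_neutral r_zero add.l_cancel zero_closed unit_closed)

lemma unit_minus: "\<eta> (k - l) = \<eta> k \<ominus> \<eta> l"
  using unit_add[of "k - l" l] by (simp add: add_eq_iff_eq_minus[symmetric])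

lemma integral_coeff_unique:
  assumes "left_cong I3 (\<eta> k \<otimes> \<Lambda>) (\<eta> l \<otimes> \<Lambda>)" shows "k = l"
proof (rule ccontr)
  assume "k \<noteq> l"
  have "\<eta> (k - l) \<otimes> \<Lambda> \<in> I3"
    using assms by (simp add: left_cong_def unit_minus minus_eq l_distr l_minus)
  then have "\<eta> (inverse (k - l)) \<otimes> (\<eta> (k - l) \<otimes> \<Lambda>) \<in> I3"
    using I3_ideal by (simp add: left_ideal_def)
  also have "\<eta> (inverse (k - l)) \<otimes> (\<eta> (k - l) \<otimes> \<Lambda>) = \<Lambda>"
    using \<open>k \<noteq> l\<close> by (simp add: m_assoc[symmetric] unit_mult[symmetric] unit_one)
  finally show False using integral_nonzero by simp
qed

lemma I3_cong_mult_right: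
  "left_cong I3 x y \<Longrightarrow> r \<in> carrier A \<Longrightarrow> left_cong I3 (x \<otimes> r) (y \<otimes> r)"
  by (rule left_cong_mult_right) (auto intro: right_ideal)

text \<open>The value of a cocycle at \<open>z\<close> is congruent to a unique scalar multiple of
  \<open>\<Lambda>\<close>, and this scalar classifies its class. Right multiplication scales
  \<open>\<Lambda>\<close> by the counit, so both actions scale by the counit. Only the carrier of
  \<open>R\<close> matters: in the third claim \<open>A\<close> may be the opposite ring, where
  multiplication on the right is the left action of the original one.\<close>

theorem Ext3_bimodule_trivial:
  assumes res: "projective_resolution A (trivial_module \<epsilon>) P d aug" and R: "carrier R = carrier A"
  defines "scal \<equiv> \<lambda>h f. \<lambda>x\<in>carrier (P 3). f (\<eta> (\<epsilon> h) \<odot>\<^bsub>P 3\<^esub> x)"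
    and "rmul \<equiv> \<lambda>h f. \<lambda>x\<in>carrier (P 3). f x \<otimes> h"
  shows "bimodule_isomorphic R (Ext_bimodule A P d (regular_module A) 3 scal rmul) (trivial_bimodule \<epsilon>)"
    and "bimodule_isomorphic R (trivial_bimodule \<epsilon>) (Ext_bimodule A P d (regular_module A) 3 scal rmul)"
    and "bimodule_isomorphic R (Ext_bimodule A P d (regular_module A) 3 rmul scal) (trivial_bimodule \<epsilon>)"
proof -
  interpret trivial_resolution A \<eta> \<epsilon> P d aug by unfold_locales (rule res)
  define Z where "Z = Ext_cocycles A P d (regular_module A) 3"
  define B where "B = Ext_coboundaries A P d (regular_module A) 3"
  obtain z where z: "z \<in> carrier (P 3)"
    and zint: "\<And>f. cocycle {\<zero>} 3 f \<Longrightarrow> left_integral I3 (f z)"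
    and zcob: "\<And>f. cocycle {\<zero>} 3 f \<Longrightarrow> f z \<in> I3 \<longleftrightarrow> coboundary {\<zero>} 3 f"
    and zsurj: "\<And>\<Gamma>. left_integral I3 \<Gamma> \<Longrightarrow> \<exists>f. cocycle {\<zero>} 3 f \<and> left_cong I3 (f z) \<Gamma>"
    using Ext3_eq_integrals[OF extension1 extension2 extension3 counit_t] by blast
  have Z: "f \<in> carrier Z \<longleftrightarrow> cocycle {\<zero>} 3 f \<and> f \<in> extensional (carrier (P 3))" for f
    by (auto simp: Z_def Ext_cocycles_def cocycle_def module_hom_iff regular_module_def)
  have addZ: "f \<oplus>\<^bsub>Z\<^esub> g = (\<lambda>x\<in>carrier (P 3). f x \<oplus> g x)" for f g
    by (simp add: Z_def Ext_cocycles_def regular_module_def)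
  have restrict_cochain: "cochain i (restrict f (carrier (P i)))" if "cochain i f" for i f
    using linear_map_cong[OF P_module _ that, of "restrict f (carrier (P i))"] by simp
  have restrictZ: "restrict f (carrier (P 3)) \<in> carrier Z" if "cocycle {\<zero>} 3 f" for f
    using that restrict_cochain[of 3 f] by (auto simp: Z cocycle_def)
  have B: "f \<in> B \<longleftrightarrow> f \<in> extensional (carrier (P 3)) \<and> coboundary {\<zero>} 3 f" if fc: "cochain 3 f" for f
  proof
    assume "f \<in> B"
    then obtain g where g: "cochain 2 g" "f = compose (carrier (P 3)) g (d 2)"
      by (auto simp: B_def numeral_3_eq_3 numeral_2_eq_2 module_hom_iff)
    then have "left_cong {\<zero>} (f x) (g (d 2 x))" if "x \<in> carrier (P 3)" for x
      using that left_cong_refl[OF left_ideal_zero_set, of "g (d 2 x)"] cochain_closed[OF g(1)]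
        d_closed[of x 2]
      by (simp add: compose_def numeral_3_eq_3 numeral_2_eq_2)
    then show "f \<in> extensional (carrier (P 3)) \<and> coboundary {\<zero>} 3 f"
      using g by (auto simp: compose_def numeral_3_eq_3 numeral_2_eq_2)
  next
    assume f: "f \<in> extensional (carrier (P 3)) \<and> coboundary {\<zero>} 3 f"
    then obtain g where g: "cochain 2 g" "\<And>x. x \<in> carrier (P 3) \<Longrightarrow> left_cong {\<zero>} (f x) (g (d 2 x))"
      by (auto simp: numeral_3_eq_3 numeral_2_eq_2)
    have dc: "d 2 x \<in> carrier (P 2)" if "x \<in> carrier (P 3)" for x
      using d_closed[of x 2] that by simp
    have "f x = g (d 2 x)" if "x \<in> carrier (P 3)" for x
      using g(2)[OF that] by (auto simp: left_cong_def)
    then have "f = compose (carrier (P 3)) (restrict g (carrier (P 2))) (d 2)"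
      using f dc by (auto simp: compose_def extensional_def fun_eq_iff)
    moreover have "restrict g (carrier (P 2)) \<in> module_hom A (P 2) (regular_module A)"
      using restrict_cochain[OF g(1)] by (simp add: module_hom_iff)
    ultimately show "f \<in> B" by (auto simp: B_def numeral_3_eq_3 numeral_2_eq_2)
  qed
  have Zc: "cochain 3 f" if "f \<in> carrier Z" for f using that by (simp add: Z cocycle_def)
  have ZA: "f z \<in> carrier A" if "f \<in> carrier Z" for f using Zc[OF that] z by (simp add: cochain_closed)
  have ex1: "\<exists>k. left_cong I3 (f z) (\<eta> k \<otimes> \<Lambda>)" if "f \<in> carrier Z" for f
    using integral_unique zint that by (simp add: Z)
  define val where "val f = (SOME k. left_cong I3 (f z) (\<eta> k \<otimes> \<Lambda>))" for f
  have val: "left_cong I3 (f z) (\<eta> (val f) \<otimes> \<Lambda>)" if "f \<in> carrier Z" for f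
    unfolding val_def by (rule someI_ex[OF ex1[OF that]])
  have valI: "val f = k" if "f \<in> carrier Z" "left_cong I3 (f z) (\<eta> k \<otimes> \<Lambda>)" for f k
    using val[OF that(1)] that(2) integral_coeff_unique left_cong_trans[OF I3_ideal] left_cong_sym[OF I3_ideal]
    by blast
  have val_zero: "val f = 0 \<longleftrightarrow> f \<in> B" if "f \<in> carrier Z" for f
  proof -
    have "val f = 0 \<longleftrightarrow> left_cong I3 (f z) \<zero>"
      using val[OF that] valI[OF that, of 0] by (auto simp: unit_zero)
    then show ?thesis using zcob B[OF Zc[OF that]] that ZA[OF that] left_cong_zero_iff[OF I3_ideal] by (auto simp: Z)
  qed
  have add_closed: "f \<oplus>\<^bsub>Z\<^esub> g \<in> carrier Z" and val_add: "val (f \<oplus>\<^bsub>Z\<^esub> g) = val f + val g"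
    if "f \<in> carrier Z" "g \<in> carrier Z" for f g
  proof -
    have "cocycle {\<zero>} 3 (\<lambda>x. f x \<oplus> g x)"
      using that by (simp add: Z cocycle_def cochain_iff a_ac r_distr)
    from restrictZ[OF this] show c: "f \<oplus>\<^bsub>Z\<^esub> g \<in> carrier Z" by (simp add: addZ)
    show "val (f \<oplus>\<^bsub>Z\<^esub> g) = val f + val g"
      using left_cong_add[OF I3_ideal val val, OF that] z
      by (intro valI[OF c]) (simp add: addZ unit_add l_distr)
  qed
  have diff: "\<exists>b\<in>carrier Z. b \<oplus>\<^bsub>Z\<^esub> f = g" if "f \<in> carrier Z" "g \<in> carrier Z" for f g
  proof -
    have "cochain 3 (\<lambda>x. g x \<ominus> f x)" using cochain_diff Zc that by blast
    moreover have "g (d 3 x) \<ominus> f (d 3 x) = \<zero>" if "x \<in> carrier (P (Suc 3))" for x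
      using \<open>f \<in> carrier Z\<close> \<open>g \<in> carrier Z\<close> that by (simp add: Z cocycle_def minus_eq)
    ultimately have 1: "cocycle {\<zero>} 3 (\<lambda>x. g x \<ominus> f x)" by (simp add: cocycle_def)
    have "(restrict (\<lambda>x. g x \<ominus> f x) (carrier (P 3))) \<oplus>\<^bsub>Z\<^esub> f = g"
      using that cochain_closed[OF Zc] by (auto simp: addZ Z extensional_def fun_eq_iff add_minus_cancel)
    then show ?thesis using restrictZ[OF 1] by blast
  qed
  \<comment> \<open>The fibres of \<open>val\<close> turn out to be the cosets of \<open>B\<close>,
    so every operation on cosets becomes one on scalars.\<close>
  define fiber where "fiber k = {f \<in> carrier Z. val f = k}" for k
  have fiber_nonempty: "\<exists>f. f \<in> fiber k" for k
  proof -
    have "left_integral I3 (\<eta> k \<otimes> \<Lambda>)"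
      unfolding left_integral_def
    proof (intro conjI ballI)
      fix r assume r: "r \<in> carrier A"
      have "left_cong I3 (\<eta> k \<otimes> (r \<otimes> \<Lambda>)) (\<eta> k \<otimes> (\<eta> (\<epsilon> r) \<otimes> \<Lambda>))"
        using integral r by (intro left_cong_mult I3_ideal) (auto simp: left_integral_def)
      then show "left_cong I3 (r \<otimes> (\<eta> k \<otimes> \<Lambda>)) (\<eta> (\<epsilon> r) \<otimes> (\<eta> k \<otimes> \<Lambda>))"
        using r unit_central[OF r, of k] unit_central[OF unit_closed, of k "\<epsilon> r"]
        by (simp add: m_assoc[symmetric])
    qed simp
    then obtain f where f: "cocycle {\<zero>} 3 f" "left_cong I3 (f z) (\<eta> k \<otimes> \<Lambda>)" using zsurj by blast
    then have "val (restrict f (carrier (P 3))) = k" using z by (intro valI restrictZ) simp_all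
    then show ?thesis using restrictZ[OF f(1)] by (auto simp: fiber_def)
  qed
  have fiber_add: "(\<Union>f\<in>fiber k. \<Union>g\<in>fiber l. {f \<oplus>\<^bsub>Z\<^esub> g}) = fiber (k + l)" for k l
  proof
    show "(\<Union>f\<in>fiber k. \<Union>g\<in>fiber l. {f \<oplus>\<^bsub>Z\<^esub> g}) \<subseteq> fiber (k + l)"
      by (auto simp: fiber_def val_add add_closed)
    show "fiber (k + l) \<subseteq> (\<Union>f\<in>fiber k. \<Union>g\<in>fiber l. {f \<oplus>\<^bsub>Z\<^esub> g})"
    proof
      fix g assume g: "g \<in> fiber (k + l)"
      obtain f where f: "f \<in> fiber l" using fiber_nonempty by blast
      obtain b where b: "b \<in> carrier Z" "b \<oplus>\<^bsub>Z\<^esub> f = g" using diff f g by (auto simp: fiber_def)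
      then have "val b + l = k + l" using val_add[OF b(1), of f] f g by (simp add: fiber_def)
      then have "b \<in> fiber k" using b by (simp add: fiber_def)
      then show "g \<in> (\<Union>f\<in>fiber k. \<Union>g\<in>fiber l. {f \<oplus>\<^bsub>Z\<^esub> g})" using b f by blast
    qed
  qed
  have B_fiber: "B = fiber 0"
  proof -
    have "f \<in> carrier Z" if fB: "f \<in> B" for f
    proof -
      obtain g where g: "cochain 2 g" "f = compose (carrier (P 3)) g (d 2)"
        using fB by (auto simp: B_def numeral_3_eq_3 numeral_2_eq_2 module_hom_iff)
      have "cochain 3 (\<lambda>x. g (d 2 x))"
        using linear_map_comp[OF d_linear g(1)] by (simp add: numeral_3_eq_3 numeral_2_eq_2)
      moreover have "g (d 2 (d 3 x)) = \<zero>" if "x \<in> carrier (P (Suc 3))" for x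
        using d_d[of x 2] that cochain_zero[OF g(1)] by (simp add: numeral_3_eq_3 numeral_2_eq_2)
      ultimately have "cocycle {\<zero>} 3 (\<lambda>x. g (d 2 x))" by (simp add: cocycle_def)
      from restrictZ[OF this] show ?thesis by (simp add: g(2) compose_def)
    qed
    then show ?thesis using val_zero by (auto simp: fiber_def)
  qed
  have coset: "B +>\<^bsub>Z\<^esub> f = fiber (val f)" if fZ: "f \<in> carrier Z" for f
  proof
    show "B +>\<^bsub>Z\<^esub> f \<subseteq> fiber (val f)"
      using fZ by (auto simp: a_r_coset_def' B_fiber fiber_def val_add add_closed)
    show "fiber (val f) \<subseteq> B +>\<^bsub>Z\<^esub> f"
    proof
      fix g assume g: "g \<in> fiber (val f)"
      then obtain b where b: "b \<in> carrier Z" "b \<oplus>\<^bsub>Z\<^esub> f = g" using diff fZ by (auto simp: fiber_def)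
      then have "val b = 0" using val_add[OF b(1) fZ] g by (simp add: fiber_def)
      then show "g \<in> B +>\<^bsub>Z\<^esub> f" using b by (auto simp: a_r_coset_def' B_fiber fiber_def)
    qed
  qed
  have carrier: "a_rcosets\<^bsub>Z\<^esub> B = range fiber"
  proof
    show "a_rcosets\<^bsub>Z\<^esub> B \<subseteq> range fiber" using coset by (auto simp: A_RCOSETS_def')
    show "range fiber \<subseteq> a_rcosets\<^bsub>Z\<^esub> B"
    proof
      fix C assume "C \<in> range fiber"
      then obtain k where C: "C = fiber k" by blast
      obtain f where f: "f \<in> fiber k" using fiber_nonempty by blast
      then have "C = B +>\<^bsub>Z\<^esub> f" "f \<in> carrier Z" using coset[of f] C by (auto simp: fiber_def)
      then show "C \<in> a_rcosets\<^bsub>Z\<^esub> B" by (auto simp: A_RCOSETS_def')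
    qed
  qed
  have inj: "inj fiber"
  proof (rule injI)
    fix k l assume kl: "fiber k = fiber l"
    obtain f where "f \<in> fiber k" using fiber_nonempty by blast
    with kl show "k = l" by (auto simp: fiber_def)
  qed
  \<comment> \<open>The action on a coset is a union over its representatives; it is a single coset
    because all of them land in the same fibre.\<close>
  have act: "(\<Union>f\<in>fiber k. B +>\<^bsub>Z\<^esub> op f) = fiber l"
    if op: "\<And>f. f \<in> fiber k \<Longrightarrow> op f \<in> fiber l" for op k l
  proof -
    have "B +>\<^bsub>Z\<^esub> op f = fiber l" if "f \<in> fiber k" for f
      using op[OF that] coset[of "op f"] by (simp add: fiber_def)
    then show ?thesis using fiber_nonempty[of k] by auto
  qed
  have scal: "scal h f \<in> fiber (\<epsilon> h * k)" if "h \<in> carrier A" "f \<in> fiber k" for h f k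
  proof -
    have f: "f \<in> carrier Z" "val f = k" using that by (auto simp: fiber_def)
    note fc = Zc[OF f(1)]
    have fx: "f (\<eta> (\<epsilon> h) \<odot>\<^bsub>P 3\<^esub> x) = \<eta> (\<epsilon> h) \<otimes> f x" if "x \<in> carrier (P 3)" for x
      using that by (simp add: cochain_smult[OF fc])
    have "r \<otimes> (\<eta> (\<epsilon> h) \<otimes> y) = \<eta> (\<epsilon> h) \<otimes> (r \<otimes> y)" if "r \<in> carrier A" "y \<in> carrier A" for r y
      using that by (metis m_assoc unit_central unit_closed)
    then have "cocycle {\<zero>} 3 (\<lambda>x. \<eta> (\<epsilon> h) \<otimes> f x)"
      using f(1) by (simp add: Z cocycle_def cochain_iff r_distr)
    from restrictZ[OF this] have c: "scal h f \<in> carrier Z"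
      unfolding scal_def by (simp add: fx cong: restrict_cong)
    have "left_cong I3 (\<eta> (\<epsilon> h) \<otimes> f z) (\<eta> (\<epsilon> h) \<otimes> (\<eta> k \<otimes> \<Lambda>))"
      using left_cong_mult[OF I3_ideal val[OF f(1)]] f(2) by simp
    then have "val (scal h f) = \<epsilon> h * k"
      using z by (intro valI[OF c]) (simp add: scal_def fx unit_mult m_assoc)
    then show ?thesis using c by (simp add: fiber_def)
  qed
  have rmul: "rmul h f \<in> fiber (\<epsilon> h * k)" if h: "h \<in> carrier A" and "f \<in> fiber k" for h f k
  proof -
    have f: "f \<in> carrier Z" "val f = k" using that by (auto simp: fiber_def)
    have "cocycle {\<zero>} 3 (\<lambda>x. f x \<otimes> h)"
      using f(1) h by (simp add: Z cocycle_def cochain_iff l_distr m_assoc)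
    from restrictZ[OF this] have c: "rmul h f \<in> carrier Z" by (simp add: rmul_def)
    have "left_cong I3 (f z \<otimes> h) (\<eta> k \<otimes> \<Lambda> \<otimes> h)"
      using I3_cong_mult_right[OF val[OF f(1)] h] f(2) by simp
    moreover have "left_cong I3 (\<eta> k \<otimes> (\<Lambda> \<otimes> h)) (\<eta> k \<otimes> (\<eta> (\<epsilon> h) \<otimes> \<Lambda>))"
      using left_cong_mult[OF I3_ideal integral_right[OF h]] by simp
    moreover have "\<eta> k \<otimes> (\<eta> (\<epsilon> h) \<otimes> \<Lambda>) = \<eta> (\<epsilon> h * k) \<otimes> \<Lambda>"
      by (simp add: m_assoc[symmetric] unit_mult[symmetric] mult.commute)
    ultimately have "left_cong I3 (f z \<otimes> h) (\<eta> (\<epsilon> h * k) \<otimes> \<Lambda>)"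
      using h left_cong_trans[OF I3_ideal] by (simp add: m_assoc)
    then have "val (rmul h f) = \<epsilon> h * k"
      using z by (intro valI[OF c]) (simp add: rmul_def)
    then show ?thesis using c by (simp add: fiber_def)
  qed
  have *: "bimodule_isomorphic R (Ext_bimodule A P d (regular_module A) 3 lact ract) (trivial_bimodule \<epsilon>)"
      "bimodule_isomorphic R (trivial_bimodule \<epsilon>) (Ext_bimodule A P d (regular_module A) 3 lact ract)"
    if l: "\<And>h f k. h \<in> carrier A \<Longrightarrow> f \<in> fiber k \<Longrightarrow> lact h f \<in> fiber (\<epsilon> h * k)"
      and r: "\<And>h f k. h \<in> carrier A \<Longrightarrow> f \<in> fiber k \<Longrightarrow> ract h f \<in> fiber (\<epsilon> h * k)"
    for lact ract
  proof -
    let ?E = "Ext_bimodule A P d (regular_module A) 3 lact ract"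
    have E: "carrier ?E = range fiber" "add ?E = set_add Z"
      "module.smult ?E = (\<lambda>h C. \<Union>f\<in>C. B +>\<^bsub>Z\<^esub> lact h f)"
      "rsmult ?E = (\<lambda>C h. \<Union>f\<in>C. B +>\<^bsub>Z\<^esub> ract h f)"
      by (simp_all add: Ext_bimodule_def Let_def Z_def B_def carrier[unfolded Z_def B_def])
    have la: "(\<Union>f\<in>fiber k. B +>\<^bsub>Z\<^esub> lact h f) = fiber (\<epsilon> h * k)" if "h \<in> carrier A" for h k
      by (rule act) (use l that in blast)
    have ra: "(\<Union>f\<in>fiber k. B +>\<^bsub>Z\<^esub> ract h f) = fiber (\<epsilon> h * k)" if "h \<in> carrier A" for h k
      by (rule act) (use r that in blast)
    have sa: "fiber k <+>\<^bsub>Z\<^esub> fiber l = fiber (k + l)" for k l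
      using fiber_add by (simp add: set_add_def set_mult_def)
    have inv: "inv_into UNIV fiber (fiber k) = k" for k using inj by (rule inv_f_f)
    have bij: "bij_betw fiber UNIV (range fiber)" using inj by (rule inj_on_imp_bij_betw)
    show "bimodule_isomorphic R ?E (trivial_bimodule \<epsilon>)"
      unfolding bimodule_isomorphic_def
    proof (intro exI[of _ "inv_into UNIV fiber"] conjI ballI)
      show "bij_betw (inv_into UNIV fiber) (carrier ?E) (carrier (trivial_bimodule \<epsilon>))"
        using bij_betw_inv_into[OF bij] by (simp add: E trivial_bimodule_def)
    qed (auto simp: E R la ra sa inv trivial_bimodule_def mult.commute)
    show "bimodule_isomorphic R (trivial_bimodule \<epsilon>) ?E"
      unfolding bimodule_isomorphic_def
      by (intro exI[of _ fiber] conjI ballI)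
         (use bij in \<open>auto simp: E R la ra sa trivial_bimodule_def mult.commute\<close>)
  qed
  show "bimodule_isomorphic R (Ext_bimodule A P d (regular_module A) 3 scal rmul) (trivial_bimodule \<epsilon>)"
    "bimodule_isomorphic R (trivial_bimodule \<epsilon>) (Ext_bimodule A P d (regular_module A) 3 scal rmul)"
    by (rule *; use scal rmul in blast)+
  show "bimodule_isomorphic R (Ext_bimodule A P d (regular_module A) 3 rmul scal) (trivial_bimodule \<epsilon>)"
    by (rule *) (use scal rmul in blast)+
qed

end

section \<open>Monoid algebras and presentations\<close>

lemma poly_mapping_sum_single:
  "f = (\<Sum>w\<in>Poly_Mapping.keys f. Poly_Mapping.single w (Poly_Mapping.lookup f w))"
proof (rule poly_mapping_eqI)
  fix v
  show "Poly_Mapping.lookup f v = Poly_Mapping.lookup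
      (\<Sum>w\<in>Poly_Mapping.keys f. Poly_Mapping.single w (Poly_Mapping.lookup f w)) v"
    by (simp add: lookup_sum lookup_single when_def in_keys_iff)
qed

text \<open>Common form of \<open>free_lift\<close>, \<open>free_antilift\<close> and the later
  specialisations of Laurent polynomials. Additivity holds for any \<open>\<chi>\<close> and is
  split off, because reversal of words and \<open>\<iota>\<close> below are used without
  multiplicativity.\<close>

definition monoid_lift :: "('k::zero \<Rightarrow> 'r::ring_1) \<Rightarrow> ('m \<Rightarrow> 'r) \<Rightarrow> ('m \<Rightarrow>\<^sub>0 'k) \<Rightarrow> 'r"
  where "monoid_lift \<eta> \<chi> f = (\<Sum>w\<in>Poly_Mapping.keys f. \<eta> (Poly_Mapping.lookup f w) * \<chi> w)"

lemma free_lift_eq_monoid_lift: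
  "free_lift \<eta> g = monoid_lift \<eta> (\<lambda>w. prod_list (map g (letters w)))"
  by (simp add: fun_eq_iff free_lift_def monoid_lift_def)

lemma free_antilift_eq_monoid_lift:
  "free_antilift \<eta> g = monoid_lift \<eta> (\<lambda>w. prod_list (map g (rev (letters w))))"
  by (simp add: fun_eq_iff free_antilift_def monoid_lift_def)

locale additive_lift =
  fixes \<eta> :: "'k::ring_1 \<Rightarrow> 'r::ring_1" and \<chi> :: "'m \<Rightarrow> 'r"
  assumes unit_add: "\<eta> (k + l) = \<eta> k + \<eta> l"
begin

lemma unit_0: "\<eta> 0 = 0"
  using unit_add[of 0 0] by simp

lemma lift_superset:
  assumes "finite S" "Poly_Mapping.keys f \<subseteq> S"
  shows "monoid_lift \<eta> \<chi> f = (\<Sum>w\<in>S. \<eta> (Poly_Mapping.lookup f w) * \<chi> w)"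
  unfolding monoid_lift_def
  by (rule sum.mono_neutral_left) (use assms in \<open>auto simp: in_keys_iff unit_0\<close>)

lemma lift_add: "monoid_lift \<eta> \<chi> (f + g) = monoid_lift \<eta> \<chi> f + monoid_lift \<eta> \<chi> g"
proof -
  let ?S = "Poly_Mapping.keys f \<union> Poly_Mapping.keys g"
  have "Poly_Mapping.keys (f + g) \<subseteq> ?S" by (rule keys_add)
  then show ?thesis
    by (simp add: lift_superset[of ?S] lookup_add unit_add distrib_right sum.distrib)
qed

lemma lift_zero: "monoid_lift \<eta> \<chi> 0 = 0"
  by (simp add: monoid_lift_def)

lemma lift_single: "monoid_lift \<eta> \<chi> (Poly_Mapping.single w k) = \<eta> k * \<chi> w"
  by (simp add: lift_superset[of "{w}"])

lemma lift_uminus: "monoid_lift \<eta> \<chi> (- f) = - monoid_lift \<eta> \<chi> f"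
  using lift_add[of f "- f"] by (simp add: lift_zero eq_neg_iff_add_eq_0 add.commute)

lemma lift_diff: "monoid_lift \<eta> \<chi> (f - g) = monoid_lift \<eta> \<chi> f - monoid_lift \<eta> \<chi> g"
  using lift_add[of f "- g"] by (simp add: lift_uminus)

lemma lift_sum: "monoid_lift \<eta> \<chi> (sum F S) = (\<Sum>i\<in>S. monoid_lift \<eta> \<chi> (F i))"
  by (induction S rule: infinite_finite_induct) (simp_all add: lift_zero lift_add)

end

lemma monoid_algebra_scalar_central:
  fixes f :: "'m::monoid_add \<Rightarrow>\<^sub>0 'k::comm_semiring_1"
  shows "Poly_Mapping.single 0 k * f = f * Poly_Mapping.single 0 k"
proof -
  have "Poly_Mapping.single 0 k * (\<Sum>w\<in>S. Poly_Mapping.single w (F w))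
      = (\<Sum>w\<in>S. Poly_Mapping.single w (F w)) * Poly_Mapping.single 0 k" for S and F :: "'m \<Rightarrow> 'k"
    by (simp add: sum_distrib_left sum_distrib_right mult_single mult.commute)
  from this[where F = "Poly_Mapping.lookup f" and S = "Poly_Mapping.keys f"]
  show ?thesis unfolding poly_mapping_sum_single[symmetric] .
qed

locale algebra_lift = additive_lift \<eta> \<chi>
  for \<eta> :: "'k::field \<Rightarrow> 'r::ring_1" and \<chi> :: "'m::monoid_add \<Rightarrow> 'r" +
  assumes unit_mult: "\<eta> (k * l) = \<eta> k * \<eta> l" and unit_1: "\<eta> 1 = 1"
    and unit_comm: "\<eta> k * \<chi> w = \<chi> w * \<eta> k"
    and char_add: "\<chi> (v + w) = \<chi> v * \<chi> w" and char_0: "\<chi> 0 = 1"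
begin

lemma lift_scalar: "monoid_lift \<eta> \<chi> (Poly_Mapping.single 0 k) = \<eta> k"
  by (simp add: lift_single char_0)

lemma lift_one: "monoid_lift \<eta> \<chi> 1 = 1"
  using lift_scalar[of 1] by (simp add: unit_1)

lemma lift_mult: "monoid_lift \<eta> \<chi> (f * g) = monoid_lift \<eta> \<chi> f * monoid_lift \<eta> \<chi> g"
proof -
  have *: "monoid_lift \<eta> \<chi> (Poly_Mapping.single v k * Poly_Mapping.single w l)
      = monoid_lift \<eta> \<chi> (Poly_Mapping.single v k) * monoid_lift \<eta> \<chi> (Poly_Mapping.single w l)" for v w k l
    using unit_comm[of l v]
    by (simp add: mult_single lift_single unit_mult char_add) (metis mult.assoc)
  have "monoid_lift \<eta> \<chi> ((\<Sum>v\<in>S. Poly_Mapping.single v (F v)) * (\<Sum>w\<in>T. Poly_Mapping.single w (G w)))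
      = monoid_lift \<eta> \<chi> (\<Sum>v\<in>S. Poly_Mapping.single v (F v)) * monoid_lift \<eta> \<chi> (\<Sum>w\<in>T. Poly_Mapping.single w (G w))"
    for S T F G
    by (simp add: sum_product lift_sum *)
  from this[of "Poly_Mapping.lookup f" "Poly_Mapping.keys f" "Poly_Mapping.lookup g" "Poly_Mapping.keys g"]
  show ?thesis unfolding poly_mapping_sum_single[symmetric] .
qed

lemma lift_power: "monoid_lift \<eta> \<chi> (f ^ k) = monoid_lift \<eta> \<chi> f ^ k"
  by (induction k) (simp_all add: lift_one lift_mult)

lemmas hom = lift_mult lift_add lift_zero lift_diff lift_one lift_sum

lemmas hom_single = lift_single

end

lemma fscalar_add: "fscalar (k + l) = fscalar k + fscalar l"
  and fscalar_mult: "fscalar (k * l) = fscalar k * fscalar l"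
  and fscalar_1: "fscalar 1 = 1" and fscalar_0: "fscalar 0 = 0"
  and fscalar_central: "fscalar k * f = f * fscalar k"
  by (simp_all add: fscalar_def single_add mult_single monoid_algebra_scalar_central)

lemma fscalar_left_commute: "f * (fscalar k * g) = fscalar k * (f * g)"
  by (metis fscalar_central mult.assoc)

lemma single_word:
  "Poly_Mapping.single (Word ws) k = fscalar k * prod_list (map fgen ws)"
proof (induction ws)
  case Nil
  show ?case by (simp add: fscalar_def zero_fword_def)
next
  case (Cons s ws)
  have "fscalar k * prod_list (map fgen (s # ws)) = fgen s * Poly_Mapping.single (Word ws) k"
    by (simp add: Cons fscalar_left_commute)
  also have "\<dots> = Poly_Mapping.single (Word (s # ws)) k"
    by (simp add: fgen_def mult_single plus_fword_def)
  finally show ?case ..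
qed

lemma free_algebra_induct [case_names one add scalar gen]:
  assumes one: "Q 1" and add: "\<And>f g. Q f \<Longrightarrow> Q g \<Longrightarrow> Q (f + g)"
    and scalar: "\<And>k f. Q f \<Longrightarrow> Q (fscalar k * f)" and gen: "\<And>s f. Q f \<Longrightarrow> Q (fgen s * f)"
  shows "Q (f :: ('x, 'k::field) free_algebra)"
proof -
  have word: "Q (prod_list (map fgen ws))" for ws by (induction ws) (simp_all add: one gen)
  have "Q 0" using scalar[OF one, of 0] by (simp add: fscalar_0)
  then have "Q (\<Sum>w\<in>S. Poly_Mapping.single w (F w))" for S and F :: "'x fword \<Rightarrow> 'k"
    by (induction S rule: infinite_finite_induct)
       (auto intro!: add simp: single_word[of "letters _", simplified] scalar word)
  from this[where F = "Poly_Mapping.lookup f" and S = "Poly_Mapping.keys f"]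
  show ?thesis unfolding poly_mapping_sum_single[symmetric] .
qed

locale free_algebra_lift =
  fixes \<eta> :: "'k::field \<Rightarrow> 'r::ring_1" and g :: "'x \<Rightarrow> 'r"
  assumes unit_add: "\<eta> (k + l) = \<eta> k + \<eta> l"
    and unit_mult: "\<eta> (k * l) = \<eta> k * \<eta> l" and unit_1: "\<eta> 1 = 1"
    and unit_comm: "\<eta> k * g s = g s * \<eta> k"
begin

lemma algebra_lift: "algebra_lift \<eta> (\<lambda>w. prod_list (map g (letters w)))"
proof
  fix k and w :: "'x fword"
  have "\<eta> k * prod_list (map g ws) = prod_list (map g ws) * \<eta> k" for ws
    by (induction ws) (simp_all, metis mult.assoc unit_comm)
  then show "\<eta> k * prod_list (map g (letters w)) = prod_list (map g (letters w)) * \<eta> k" .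
qed (simp_all add: unit_add unit_mult unit_1 plus_fword_def zero_fword_def)

interpretation algebra_lift \<eta> "\<lambda>w. prod_list (map g (letters w))" by (rule algebra_lift)

lemmas flift_add = lift_add[folded free_lift_eq_monoid_lift]
  and flift_zero = lift_zero[folded free_lift_eq_monoid_lift]
  and flift_one = lift_one[folded free_lift_eq_monoid_lift]
  and flift_mult = lift_mult[folded free_lift_eq_monoid_lift]
  and flift_power = lift_power[folded free_lift_eq_monoid_lift]
  and flift_uminus = lift_uminus[folded free_lift_eq_monoid_lift]
  and flift_diff = lift_diff[folded free_lift_eq_monoid_lift]

lemma flift_gen: "free_lift \<eta> g (fgen s) = g s"
  by (simp add: free_lift_eq_monoid_lift fgen_def lift_single unit_1)

lemma flift_scalar: "free_lift \<eta> g (fscalar k) = \<eta> k"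
  by (simp add: free_lift_eq_monoid_lift fscalar_def lift_scalar)

lemmas flift_simps = flift_add flift_zero flift_one flift_mult flift_power flift_uminus
  flift_diff flift_gen flift_scalar

end

lemma ring_ring_of_type_algebra: "ring (ring_of_type_algebra :: 'r::ring_1 ring)"
proof (rule ringI)
  show "abelian_group (ring_of_type_algebra :: 'r ring)"
    by (rule abelian_groupI)
       (auto simp: ring_of_type_algebra_def algebra_simps intro: exI[of _ "- _"])
qed (unfold_locales, auto simp: ring_of_type_algebra_def algebra_simps)

lemma ideal_relation_ideal: "ideal (relation_ideal S) ring_of_type_algebra"
  unfolding relation_ideal_def
  by (rule ring.genideal_ideal[OF ring_ring_of_type_algebra]) (simp add: ring_of_type_algebra_def)

lemma relation_ideal_incl: "r \<in> S \<Longrightarrow> r \<in> relation_ideal S"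
  unfolding relation_ideal_def
  using ring.genideal_self[OF ring_ring_of_type_algebra] by (force simp: ring_of_type_algebra_def)

lemma relation_ideal_add: "f \<in> relation_ideal S \<Longrightarrow> g \<in> relation_ideal S \<Longrightarrow> f + g \<in> relation_ideal S"
  and relation_ideal_0: "0 \<in> relation_ideal S"
  and relation_ideal_lmult: "f \<in> relation_ideal S \<Longrightarrow> g * f \<in> relation_ideal S"
  and relation_ideal_rmult: "f \<in> relation_ideal S \<Longrightarrow> f * g \<in> relation_ideal S"
  using additive_subgroup.a_closed[OF ideal.axioms(1)[OF ideal_relation_ideal[of S]], of f g]
    additive_subgroup.zero_closed[OF ideal.axioms(1)[OF ideal_relation_ideal[of S]]]
    ideal.I_l_closed[OF ideal_relation_ideal[of S], of f g]
    ideal.I_r_closed[OF ideal_relation_ideal[of S], of f g]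
  by (simp_all add: ring_of_type_algebra_def)

lemma relation_ideal_uminus: "f \<in> relation_ideal S \<Longrightarrow> - f \<in> relation_ideal S"
  using relation_ideal_lmult[of f S "- 1"] by simp

lemma relation_ideal_least:
  assumes "0 \<in> K" and add: "\<And>f g. f \<in> K \<Longrightarrow> g \<in> K \<Longrightarrow> f + g \<in> K"
    and l: "\<And>f g. f \<in> K \<Longrightarrow> g * f \<in> K" and r: "\<And>f g. f \<in> K \<Longrightarrow> f * g \<in> K" and "S \<subseteq> K"
  shows "relation_ideal S \<subseteq> K"
proof -
  let ?R = "ring_of_type_algebra :: ('a, 'b) free_algebra ring"
  have R: "ring ?R" by (rule ring_ring_of_type_algebra)
  then interpret ring ?R .
  have inv: "inv\<^bsub>add_monoid ?R\<^esub> f = - f" for f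
    using minus_equality[of "- f" f] by (simp add: ring_of_type_algebra_def a_inv_def)
  have "ideal K ?R"
  proof (rule idealI[OF R])
    show "subgroup K (add_monoid ?R)"
    proof (rule group.subgroupI[OF a_group])
      fix f assume "f \<in> K"
      then show "inv\<^bsub>add_monoid ?R\<^esub> f \<in> K" unfolding inv using l[of f "- 1"] by simp
    qed (use assms(1) add in \<open>auto simp: ring_of_type_algebra_def\<close>)
  qed (use l r in \<open>auto simp: ring_of_type_algebra_def\<close>)
  then show ?thesis
    unfolding relation_ideal_def using \<open>S \<subseteq> K\<close> by (rule genideal_minimal)
qed

lemma (in free_algebra_lift) flift_relation_ideal:
  assumes "\<And>r. r \<in> S \<Longrightarrow> free_lift \<eta> g r = 0" "f \<in> relation_ideal S"
  shows "free_lift \<eta> g f = 0"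
proof -
  have "relation_ideal S \<subseteq> {f. free_lift \<eta> g f = 0}"
    by (rule relation_ideal_least) (use assms(1) in \<open>auto simp: flift_simps\<close>)
  then show ?thesis using assms(2) by auto
qed

text \<open>The ring and the surjection are kept abstract so that the opposite algebra fits as well,
  presented through an anti-automorphism of the free algebra.\<close>

locale presentation = ring A for A :: "'a ring" (structure) +
  fixes \<theta> :: "('x, 'k::field) free_algebra \<Rightarrow> 'a" and S :: "('x, 'k) free_algebra set"
  assumes \<theta>_closed [simp]: "\<theta> f \<in> carrier A"
    and \<theta>_surj: "r \<in> carrier A \<Longrightarrow> \<exists>f. r = \<theta> f"
    and \<theta>_add: "\<theta> (f + g) = \<theta> f \<oplus> \<theta> g" and \<theta>_mult: "\<theta> (f * g) = \<theta> f \<otimes> \<theta> g"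
    and \<theta>_one: "\<theta> 1 = \<one>" and \<theta>_kernel: "\<theta> f = \<zero> \<longleftrightarrow> f \<in> relation_ideal S"
begin

lemma \<theta>_zero: "\<theta> 0 = \<zero>"
  by (simp add: \<theta>_kernel relation_ideal_0)

lemma \<theta>_diff: "\<theta> (f - g) = \<theta> f \<ominus> \<theta> g"
  using \<theta>_add[of "f - g" g] by (simp add: add_eq_iff_eq_minus[symmetric])

lemma \<theta>_eq_iff: "\<theta> f = \<theta> g \<longleftrightarrow> f - g \<in> relation_ideal S"
  unfolding \<theta>_kernel[symmetric] \<theta>_diff by simp

end

lemma presentation_quotient:
  "presentation (presented_algebra S) (\<lambda>f. relation_ideal S +>\<^bsub>ring_of_type_algebra\<^esub> f) S"
proof -
  let ?R = "ring_of_type_algebra :: ('a, 'b) free_algebra ring" and ?J = "relation_ideal S"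
  interpret ideal ?J ?R by (rule ideal_relation_ideal)
  have hom: "(+>\<^bsub>?R\<^esub>) ?J \<in> ring_hom ?R (?R Quot ?J)" by (rule rcos_ring_hom)
  interpret Q: ring "presented_algebra S"
    unfolding presented_algebra_def by (rule quotient_is_ring)
  show ?thesis
  proof unfold_locales
    fix f g :: "('a, 'b) free_algebra"
    show "?J +>\<^bsub>?R\<^esub> f \<in> carrier (presented_algebra S)"
      using ring_hom_closed[OF hom, of f] by (simp add: presented_algebra_def ring_of_type_algebra_def)
    show "?J +>\<^bsub>?R\<^esub> (f + g) = (?J +>\<^bsub>?R\<^esub> f) \<oplus>\<^bsub>presented_algebra S\<^esub> (?J +>\<^bsub>?R\<^esub> g)"
      using ring_hom_add[OF hom, of f g] by (simp add: presented_algebra_def ring_of_type_algebra_def)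
    show "?J +>\<^bsub>?R\<^esub> (f * g) = (?J +>\<^bsub>?R\<^esub> f) \<otimes>\<^bsub>presented_algebra S\<^esub> (?J +>\<^bsub>?R\<^esub> g)"
      using ring_hom_mult[OF hom, of f g] by (simp add: presented_algebra_def ring_of_type_algebra_def)
    show "?J +>\<^bsub>?R\<^esub> 1 = \<one>\<^bsub>presented_algebra S\<^esub>"
      using ring_hom_one[OF hom] by (simp add: presented_algebra_def ring_of_type_algebra_def)
    show "(?J +>\<^bsub>?R\<^esub> f = \<zero>\<^bsub>presented_algebra S\<^esub>) = (f \<in> ?J)"
    proof
      assume "?J +>\<^bsub>?R\<^esub> f = \<zero>\<^bsub>presented_algebra S\<^esub>"
      then show "f \<in> ?J"
        using a_rcos_self[of f] by (simp add: presented_algebra_def FactRing_def ring_of_type_algebra_def)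
    next
      assume "f \<in> ?J"
      then show "?J +>\<^bsub>?R\<^esub> f = \<zero>\<^bsub>presented_algebra S\<^esub>"
        using a_rcos_const by (simp add: presented_algebra_def FactRing_def)
    qed
  next
    fix r assume "r \<in> carrier (presented_algebra S)"
    then show "\<exists>f. r = ?J +>\<^bsub>?R\<^esub> f"
      by (auto simp: presented_algebra_def FactRing_def A_RCOSETS_def')
  qed
qed

section \<open>The ring of additive endomorphisms\<close>

text \<open>Operators as a type of class \<open>ring_1\<close> are a legitimate target of
  \<open>free_lift\<close>, so a representation is given by its values on the generators.\<close>

typedef (overloaded) 'v endo = "{f :: 'v::ab_group_add \<Rightarrow> 'v. \<forall>x y. f (x + y) = f x + f y}"
  morphisms app Endo
  by (rule exI[of _ id]) simp

setup_lifting type_definition_endo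

lemma endo_eqI: "(\<And>v. app f v = app g v) \<Longrightarrow> f = g"
  by (simp add: app_inject[symmetric] fun_eq_iff)

lemma app_add: "app f (u + v) = app f u + app f v"
  using app[of f] by simp

lemma app_Endo: "(\<And>x y. f (x + y) = f x + f y) \<Longrightarrow> app (Endo f) = f"
  by (rule Endo_inverse) simp

lemma app_0: "app f 0 = 0"
  using app_add[of f 0 0] by simp

lemma app_uminus: "app f (- v) = - app f v"
  using app_add[of f v "- v"] by (simp add: app_0 eq_neg_iff_add_eq_0 add.commute)

instantiation endo :: ("{ab_group_add, zero_neq_one}") ring_1
begin

lift_definition zero_endo :: "'a endo" is "\<lambda>_. 0" by simp
lift_definition one_endo :: "'a endo" is "\<lambda>v. v" by simp
lift_definition plus_endo :: "'a endo \<Rightarrow> 'a endo \<Rightarrow> 'a endo" is "\<lambda>f g v. f v + g v"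
  by (simp add: algebra_simps)
lift_definition minus_endo :: "'a endo \<Rightarrow> 'a endo \<Rightarrow> 'a endo" is "\<lambda>f g v. f v - g v"
  by (simp add: algebra_simps)
lift_definition uminus_endo :: "'a endo \<Rightarrow> 'a endo" is "\<lambda>f v. - f v"
  by simp
lift_definition times_endo :: "'a endo \<Rightarrow> 'a endo \<Rightarrow> 'a endo" is "\<lambda>f g v. f (g v)"
  by simp

instance
proof
  have "app (0 :: 'a endo) 1 \<noteq> app 1 1" by (simp add: zero_endo.rep_eq one_endo.rep_eq)
  then show "(0 :: 'a endo) \<noteq> 1" by metis
qed (transfer; simp add: algebra_simps fun_eq_iff)+

end

lemmas app_simps = zero_endo.rep_eq one_endo.rep_eq plus_endo.rep_eq minus_endo.rep_eq
  uminus_endo.rep_eq times_endo.rep_eq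

section \<open>Laurent polynomials in three variables\<close>

text \<open>The group algebra of the free abelian group on \<open>a\<close>, \<open>b\<close>,
  \<open>c\<close>; an exponent triple lists them in this order.\<close>

type_synonym 'k laurent = "int \<times> int \<times> int \<Rightarrow>\<^sub>0 'k"

definition lconst :: "'k::field \<Rightarrow> 'k laurent" where "lconst = Poly_Mapping.single 0"

definition mon :: "int \<times> int \<times> int \<Rightarrow> 'k::field laurent" where "mon e = Poly_Mapping.single e 1"

lemma lconst_hom: "lconst (k + l) = lconst k + lconst l" "lconst (k * l) = lconst k * lconst l"
    "lconst 1 = 1" "lconst 0 = 0" "lconst (- k) = - lconst k" "lconst (k - l) = lconst k - lconst l"
  by (simp_all add: lconst_def single_add mult_single single_uminus single_diff)

lemma mon_hom: "mon (e + e') = mon e * mon e'" "mon 0 = 1"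
  by (simp_all add: mon_def mult_single)

lemma single_eq_mon: "Poly_Mapping.single e k = lconst k * mon e"
  by (simp add: lconst_def mon_def mult_single)

text \<open>The \<open>p\<close>-integer \<open>1 + p + ... + p^(l-1)\<close>, defined without
  division because the Verma module must allow \<open>p = 1\<close>.\<close>

fun qnum :: "'k::field \<Rightarrow> nat \<Rightarrow> 'k"
  where "qnum p 0 = 0" | "qnum p (Suc l) = 1 + p * qnum p l"

lemma qnum_closed: "qnum p l * (p - 1) = p ^ l - 1"
proof (induction l)
  case (Suc l)
  have "qnum p (Suc l) * (p - 1) = (p - 1) + p * (qnum p l * (p - 1))" by (simp add: algebra_simps)
  also have "\<dots> = p ^ Suc l - 1" unfolding Suc by (simp add: algebra_simps)
  finally show ?case .
qed simp

lemma qnum_Suc': "qnum p (Suc l) = qnum p l + p ^ l"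
  by (induction l) (simp_all add: algebra_simps)

text \<open>Recursion for the coefficient of \<open>a^(2 n1)\<close> when \<open>y\<close> is moved
  past one more \<open>x\<close>.\<close>

lemma qnum_step:
  assumes "p \<noteq> 0"
  shows "qnum p (Suc (Suc l)) * inverse p ^ (2 * Suc l)
    = inverse p * (qnum p (Suc l) * inverse p ^ (2 * l)) + inverse p ^ (2 * Suc l)"
proof -
  have ph: "inverse p * (p * y) = y" "p * (inverse p * y) = y" for y using assms by (simp_all add: field_simps)
  show ?thesis
    by (simp only: qnum.simps(2)[of p "Suc l"]) (simp add: algebra_simps ph del: qnum.simps)
qed

lemma mod_minus_1: "l mod n \<noteq> 0 \<Longrightarrow> l mod n - 1 = (l - 1) mod (n :: nat)"
  by (cases l) (auto simp: mod_Suc split: if_splits)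

lemma primitive_root_power_eq_1_iff:
  assumes "primitive_root_of_unity n (q::'k::field)"
  shows "q ^ i = 1 \<longleftrightarrow> n dvd i"
proof -
  have n: "0 < n" "q ^ n = 1" "\<And>k. 0 < k \<Longrightarrow> k < n \<Longrightarrow> q ^ k \<noteq> 1"
    using assms by (auto simp: primitive_root_of_unity_def)
  have "q ^ i = (q ^ n) ^ (i div n) * q ^ (i mod n)"
    by (simp add: power_mult[symmetric] power_add[symmetric])
  then have "q ^ i = q ^ (i mod n)" using n by simp
  then show ?thesis
    using n(3)[of "i mod n"] n(1) by (cases "i mod n = 0") (auto simp: dvd_eq_mod_eq_0)
qed

locale H_parameters =
  fixes n n1 :: nat and q \<beta>1 \<beta>2 \<beta>3 :: "'k::field_char_0"
  assumes n_ge_2: "n \<ge> 2" and primitive: "primitive_root_of_unity n q" and coprime: "coprime n n1"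
begin

definition "p = q ^ n1"

lemma n_pos: "0 < n" using n_ge_2 by simp

lemma q_n: "q ^ n = 1" using primitive by (simp add: primitive_root_of_unity_def)

lemma q_nz [simp]: "q \<noteq> 0" using q_n n_pos by (metis power_0_left zero_neq_one less_irrefl)

lemma p_nz [simp]: "p \<noteq> 0" by (simp add: p_def)

lemma q_power_eq_1: "q ^ i = 1 \<longleftrightarrow> n dvd i"
  using primitive_root_power_eq_1_iff[OF primitive] .

lemma p_power_eq_1: "p ^ i = 1 \<longleftrightarrow> n dvd i"
  using coprime by (simp add: p_def power_mult[symmetric] q_power_eq_1 coprime_dvd_mult_right_iff)

lemma p_n: "p ^ n = 1" and p_ne_1: "p \<noteq> 1"
  using p_power_eq_1[of n] p_power_eq_1[of 1] n_ge_2 by auto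

lemma qnum_p_eq_0: "n dvd l \<Longrightarrow> qnum p l = 0"
  using qnum_closed[of p l] p_power_eq_1[of l] p_ne_1 by simp

lemma qnum_ip_eq_0: "n dvd l \<Longrightarrow> qnum (inverse p) l = 0"
  using qnum_closed[of "inverse p" l] p_power_eq_1[of l] p_ne_1 by (simp add: power_inverse)

lemma q_powi_mod: "n dvd l \<Longrightarrow> q powi (i * int l) = 1"
proof -
  assume "n dvd l"
  then have "q ^ l = 1" by (simp add: q_power_eq_1)
  then have "(q powi int l) powi i = 1" by simp
  then show ?thesis by (simp only: power_int_mult[symmetric] mult.commute)
qed

subsection \<open>Homomorphisms out of the Laurent polynomials\<close>

text \<open>Moving \<open>y\<close> past a group element: \<open>y g = (\<tau> g) y\<close>.\<close>

definition \<tau> :: "'k laurent \<Rightarrow> 'k laurent"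
  where "\<tau> = monoid_lift lconst (\<lambda>e. lconst (q powi (- fst e)) * mon e)"

text \<open>The specialisation \<open>c = 1\<close>. Below, \<open>\<pi>2\<close> sets
  \<open>b = c = 1\<close>, and \<open>ev s\<close> sets in addition \<open>a = q^s\<close>.\<close>

definition \<pi>1 :: "'k laurent \<Rightarrow> 'k laurent"
  where "\<pi>1 = monoid_lift lconst (\<lambda>e. mon (fst e, fst (snd e), 0))"

definition \<pi>2 :: "'k laurent \<Rightarrow> 'k laurent"
  where "\<pi>2 = monoid_lift lconst (\<lambda>e. mon (fst e, 0, 0))"

definition ev :: "int \<Rightarrow> 'k laurent \<Rightarrow> 'k"
  where "ev s = monoid_lift id (\<lambda>e. q powi (s * fst e))"

lemma lift_\<tau>: "algebra_lift lconst (\<lambda>e. lconst (q powi (- fst e)) * mon e)"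
  by unfold_locales (simp_all add: lconst_hom mon_hom power_int_diff power_int_minus divide_inverse mult_ac)

lemma lift_\<pi>1: "algebra_lift (lconst :: 'k \<Rightarrow> _) (\<lambda>e :: int \<times> int \<times> int. mon (fst e, fst (snd e), 0))"
  by unfold_locales
    (simp_all add: lconst_hom mult.commute mon_hom(1)[symmetric] mon_hom(2)[unfolded zero_prod_def])

lemma lift_\<pi>2: "algebra_lift (lconst :: 'k \<Rightarrow> _) (\<lambda>e :: int \<times> int \<times> int. mon (fst e, 0, 0))"
  by unfold_locales
    (simp_all add: lconst_hom mult.commute mon_hom(1)[symmetric] mon_hom(2)[unfolded zero_prod_def])

lemma lift_ev: "algebra_lift id (\<lambda>e :: int \<times> int \<times> int. q powi (s * fst e))"
  by unfold_locales (simp_all add: power_int_add distrib_left)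

lemmas \<tau>_hom = algebra_lift.hom[OF lift_\<tau>, folded \<tau>_def]
  and \<pi>1_hom = algebra_lift.hom[OF lift_\<pi>1, folded \<pi>1_def]
  and \<pi>2_hom = algebra_lift.hom[OF lift_\<pi>2, folded \<pi>2_def]
  and ev_hom = algebra_lift.hom[OF lift_ev, folded ev_def]

lemma lift_lconst:
  "\<tau> (lconst k) = lconst k" "\<pi>1 (lconst k) = lconst k" "\<pi>2 (lconst k) = lconst k" "ev s (lconst k) = k"
  using algebra_lift.lift_scalar[OF lift_\<tau>, of k] algebra_lift.lift_scalar[OF lift_\<pi>1, of k]
    algebra_lift.lift_scalar[OF lift_\<pi>2, of k] algebra_lift.lift_scalar[OF lift_ev, of s k]
  by (simp_all add: \<tau>_def \<pi>1_def \<pi>2_def ev_def lconst_def)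

lemma lift_mon:
  "\<tau> (mon e) = lconst (q powi (- fst e)) * mon e" "\<pi>1 (mon (i, j, k)) = mon (i, j, 0)"
  "\<pi>2 (mon (i, j, k)) = mon (i, 0, 0)" "ev s (mon e) = q powi (s * fst e)"
  using algebra_lift.hom_single[OF lift_\<tau>, where w = e and k = 1]
    algebra_lift.hom_single[OF lift_\<pi>1, where w = "(i, j, k)" and k = 1]
    algebra_lift.hom_single[OF lift_\<pi>2, where w = "(i, j, k)" and k = 1]
    algebra_lift.hom_single[OF lift_ev, where w = e and k = 1]
  by (simp_all add: \<tau>_def \<pi>1_def \<pi>2_def ev_def mon_def[symmetric] lconst_hom)

section \<open>A faithful representation of \<open>H\<^sub>\<beta>\<close>\<close>

text \<open>The coordinate \<open>v l m\<close> is the Laurent polynomial \<open>g\<close> in the term \<open>x\<^sup>l g y\<^sup>m\<close> of the basis expansion,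
  and the operators are left multiplications.  Instead of cutting off at \<open>n\<close>, the indices \<open>l\<close> and \<open>m\<close>
  run through infinitely many blocks of length \<open>n\<close> which do not interact.\<close>

type_synonym 'b coords = "nat \<Rightarrow> nat \<Rightarrow> 'b laurent"

definition z1 :: "'k laurent" where "z1 = lconst \<beta>1 * (mon (int (n * n1), 0, 0) - mon (0, int n, 0))"
definition z2 :: "'k laurent" where "z2 = lconst \<beta>2 * (mon (int (n * n1), 0, 0) - mon (0, 0, int n))"

text \<open>\<open>gam l\<close> is the coefficient of \<open>x\<^sup>l\<close> in \<open>y x\<^sup>l\<^sup>+\<^sup>1\<close>.\<close>

definition gam :: "nat \<Rightarrow> 'k laurent"
  where "gam l = lconst \<beta>3 * (lconst (qnum p (Suc l) * inverse p ^ (2 * l)) * mon (int (2 * n1), 0, 0) -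
    lconst (qnum (inverse p) (Suc l)) * mon (0, 1, 1))"

text \<open>The scalar comes from \<open>a^i x^l = q^(-i l) x^l a^i\<close>.\<close>

definition opG :: "int \<times> int \<times> int \<Rightarrow> 'k coords \<Rightarrow> 'k coords"
  where "opG e v = (\<lambda>l m. lconst (q powi (- (fst e * int l))) * mon e * v l m)"

definition opS :: "'k \<Rightarrow> 'k coords \<Rightarrow> 'k coords" where "opS k v = (\<lambda>l m. lconst k * v l m)"

text \<open>At the start of a block the entry arrives from the last position of the same block with
  the factor \<open>z1\<close>, the prescribed value of \<open>x^n\<close>.\<close>

definition opX :: "'k coords \<Rightarrow> 'k coords"
  where "opX v = (\<lambda>l m. if l mod n = 0 then z1 * v (l + n - 1) m else v (l - 1) m)"

definition sh :: "'k coords \<Rightarrow> 'k coords"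
  where "sh v = (\<lambda>l m. if m mod n = 0 then z2 * v l (m + n - 1) else v l (m - 1))"

text \<open>Coordinate form of \<open>y x^l g y^m = p^(-l) x^l (\<tau> g) y^(m+1) + x^(l-1) (gam
  (l-1)) g y^m\<close>; the second summand feeds position \<open>l\<close> from position
  \<open>l + 1\<close>.\<close>

definition opY :: "'k coords \<Rightarrow> 'k coords"
  where "opY v = (\<lambda>l m. lconst (inverse p ^ l) * \<tau> (sh v l m) + gam l * v (Suc l) m)"

lemma sh_simp: "sh (\<lambda>l m. g l * v l m) l m = g l * sh v l m"
  by (simp add: sh_def mult_ac)

lemma q_powi_nn1: "q powi (int (n * n1)) = 1" "q powi (- int (n * n1)) = 1" "q powi (s * int (n * n1)) = 1"
  "q powi (s * (int n * int n1)) = 1"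
  using q_powi_mod[of "n * n1" 1] q_powi_mod[of "n * n1" "-1"] q_powi_mod[of "n * n1" s] by simp_all

lemma \<tau>_z1: "\<tau> z1 = z1" and \<tau>_z2: "\<tau> z2 = z2"
  using q_powi_nn1
  by (simp_all add: z1_def z2_def \<tau>_hom lift_lconst lift_mon lconst_hom algebra_simps)

text \<open>At the last position of a block \<open>opY\<close> would read from the next block; the
  coefficient vanishes because the \<open>p\<close>-integer of a multiple of \<open>n\<close> is
  zero. Thus the blocks do not interact.\<close>

lemma gam_eq_0: "n dvd Suc l \<Longrightarrow> gam l = 0"
  by (simp add: gam_def qnum_p_eq_0 qnum_ip_eq_0 lconst_hom del: qnum.simps)

lemma gam_dvd: "n dvd l \<Longrightarrow> gam l = lconst \<beta>3 * (mon (int (2 * n1), 0, 0) - mon (0, 1, 1))"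
proof -
  assume d: "n dvd l"
  then have "inverse p ^ (2 * l) = 1"
    using p_power_eq_1[of "2 * l"] by (simp add: power_inverse)
  then show ?thesis using d by (simp add: gam_def qnum_p_eq_0 qnum_ip_eq_0 lconst_hom)
qed

lemma gam_Suc:
  "gam (Suc l) = lconst (inverse p) * gam l +
     lconst \<beta>3 * (lconst (inverse p ^ (2 * Suc l)) * mon (int (2 * n1), 0, 0) - mon (0, 1, 1))"
  unfolding gam_def qnum_step[OF p_nz] qnum.simps(2)[of "inverse p" "Suc l"]
  by (simp add: lconst_hom algebra_simps del: qnum.simps)

definition GE :: "int \<times> int \<times> int \<Rightarrow> 'k coords endo" where "GE e = Endo (opG e)"
definition SE :: "'k \<Rightarrow> 'k coords endo" where "SE k = Endo (opS k)"
definition XE :: "'k coords endo" where "XE = Endo opX"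
definition YE :: "'k coords endo" where "YE = Endo opY"

lemma app_GE: "app (GE e) = opG e" and app_SE: "app (SE k) = opS k"
  and app_XE: "app XE = opX" and app_YE: "app YE = opY"
  unfolding GE_def SE_def XE_def YE_def
  by (rule app_Endo; simp add: opG_def opS_def opX_def opY_def sh_def \<tau>_hom fun_eq_iff algebra_simps)+

lemma SE_hom: "SE (k + l) = SE k + SE l" "SE (k * l) = SE k * SE l" "SE 1 = 1" "SE 0 = 0"
    "SE (- k) = - SE k" "SE (k - l) = SE k - SE l"
  by (rule endo_eqI; simp add: app_simps app_SE opS_def lconst_hom fun_eq_iff algebra_simps)+

lemma GE_hom: "GE (e + e') = GE e * GE e'" "GE 0 = 1"
proof -
  have "lconst (q powi (- (fst (e + e') * int l)))
      = lconst (q powi (- (fst e * int l))) * lconst (q powi (- (fst e' * int l)))" for l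
    by (simp add: lconst_hom(2)[symmetric] power_int_add[symmetric] algebra_simps)
  then show "GE (e + e') = GE e * GE e'"
    by (intro endo_eqI) (simp add: app_simps app_GE opG_def mon_hom mult_ac)
  show "GE 0 = 1"
    by (rule endo_eqI) (simp add: app_simps app_GE opG_def mon_hom lconst_hom)
qed

lemma SE_GE: "SE k * GE e = GE e * SE k" and SE_XE: "SE k * XE = XE * SE k" and SE_YE: "SE k * YE = YE * SE k"
  by (rule endo_eqI; simp add: app_simps app_SE app_GE app_XE app_YE opS_def opG_def opX_def opY_def sh_def
      \<tau>_hom lift_lconst fun_eq_iff algebra_simps)+

lemma XE_GE: "XE * GE e = SE (q powi fst e) * GE e * XE"
proof (rule endo_eqI)
  fix v
  have 1: "q powi (- (fst e * int (l - 1))) = q powi fst e * q powi (- (fst e * int l))" if "0 < l" for l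
    using that by (simp add: power_int_add[symmetric] of_nat_diff algebra_simps)
  have "q powi (- (fst e * int (l + n - 1))) = q powi fst e * q powi (- (fst e * int l)) * q powi (- fst e * int n)" for l
    using n_pos by (simp add: power_int_add[symmetric] of_nat_diff algebra_simps)
  then have 2: "q powi (- (fst e * int (l + n - 1))) = q powi fst e * q powi (- (fst e * int l))" for l
    using q_powi_mod[of n "- fst e"] by simp
  have "app (XE * GE e) v l m = app (SE (q powi fst e) * GE e * XE) v l m" for l m
  proof (cases "l mod n = 0")
    case True
    then show ?thesis
      unfolding app_simps app_SE app_GE app_XE opS_def opG_def opX_def
      by (simp only: 2 lconst_hom simp_thms if_True mult_ac)
  next
    case False
    then have "0 < l" by (cases l) auto
    then show ?thesis
      unfolding app_simps app_SE app_GE app_XE opS_def opG_def opX_def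
      using False by (simp only: 1 lconst_hom simp_thms if_False mult_ac)
  qed
  then show "app (XE * GE e) v = app (SE (q powi fst e) * GE e * XE) v" by (simp add: fun_eq_iff)
qed

lemma YE_GE: "YE * GE e = SE (q powi (- fst e)) * GE e * YE"
proof (rule endo_eqI)
  fix v
  have 1: "q powi (- (fst e * int (Suc l))) = q powi (- fst e) * q powi (- (fst e * int l))" for l
    by (simp add: power_int_add[symmetric] algebra_simps)
  have 2: "sh (opG e v) l m = lconst (q powi (- (fst e * int l))) * mon e * sh v l m" for l m
    by (simp add: opG_def sh_def mult_ac)
  show "app (YE * GE e) v = app (SE (q powi (- fst e)) * GE e * YE) v"
    unfolding app_simps app_SE app_GE app_YE opY_def 2
    unfolding opG_def opS_def 1
    by (simp add: fun_eq_iff \<tau>_hom lift_lconst lift_mon lconst_hom algebra_simps)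
qed

text \<open>Inside a block this is the recursion \<open>gam_Suc\<close>. At the start of a block the
  term \<open>x y\<close> wraps around: \<open>z1\<close> is fixed by \<open>\<tau>\<close>, the
  scalar \<open>p^(-l)\<close> has period \<open>n\<close>, and \<open>gam\<close> vanishes at the
  block end.\<close>

lemma YE_XE: "YE * XE = SE (inverse p) * XE * YE + SE \<beta>3 * (GE (int (2 * n1), 0, 0) - GE (0, 1, 1))"
proof (rule endo_eqI)
  fix v :: "'k coords"
  have q2: "q powi (- (int (2 * n1) * int l)) = inverse p ^ (2 * l)" for l
    by (simp add: p_def power_int_minus power_inverse power_mult[symmetric] mult_ac flip: of_nat_mult)
  have "app (YE * XE) v l m =
      app (SE (inverse p) * XE * YE + SE \<beta>3 * (GE (int (2 * n1), 0, 0) - GE (0, 1, 1))) v l m" for l m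
  proof (cases "l mod n = 0")
    case True
    then have d: "n dvd l" by auto
    have Suc: "Suc l mod n \<noteq> 0" using True n_ge_2 by (simp add: mod_Suc)
    have X: "opX v (Suc l) m = v l m" using Suc by (simp add: opX_def)
    have shX: "sh (opX v) l m = z1 * sh v (l + n - 1) m" using True by (simp add: sh_def opX_def mult_ac)
    have g: "gam (l + n - 1) = 0" using n_pos d by (intro gam_eq_0) simp
    have ip: "inverse p * inverse p ^ (l + n - 1) = inverse p ^ l"
    proof -
      have "inverse p * inverse p ^ (l + n - 1) = inverse p ^ (l + n)"
        using n_pos by (metis Suc_pred' add_gr_0 power_Suc)
      then show ?thesis by (simp add: power_add power_inverse p_n)
    qed
    have ip1: "inverse p ^ (2 * l) = 1" using d p_power_eq_1[of "2 * l"] by (simp add: power_inverse)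
    have G: "opG (int (2 * n1), 0, 0) v l m = mon (int (2 * n1), 0, 0) * v l m"
      unfolding opG_def fst_conv q2 ip1 lconst_hom by simp
    have g': "gam (l + n - Suc 0) = 0" using g by simp
    have "app (YE * XE) v l m = lconst (inverse p ^ l) * (z1 * \<tau> (sh v (l + n - 1) m)) + gam l * v l m"
      by (simp add: app_simps app_XE app_YE opY_def shX \<tau>_hom \<tau>_z1 X)
    also have "\<dots> = lconst (inverse p) * (z1 * (lconst (inverse p ^ (l + n - 1)) * \<tau> (sh v (l + n - 1) m)))
        + lconst \<beta>3 * (mon (int (2 * n1), 0, 0) - mon (0, 1, 1)) * v l m"
      by (simp add: gam_dvd[OF d] ip[symmetric] lconst_hom mult_ac)
    also have "\<dots> = app (SE (inverse p) * XE * YE + SE \<beta>3 * (GE (int (2 * n1), 0, 0) - GE (0, 1, 1))) v l m"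
      unfolding app_simps app_XE app_YE app_SE app_GE opS_def plus_fun_apply minus_apply G
      using True by (simp add: opX_def opY_def g' opG_def lconst_hom algebra_simps)
    finally show ?thesis .
  next
    case False
    then obtain l' where l: "l = Suc l'" by (cases l) auto
    have G: "opG (int (2 * n1), 0, 0) v l m = lconst (inverse p ^ (2 * l)) * mon (int (2 * n1), 0, 0) * v l m"
      unfolding opG_def fst_conv q2 ..
    have shX: "sh (opX v) l m = sh v l' m" using False by (simp add: sh_def opX_def l)
    have X: "gam l * opX v (Suc l) m = gam l * v l m"
    proof (cases "Suc l mod n = 0")
      case True
      then have "gam l = 0" by (intro gam_eq_0) auto
      then show ?thesis by simp
    qed (simp add: opX_def)
    have "app (YE * XE) v l m = lconst (inverse p ^ l) * \<tau> (sh v l' m) + gam l * v l m"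
      by (simp add: app_simps app_XE app_YE opY_def shX X)
    also have "\<dots> = lconst (inverse p) * (lconst (inverse p ^ l') * \<tau> (sh v l' m) + gam l' * v l m)
        + lconst \<beta>3 * (lconst (inverse p ^ (2 * l)) * mon (int (2 * n1), 0, 0) - mon (0, 1, 1)) * v l m"
      unfolding l gam_Suc by (simp add: lconst_hom algebra_simps)
    also have "\<dots> = app (SE (inverse p) * XE * YE + SE \<beta>3 * (GE (int (2 * n1), 0, 0) - GE (0, 1, 1))) v l m"
      unfolding app_simps app_XE app_YE app_SE app_GE opS_def plus_fun_apply minus_apply G
      using False by (simp add: opX_def opY_def opG_def lconst_hom algebra_simps l)
    finally show ?thesis .
  qed
  then show "app (YE * XE) v =
      app (SE (inverse p) * XE * YE + SE \<beta>3 * (GE (int (2 * n1), 0, 0) - GE (0, 1, 1))) v"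
    by (simp add: fun_eq_iff)
qed

lemma GE_power: "GE (i, j, k) ^ r = GE (i * int r, j * int r, k * int r)"
proof (induction r)
  case 0
  show ?case using GE_hom(2) by (simp add: zero_prod_def)
next
  case (Suc r)
  have "GE (i * int (Suc r), j * int (Suc r), k * int (Suc r)) = GE ((i, j, k) + (i * int r, j * int r, k * int r))"
    by (simp add: algebra_simps)
  then show ?case by (simp only: Suc GE_hom power_Suc)
qed

lemma XE_power_app:
  "k \<le> n \<Longrightarrow> app (XE ^ k) v l m = (if k \<le> l mod n then v (l - k) m else z1 * v (l + n - k) m)"
proof (induction k arbitrary: l)
  case 0
  show ?case by (simp add: app_simps)
next
  case (Suc k)
  have "0 < l" if "l mod n \<noteq> 0" using that by (cases l) auto
  moreover note mod_minus_1[of l n]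
  moreover have "(l + n - 1) mod n = n - 1" if "l mod n = 0"
  proof -
    have "(l + n - 1) mod n = (l + (n - 1)) mod n" using n_pos by simp
    also have "\<dots> = (l mod n + (n - 1)) mod n" by (simp add: mod_add_left_eq)
    finally show ?thesis using that n_pos by simp
  qed
  ultimately show ?case
    using Suc by (auto simp: app_simps app_XE opX_def)
qed

lemma XE_n: "XE ^ n = SE \<beta>1 * (GE (int (n * n1), 0, 0) - GE (0, int n, 0))"
proof (rule endo_eqI)
  fix v
  have 1: "q powi (- (int (n * n1) * int l)) = 1" for l
    using q_powi_mod[of "n * n1" "- int l"] by (simp add: mult_ac)
  have "\<not> n \<le> l mod n" for l using n_pos by (simp add: not_le)
  then show "app (XE ^ n) v = app (SE \<beta>1 * (GE (int (n * n1), 0, 0) - GE (0, int n, 0))) v"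
    using 1 by (simp add: fun_eq_iff XE_power_app app_simps app_SE app_GE opS_def opG_def z1_def lconst_hom algebra_simps)
qed

lemma SE_commutes:
  "GE e * (SE k * f) = SE k * (GE e * f)" "XE * (SE k * f) = SE k * (XE * f)" "YE * (SE k * f) = SE k * (YE * f)"
  by (simp_all only: mult.assoc[symmetric] SE_GE SE_XE SE_YE)

lemma GE_commutes: "XE * (GE e * f) = SE (q powi fst e) * (GE e * (XE * f))"
  "YE * (GE e * f) = SE (q powi (- fst e)) * (GE e * (YE * f))"
  by (simp_all only: mult.assoc[symmetric] XE_GE YE_GE)

lemma SE_combine:
  "SE i * (SE r * Z + SE b * (M - N)) + SE b * (SE c * (SE s * M) - SE c' * N)
    = SE (i * r) * Z + SE b * (SE (i + c * s) * M - SE (i + c') * N)"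
  by (rule endo_eqI) (simp add: app_simps app_SE opS_def lconst_hom fun_eq_iff algebra_simps)

text \<open>Wanted only for exponent \<open>n\<close>, where both \<open>p\<close>-integers vanish
  and \<open>y^n\<close> commutes with \<open>x\<close>. This replaces a computation of
  \<open>YE ^ n\<close> on coordinates, which would mix many \<open>gam\<close> terms.\<close>

lemma YE_power_XE:
  "YE ^ Suc k * XE = SE (inverse p ^ Suc k) * (XE * YE ^ Suc k) +
    SE \<beta>3 * ((SE (qnum p (Suc k) * inverse p ^ (2 * k)) * GE (int (2 * n1), 0, 0) -
      SE (qnum (inverse p) (Suc k)) * GE (0, 1, 1)) * YE ^ k)"
proof (induction k)
  case 0
  show ?case using YE_XE by (simp add: SE_hom mult.assoc)
next
  case (Suc k)
  let ?a = "GE (int (2 * n1), 0, 0)" and ?b = "GE (0, 1, 1)" and ?Y = "YE ^ Suc k"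
  have q2: "q powi (- int (2 * n1)) = inverse p ^ 2"
    by (simp add: p_def power_int_minus power_inverse power_mult[symmetric] mult_ac flip: of_nat_mult)
  have "YE * (XE * ?Y) = SE (inverse p) * (XE * (YE * ?Y)) + SE \<beta>3 * (?a * ?Y - ?b * ?Y)"
    using arg_cong[OF YE_XE, of "\<lambda>f. f * ?Y"] by (simp only: algebra_simps)
  moreover have "YE * (?a * YE ^ k) = SE (inverse p ^ 2) * (?a * ?Y)" "YE * (?b * YE ^ k) = ?b * ?Y"
    by (simp_all add: GE_commutes q2 SE_hom del: of_nat_mult)
  moreover have "YE ^ Suc (Suc k) * XE = YE * (YE ^ Suc k * XE)" by (simp add: mult.assoc)
  ultimately have "YE ^ Suc (Suc k) * XE =
      SE (inverse p ^ Suc k) * (SE (inverse p) * (XE * (YE * ?Y)) + SE \<beta>3 * (?a * ?Y - ?b * ?Y)) +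
      SE \<beta>3 * (SE (qnum p (Suc k) * inverse p ^ (2 * k)) * (SE (inverse p ^ 2) * (?a * ?Y)) -
        SE (qnum (inverse p) (Suc k)) * (?b * ?Y))"
    unfolding Suc by (simp only: distrib_left right_diff_distrib left_diff_distrib SE_commutes mult.assoc)
  also have "\<dots> = SE (inverse p ^ Suc k * inverse p) * (XE * (YE * ?Y)) +
      SE \<beta>3 * ((SE (inverse p ^ Suc k + qnum p (Suc k) * inverse p ^ (2 * k) * inverse p ^ 2) * ?a -
        SE (inverse p ^ Suc k + qnum (inverse p) (Suc k)) * ?b) * ?Y)"
    unfolding left_diff_distrib mult.assoc[of "SE _" "GE _"] by (rule SE_combine)
  also have "inverse p ^ Suc k + qnum p (Suc k) * inverse p ^ (2 * k) * inverse p ^ 2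
      = qnum p (Suc (Suc k)) * inverse p ^ (2 * Suc k)"
  proof -
    have "p ^ Suc k * inverse p ^ Suc k = 1"
      unfolding power_mult_distrib[symmetric] by simp
    then have "p ^ Suc k * inverse p ^ (2 * Suc k) = inverse p ^ Suc k"
      by (simp only: mult_2 power_add mult.assoc[symmetric] mult_1_left)
    then show ?thesis
      unfolding qnum_Suc'[of p "Suc k"] by (simp add: distrib_right power_add[symmetric] mult.assoc del: qnum.simps power_Suc)
  qed
  also have "inverse p ^ Suc k + qnum (inverse p) (Suc k) = qnum (inverse p) (Suc (Suc k))"
    unfolding qnum_Suc'[of "inverse p" "Suc k"] by (rule add.commute)
  finally show ?case by (simp add: mult.commute[of _ "inverse p"] del: qnum.simps)
qed

lemma YE_n_XE: "YE ^ n * XE = XE * YE ^ n"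
proof -
  obtain k where k: "n = Suc k" using n_pos by (cases n) auto
  have "qnum p (Suc k) = 0" "qnum (inverse p) (Suc k) = 0" "inverse p ^ Suc k = 1"
    using qnum_p_eq_0[of n] qnum_ip_eq_0[of n] p_n by (simp_all add: k power_inverse del: qnum.simps power_Suc)
  then show ?thesis
    using YE_power_XE[of k] by (simp add: k SE_hom del: power_Suc qnum.simps)
qed

lemma YE_power_GE: "YE ^ k * GE e = SE (q powi (- (fst e * int k))) * (GE e * YE ^ k)"
proof (induction k)
  case (Suc k)
  have "YE ^ Suc k * GE e = YE * (YE ^ k * GE e)" by (simp add: mult.assoc)
  also have "\<dots> = SE (q powi (- (fst e * int k)) * q powi (- fst e)) * (GE e * YE ^ Suc k)"
    unfolding Suc by (simp add: SE_commutes GE_commutes SE_hom mult.assoc)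
  also have "q powi (- (fst e * int k)) * q powi (- fst e) = q powi (- (fst e * int (Suc k)))"
    by (simp add: power_int_add[symmetric] algebra_simps)
  finally show ?case .
qed (simp add: SE_hom)

lemma YE_n_GE: "YE ^ n * GE e = GE e * YE ^ n"
  using YE_power_GE[of n e] q_powi_mod[of n "- fst e"] by (simp add: SE_hom)

end

subsection \<open>Commutation up to scalars modulo an ideal of relations\<close>

definition rel_eq :: "('x, 'k::field) free_algebra set \<Rightarrow> ('x, 'k) free_algebra \<Rightarrow> ('x, 'k) free_algebra \<Rightarrow> bool"
  where "rel_eq S f g \<longleftrightarrow> f - g \<in> relation_ideal S"

lemma rel_eq_refl [simp]: "rel_eq S f f"
  by (simp add: rel_eq_def relation_ideal_0)

lemma rel_eq_sym: "rel_eq S f g \<Longrightarrow> rel_eq S g f"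
  unfolding rel_eq_def using relation_ideal_uminus by fastforce

lemma rel_eq_trans [trans]: "rel_eq S f g \<Longrightarrow> rel_eq S g h \<Longrightarrow> rel_eq S f h"
  unfolding rel_eq_def using relation_ideal_add by fastforce

lemma rel_eq_add: "rel_eq S f g \<Longrightarrow> rel_eq S f' g' \<Longrightarrow> rel_eq S (f + f') (g + g')"
  unfolding rel_eq_def using relation_ideal_add[of "f - g" S "f' - g'"] by (simp add: algebra_simps)

lemma rel_eq_mult: "rel_eq S f g \<Longrightarrow> rel_eq S f' g' \<Longrightarrow> rel_eq S (f * f') (g * g')"
  unfolding rel_eq_def
  using relation_ideal_add[OF relation_ideal_rmult[of "f - g" S f'] relation_ideal_lmult[of "f' - g'" S g]]
  by (simp add: algebra_simps)

lemma rel_eq_lmult: "rel_eq S f g \<Longrightarrow> rel_eq S (h * f) (h * g)"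
  and rel_eq_rmult: "rel_eq S f g \<Longrightarrow> rel_eq S (f * h) (g * h)"
  by (simp_all add: rel_eq_mult)

text \<open>Carrying the scalar \<open>r\<close> along reduces the reordering of monomials to
  bookkeeping with exponents.\<close>

definition scommute :: "('x, 'k::field) free_algebra set \<Rightarrow> 'k \<Rightarrow> ('x, 'k) free_algebra \<Rightarrow> ('x, 'k) free_algebra \<Rightarrow> bool"
  where "scommute S r u v \<longleftrightarrow> rel_eq S (u * v) (fscalar r * (v * u))"

lemma scommute_self: "scommute S 1 u u"
  by (simp add: scommute_def fscalar_1)

lemma scommute_one: "scommute S 1 u 1"
  by (simp add: scommute_def fscalar_1)

lemma scommute_sym:
  assumes "scommute S r u v" "r \<noteq> 0" shows "scommute S (inverse r) v u"
proof -
  have "rel_eq S (fscalar (inverse r) * (u * v)) (fscalar (inverse r) * (fscalar r * (v * u)))"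
    using assms rel_eq_lmult by (auto simp: scommute_def)
  also have "fscalar (inverse r) * (fscalar r * (v * u)) = v * u"
    using assms by (simp add: mult.assoc[symmetric] fscalar_mult[symmetric] fscalar_1)
  finally show ?thesis by (simp add: scommute_def rel_eq_sym)
qed

lemma scommute_mult_right:
  assumes "scommute S r u v" "scommute S s u w" shows "scommute S (r * s) u (v * w)"
proof -
  have "rel_eq S (u * v * w) (fscalar r * (v * u) * w)"
    using assms(1) rel_eq_rmult by (auto simp: scommute_def)
  also have "fscalar r * (v * u) * w = fscalar r * v * (u * w)" by (simp add: mult.assoc)
  also have "rel_eq S (fscalar r * v * (u * w)) (fscalar r * v * (fscalar s * (w * u)))"
    using assms(2) rel_eq_lmult by (auto simp: scommute_def)
  also have "fscalar r * v * (fscalar s * (w * u)) = fscalar (r * s) * (v * w * u)"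
    by (simp add: fscalar_mult mult.assoc fscalar_left_commute[of v])
  finally show ?thesis by (simp add: scommute_def mult.assoc)
qed

lemma scommute_mult_left:
  assumes "scommute S r u w" "scommute S s v w" shows "scommute S (r * s) (u * v) w"
proof -
  have "rel_eq S (u * (v * w)) (u * (fscalar s * (w * v)))"
    using assms(2) rel_eq_lmult by (auto simp: scommute_def)
  also have "u * (fscalar s * (w * v)) = fscalar s * ((u * w) * v)"
    by (simp add: mult.assoc fscalar_left_commute[of u])
  also have "rel_eq S (fscalar s * ((u * w) * v)) (fscalar s * ((fscalar r * (w * u)) * v))"
    using assms(1) by (intro rel_eq_lmult rel_eq_rmult) (simp add: scommute_def)
  also have "fscalar s * ((fscalar r * (w * u)) * v) = fscalar (r * s) * (w * (u * v))"
    by (simp add: mult.commute[of r] fscalar_mult mult.assoc)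
  finally show ?thesis by (simp add: scommute_def mult.assoc)
qed

lemma scommute_power_right: "scommute S r u v \<Longrightarrow> scommute S (r ^ i) u (v ^ i)"
  by (induction i) (simp_all add: scommute_one scommute_mult_right)

lemma scommute_power_left: "scommute S r u v \<Longrightarrow> scommute S (r ^ i) (u ^ i) v"
  by (induction i) (simp_all add: scommute_mult_left, simp add: scommute_def fscalar_1)

text \<open>The inverses are generators of their own, and the relations do not say how they commute
  with \<open>x\<close> and \<open>y\<close>; inserting \<open>v v'\<close> and \<open>v' v\<close>
  derives it.\<close>

lemma scommute_inverse_right:
  assumes uv: "scommute S r u v" and "r \<noteq> 0" and inv: "rel_eq S (v * v') 1" "rel_eq S (v' * v) 1"
  shows "scommute S (inverse r) u v'"
proof -
  have "rel_eq S (v' * u * (v * v')) (v' * u * 1)" by (intro rel_eq_lmult inv)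
  then have "rel_eq S (v' * u) (v' * u * (v * v'))" by (simp add: rel_eq_sym)
  also have "v' * u * (v * v') = v' * (u * v) * v'" by (simp add: mult.assoc)
  also have "rel_eq S (v' * (u * v) * v') (v' * (fscalar r * (v * u)) * v')"
    using uv by (intro rel_eq_lmult rel_eq_rmult) (simp add: scommute_def)
  also have "v' * (fscalar r * (v * u)) * v' = fscalar r * ((v' * v) * (u * v'))"
    by (simp add: mult.assoc fscalar_left_commute[of v'])
  also have "rel_eq S (fscalar r * ((v' * v) * (u * v'))) (fscalar r * (1 * (u * v')))"
    by (intro rel_eq_lmult rel_eq_rmult inv)
  finally have "scommute S r v' u" by (simp add: scommute_def)
  then show ?thesis using \<open>r \<noteq> 0\<close> by (rule scommute_sym)
qed

text \<open>The letter \<open>u'\<close> is inverse to \<open>u\<close> only modulo the relations,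
  so negative exponents are powers of a different letter.\<close>

definition zpow :: "('x, 'k::field) free_algebra \<Rightarrow> ('x, 'k) free_algebra \<Rightarrow> int \<Rightarrow> ('x, 'k) free_algebra"
  where "zpow u u' i = (if 0 \<le> i then u ^ nat i else u' ^ nat (- i))"

lemma scommute_zpow:
  assumes "scommute S r u v" "r \<noteq> 0" "rel_eq S (v * v') 1" "rel_eq S (v' * v) 1"
  shows "scommute S (r powi i) u (zpow v v' i)"
  using scommute_power_right[OF assms(1), of "nat i"]
    scommute_power_right[OF scommute_inverse_right[OF assms], of "nat (- i)"]
  by (simp add: zpow_def power_int_def)

lemma zpow_mult:
  assumes "rel_eq S (v * v') 1" "rel_eq S (v' * v) 1"
  shows "rel_eq S (v * zpow v v' i) (zpow v v' (i + 1))" "rel_eq S (v' * zpow v v' i) (zpow v v' (i - 1))"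
proof -
  show "rel_eq S (v * zpow v v' i) (zpow v v' (i + 1))"
  proof (cases "0 \<le> i")
    case True
    then have "nat (i + 1) = Suc (nat i)" by simp
    then show ?thesis using True by (simp add: zpow_def)
  next
    case False
    then have "nat (- i) = Suc (nat (- (i + 1)))" by simp
    then have "zpow v v' i = v' * v' ^ nat (- (i + 1))" using False by (simp add: zpow_def)
    moreover have "zpow v v' (i + 1) = v' ^ nat (- (i + 1))" using False by (auto simp: zpow_def)
    ultimately show ?thesis using rel_eq_rmult[OF assms(1)] by (fastforce simp: mult.assoc)
  qed
  show "rel_eq S (v' * zpow v v' i) (zpow v v' (i - 1))"
  proof (cases "0 < i")
    case True
    then have "nat i = Suc (nat (i - 1))" by simp
    then have "zpow v v' i = v * v ^ nat (i - 1)" using True by (simp add: zpow_def)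
    moreover have "zpow v v' (i - 1) = v ^ nat (i - 1)" using True by (simp add: zpow_def)
    ultimately show ?thesis using rel_eq_rmult[OF assms(2)] by (fastforce simp: mult.assoc)
  next
    case False
    then have "nat (- (i - 1)) = Suc (nat (- i))" by simp
    then show ?thesis using False by (auto simp: zpow_def)
  qed
qed

context H_parameters
begin

abbreviation "Rels \<equiv> H_relations n n1 q \<beta>1 \<beta>2 \<beta>3"
abbreviation req (infix "\<approx>" 50) where "f \<approx> g \<equiv> rel_eq Rels f g"

abbreviation "Fa \<equiv> fgen GA :: (hgen, 'k) free_algebra"
abbreviation "Fa' \<equiv> fgen GAi :: (hgen, 'k) free_algebra"
abbreviation "Fb \<equiv> fgen GB :: (hgen, 'k) free_algebra"
abbreviation "Fb' \<equiv> fgen GBi :: (hgen, 'k) free_algebra"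
abbreviation "Fc \<equiv> fgen GC :: (hgen, 'k) free_algebra"
abbreviation "Fc' \<equiv> fgen GCi :: (hgen, 'k) free_algebra"
abbreviation "Fx \<equiv> fgen GX :: (hgen, 'k) free_algebra"
abbreviation "Fy \<equiv> fgen GY :: (hgen, 'k) free_algebra"

lemma relations:
  "Fa * Fa' \<approx> 1" "Fa' * Fa \<approx> 1" "Fb * Fb' \<approx> 1" "Fb' * Fb \<approx> 1" "Fc * Fc' \<approx> 1" "Fc' * Fc \<approx> 1"
  "Fy * Fx \<approx> fscalar (inverse p) * (Fx * Fy) + fscalar \<beta>3 * (Fa ^ (2 * n1) - Fb * Fc)"
  "Fx ^ n \<approx> fscalar \<beta>1 * (Fa ^ (n * n1) - Fb ^ n)" "Fy ^ n \<approx> fscalar \<beta>2 * (Fa ^ (n * n1) - Fc ^ n)"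
  unfolding rel_eq_def
  by (rule relation_ideal_incl;
      simp add: H_relations_at_def Let_def p_def power_inverse algebra_simps)+

lemma scommute_gens:
  "scommute Rels 1 Fa Fb" "scommute Rels 1 Fa Fc" "scommute Rels 1 Fb Fc"
  "scommute Rels q Fx Fa" "scommute Rels (inverse q) Fy Fa"
  "scommute Rels 1 Fb Fx" "scommute Rels 1 Fc Fx" "scommute Rels 1 Fb Fy" "scommute Rels 1 Fc Fy"
  unfolding scommute_def rel_eq_def
  by (rule relation_ideal_incl; simp add: H_relations_at_def Let_def fscalar_1 mult.assoc)+

lemma scommute_sym1: "scommute S 1 u v \<Longrightarrow> scommute S 1 v u"
  using scommute_sym[of S 1 u v] by simp

definition gw :: "int \<times> int \<times> int \<Rightarrow> (hgen, 'k) free_algebra"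
  where "gw e = zpow Fa Fa' (fst e) * zpow Fb Fb' (fst (snd e)) * zpow Fc Fc' (snd (snd e))"

lemma scommute_gw:
  assumes "scommute Rels r u Fa" "r \<noteq> 0" "scommute Rels 1 u Fb" "scommute Rels 1 u Fc"
  shows "scommute Rels (r powi fst e) u (gw e)"
proof -
  have "scommute Rels (r powi fst e * 1 powi fst (snd e) * 1 powi snd (snd e)) u (gw e)"
    unfolding gw_def by (intro scommute_mult_right scommute_zpow assms relations) simp_all
  then show ?thesis by simp
qed

lemma scommute_y_gw: "scommute Rels (inverse q powi fst e) Fy (gw e)"
  by (intro scommute_gw scommute_gens scommute_sym1; simp)

lemma scommute_group:
  "u \<in> {Fa, Fb, Fc} \<Longrightarrow> v \<in> {Fa, Fb, Fc} \<Longrightarrow> scommute Rels 1 u v"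
  using scommute_gens(1-3) by (auto intro: scommute_self scommute_sym1)

lemma scommute_group':
  assumes "u \<in> {Fa, Fb, Fc, Fa', Fb', Fc'}" "v \<in> {Fa, Fb, Fc}"
  shows "scommute Rels 1 u v"
proof -
  have *: "scommute Rels 1 w' v" if "w \<in> {Fa, Fb, Fc}" "w * w' \<approx> 1" "w' * w \<approx> 1" for w w'
    using scommute_inverse_right[OF scommute_group[OF assms(2) that(1)] _ that(2,3)]
    by (auto intro: scommute_sym1)
  show ?thesis
    using assms scommute_group *[OF _ relations(1,2)] *[OF _ relations(3,4)] *[OF _ relations(5,6)] by auto
qed

lemma group_gw:
  "Fa * gw (i, j, k) \<approx> gw (i + 1, j, k)" "Fa' * gw (i, j, k) \<approx> gw (i - 1, j, k)"
  "Fb * gw (i, j, k) \<approx> gw (i, j + 1, k)" "Fb' * gw (i, j, k) \<approx> gw (i, j - 1, k)"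
  "Fc * gw (i, j, k) \<approx> gw (i, j, k + 1)" "Fc' * gw (i, j, k) \<approx> gw (i, j, k - 1)"
proof -
  let ?A = "zpow Fa Fa'" and ?B = "zpow Fb Fb'" and ?C = "zpow Fc Fc'"
  have za: "u * ?A i \<approx> ?A i * u" if "u \<in> {Fb, Fc, Fb', Fc'}" for u i
    using scommute_zpow[OF scommute_group'[of u Fa] _ relations(1,2), of i] that
    by (auto simp: scommute_def fscalar_1)
  have zb: "u * ?B j \<approx> ?B j * u" if "u \<in> {Fc, Fc'}" for u j
    using scommute_zpow[OF scommute_group'[of u Fb] _ relations(3,4), of j] that
    by (auto simp: scommute_def fscalar_1)
  show "Fa * gw (i, j, k) \<approx> gw (i + 1, j, k)" "Fa' * gw (i, j, k) \<approx> gw (i - 1, j, k)"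
    using zpow_mult[OF relations(1,2), of i, THEN rel_eq_rmult, of "?B j * ?C k"]
    by (simp_all add: gw_def mult.assoc)
  have b: "u * gw (i, j, k) \<approx> gw (i, j', k)" if "u \<in> {Fb, Fb'}" "u * ?B j \<approx> ?B j'" for u j'
  proof -
    have "u * ?A i * (?B j * ?C k) \<approx> ?A i * u * (?B j * ?C k)"
      using that by (intro rel_eq_rmult za) auto
    also have "?A i * u * (?B j * ?C k) = ?A i * (u * ?B j * ?C k)" by (simp add: mult.assoc)
    also have "?A i * (u * ?B j * ?C k) \<approx> ?A i * (?B j' * ?C k)"
      by (intro rel_eq_lmult rel_eq_rmult that)
    finally show ?thesis by (simp add: gw_def mult.assoc)
  qed
  show "Fb * gw (i, j, k) \<approx> gw (i, j + 1, k)" "Fb' * gw (i, j, k) \<approx> gw (i, j - 1, k)"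
    by (intro b zpow_mult relations; simp)+
  have c: "u * gw (i, j, k) \<approx> gw (i, j, k')" if "u \<in> {Fc, Fc'}" "u * ?C k \<approx> ?C k'" for u k'
  proof -
    have "u * ?A i * (?B j * ?C k) \<approx> ?A i * u * (?B j * ?C k)"
      using that by (intro rel_eq_rmult za) auto
    also have "?A i * u * (?B j * ?C k) = ?A i * (u * ?B j * ?C k)" by (simp add: mult.assoc)
    also have "?A i * (u * ?B j * ?C k) \<approx> ?A i * (?B j * u * ?C k)"
      using that by (intro rel_eq_lmult rel_eq_rmult zb) auto
    also have "?A i * (?B j * u * ?C k) = ?A i * ?B j * (u * ?C k)" by (simp add: mult.assoc)
    also have "?A i * ?B j * (u * ?C k) \<approx> ?A i * ?B j * ?C k'"
      by (intro rel_eq_lmult that)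
    finally show ?thesis by (simp add: gw_def mult.assoc)
  qed
  show "Fc * gw (i, j, k) \<approx> gw (i, j, k + 1)" "Fc' * gw (i, j, k) \<approx> gw (i, j, k - 1)"
    by (intro c zpow_mult relations; simp)+
qed

subsection \<open>The monomials span\<close>

text \<open>Closure under congruence builds the passage to the quotient into the span, so rewriting
  steps can be congruences instead of equalities.\<close>

inductive_set mspan :: "(hgen, 'k) free_algebra set"
  where
    monomial: "l < n \<Longrightarrow> m < n \<Longrightarrow> Fx ^ l * (gw e * Fy ^ m) \<in> mspan"
  | add: "f \<in> mspan \<Longrightarrow> g \<in> mspan \<Longrightarrow> f + g \<in> mspan"
  | scalar: "f \<in> mspan \<Longrightarrow> fscalar k * f \<in> mspan"
  | rel: "f \<in> mspan \<Longrightarrow> g \<approx> f \<Longrightarrow> g \<in> mspan"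

lemma span_uminus: "f \<in> mspan \<Longrightarrow> - f \<in> mspan"
proof -
  have "fscalar (- 1) = (- 1 :: (hgen, 'k) free_algebra)"
    by (simp add: fscalar_def single_uminus)
  then show "f \<in> mspan \<Longrightarrow> - f \<in> mspan" using mspan.scalar[of f "- 1"] by simp
qed

lemma span_diff: "f \<in> mspan \<Longrightarrow> g \<in> mspan \<Longrightarrow> f - g \<in> mspan"
  using mspan.add[OF _ span_uminus] by fastforce

lemma span_lmult:
  assumes "\<And>l e m. l < n \<Longrightarrow> m < n \<Longrightarrow> u * (Fx ^ l * (gw e * Fy ^ m)) \<in> mspan" and "f \<in> mspan"
  shows "u * f \<in> mspan"
  using assms(2)
  by (induction rule: mspan.induct)
     (auto simp: assms(1) distrib_left fscalar_left_commute[of u] intro: mspan.intros(2,3) mspan.rel rel_eq_lmult)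

lemma span_group:
  assumes u: "scommute Rels r u Fx" and e: "\<And>e. \<exists>e'. u * gw e \<approx> gw e'" and f: "f \<in> mspan"
  shows "u * f \<in> mspan"
proof (rule span_lmult[OF _ f])
  fix l m e assume lm: "l < n" "m < n"
  obtain e' where e': "u * gw e \<approx> gw e'" using e by blast
  have "u * Fx ^ l * (gw e * Fy ^ m) \<approx> fscalar (r ^ l) * (Fx ^ l * u) * (gw e * Fy ^ m)"
    using scommute_power_right[OF u, of l] by (intro rel_eq_rmult) (simp add: scommute_def)
  also have "fscalar (r ^ l) * (Fx ^ l * u) * (gw e * Fy ^ m) = fscalar (r ^ l) * (Fx ^ l * (u * gw e * Fy ^ m))"
    by (simp add: mult.assoc)
  also have "fscalar (r ^ l) * (Fx ^ l * (u * gw e * Fy ^ m)) \<approx> fscalar (r ^ l) * (Fx ^ l * (gw e' * Fy ^ m))"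
    by (intro rel_eq_lmult rel_eq_rmult e')
  finally have "u * Fx ^ l * (gw e * Fy ^ m) \<in> mspan"
    by (rule mspan.rel[OF mspan.scalar[OF mspan.monomial[OF lm]]])
  then show "u * (Fx ^ l * (gw e * Fy ^ m)) \<in> mspan" by (simp add: mult.assoc)
qed

lemma span_gens:
  assumes "f \<in> mspan"
  shows "Fa * f \<in> mspan" "Fa' * f \<in> mspan" "Fb * f \<in> mspan" "Fb' * f \<in> mspan" "Fc * f \<in> mspan" "Fc' * f \<in> mspan"
proof -
  have a: "scommute Rels (inverse q) Fa Fx" by (rule scommute_sym[OF scommute_gens(4)]) simp
  have inv: "\<exists>r. scommute Rels r v' Fx" if "scommute Rels r v Fx" "r \<noteq> 0" "v * v' \<approx> 1" "v' * v \<approx> 1" for r v v'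
  proof -
    have "scommute Rels (inverse (inverse r)) Fx v'"
      by (rule scommute_inverse_right[OF scommute_sym[OF that(1,2)] _ that(3,4)]) (use that(2) in simp)
    from scommute_sym[OF this] show ?thesis using that(2) by auto
  qed
  show "Fa * f \<in> mspan" by (rule span_group[OF a _ assms]) (use group_gw(1) in \<open>metis prod_cases3\<close>)
  show "Fb * f \<in> mspan" by (rule span_group[OF scommute_gens(6) _ assms]) (use group_gw(3) in \<open>metis prod_cases3\<close>)
  show "Fc * f \<in> mspan" by (rule span_group[OF scommute_gens(7) _ assms]) (use group_gw(5) in \<open>metis prod_cases3\<close>)
  obtain r where "scommute Rels r Fa' Fx" using inv[OF a _ relations(1,2)] by auto
  then show "Fa' * f \<in> mspan" by (rule span_group[OF _ _ assms]) (use group_gw(2) in \<open>metis prod_cases3\<close>)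
  obtain r where "scommute Rels r Fb' Fx" using inv[OF scommute_gens(6) _ relations(3,4)] by auto
  then show "Fb' * f \<in> mspan" by (rule span_group[OF _ _ assms]) (use group_gw(4) in \<open>metis prod_cases3\<close>)
  obtain r where "scommute Rels r Fc' Fx" using inv[OF scommute_gens(7) _ relations(5,6)] by auto
  then show "Fc' * f \<in> mspan" by (rule span_group[OF _ _ assms]) (use group_gw(6) in \<open>metis prod_cases3\<close>)
qed

lemma span_power:
  "f \<in> mspan \<Longrightarrow> Fa ^ i * f \<in> mspan" "f \<in> mspan \<Longrightarrow> Fb ^ i * f \<in> mspan" "f \<in> mspan \<Longrightarrow> Fc ^ i * f \<in> mspan"
  by (induction i; simp add: span_gens mult.assoc)+

lemma span_x: assumes "f \<in> mspan" shows "Fx * f \<in> mspan"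
proof (rule span_lmult[OF _ assms])
  fix l m e assume lm: "l < n" "m < n"
  show "Fx * (Fx ^ l * (gw e * Fy ^ m)) \<in> mspan"
  proof (cases "Suc l < n")
    case True
    then show ?thesis using mspan.monomial[OF True lm(2), of e] by (simp add: mult.assoc)
  next
    \<comment> \<open>Here \<open>l = n - 1\<close>, and the product overflows to
      \<open>x^n\<close>; its relation turns it into group elements acting on a monomial free of
      \<open>x\<close>.\<close>
    case False
    then have l: "n = Suc l" using lm by simp
    let ?g = "Fx ^ 0 * (gw e * Fy ^ m)"
    have "?g \<in> mspan" using lm by (intro mspan.monomial) auto
    then have "fscalar \<beta>1 * (Fa ^ (n * n1) * ?g - Fb ^ n * ?g) \<in> mspan"
      by (intro mspan.scalar span_diff span_power)
    moreover have "Fx ^ n * ?g \<approx> (fscalar \<beta>1 * (Fa ^ (n * n1) - Fb ^ n)) * ?g"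
      by (intro rel_eq_rmult relations)
    moreover have "Fx ^ n * ?g = Fx * (Fx ^ l * (gw e * Fy ^ m))"
      "(fscalar \<beta>1 * (Fa ^ (n * n1) - Fb ^ n)) * ?g = fscalar \<beta>1 * (Fa ^ (n * n1) * ?g - Fb ^ n * ?g)"
      by (simp_all add: l algebra_simps)
    ultimately show ?thesis using mspan.rel by metis
  qed
qed

text \<open>Induction on the exponent of \<open>x\<close>: moving \<open>y\<close> past one
  \<open>x\<close> leaves \<open>x\<close> times a case already treated, plus group elements times a
  monomial. At exponent zero \<open>y\<close> passes the group word and may overflow to
  \<open>y^n\<close>.\<close>

lemma span_y: assumes "f \<in> mspan" shows "Fy * f \<in> mspan"
proof (rule span_lmult[OF _ assms])
  fix l m e assume lm: "l < n" "m < n"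
  show "Fy * (Fx ^ l * (gw e * Fy ^ m)) \<in> mspan"
    using lm(1)
  proof (induction l)
    case 0
    let ?r = "inverse q powi fst e"
    have "Fy * gw e * Fy ^ m \<approx> fscalar ?r * (gw e * Fy) * Fy ^ m"
      using scommute_y_gw[of e] by (intro rel_eq_rmult) (simp add: scommute_def)
    then have 1: "Fy * gw e * Fy ^ m \<approx> fscalar ?r * (gw e * Fy ^ Suc m)"
      by (simp add: mult.assoc)
    have "gw e * Fy ^ Suc m \<in> mspan"
    proof (cases "Suc m < n")
      case True
      then show ?thesis using mspan.monomial[of 0 "Suc m" e] n_pos by simp
    next
      case False
      then have m: "n = Suc m" using lm by simp
      have g: "gw e \<in> mspan" using mspan.monomial[of 0 0 e] n_pos by simp
      then have "fscalar \<beta>2 * (Fa ^ (n * n1) * gw e - Fc ^ n * gw e) \<in> mspan"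
        by (intro mspan.scalar span_diff span_power)
      moreover have "gw e * Fy ^ n \<approx> fscalar \<beta>2 * (Fa ^ (n * n1) * gw e - Fc ^ n * gw e)"
      proof -
        have *: "scommute Rels 1 (u ^ i) (gw e)" if "u \<in> {Fa, Fc}" for u i
          using scommute_power_left[OF scommute_gw[of 1 u e]] scommute_group[of u] that by auto
        have "gw e * Fy ^ n \<approx> gw e * (fscalar \<beta>2 * (Fa ^ (n * n1) - Fc ^ n))"
          by (intro rel_eq_lmult relations)
        also have "gw e * (fscalar \<beta>2 * (Fa ^ (n * n1) - Fc ^ n))
            = fscalar \<beta>2 * (gw e * Fa ^ (n * n1)) + fscalar (- \<beta>2) * (gw e * Fc ^ n)"
          by (simp add: fscalar_left_commute[of "gw e"] algebra_simps) (simp add: fscalar_def single_uminus)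
        also have "\<dots> \<approx> fscalar \<beta>2 * (Fa ^ (n * n1) * gw e) + fscalar (- \<beta>2) * (Fc ^ n * gw e)"
          using *[of Fa "n * n1"] *[of Fc n]
          by (intro rel_eq_add rel_eq_lmult) (simp_all add: scommute_def fscalar_1 rel_eq_sym)
        also have "\<dots> = fscalar \<beta>2 * (Fa ^ (n * n1) * gw e - Fc ^ n * gw e)"
          by (simp add: algebra_simps) (simp add: fscalar_def single_uminus)
        finally show ?thesis .
      qed
      ultimately show ?thesis using mspan.rel m by metis
    qed
    then have "fscalar ?r * (gw e * Fy ^ Suc m) \<in> mspan" by (rule mspan.scalar)
    then show ?case using mspan.rel 1 by (simp add: mult.assoc)
  next
    case (Suc l)
    let ?g = "Fx ^ l * (gw e * Fy ^ m)"
    have g: "?g \<in> mspan" "Fy * ?g \<in> mspan" using Suc lm by (auto intro: mspan.monomial)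
    have "Fy * Fx * ?g \<approx> (fscalar (inverse p) * (Fx * Fy) + fscalar \<beta>3 * (Fa ^ (2 * n1) - Fb * Fc)) * ?g"
      by (intro rel_eq_rmult relations)
    also have "(fscalar (inverse p) * (Fx * Fy) + fscalar \<beta>3 * (Fa ^ (2 * n1) - Fb * Fc)) * ?g
        = fscalar (inverse p) * (Fx * (Fy * ?g)) + fscalar \<beta>3 * (Fa ^ (2 * n1) * ?g - Fb * (Fc * ?g))"
      by (simp only: distrib_right left_diff_distrib mult.assoc)
    finally have "Fy * Fx * ?g \<approx> \<dots>" .
    moreover have "\<dots> \<in> mspan"
      using g by (intro mspan.add mspan.scalar span_diff span_x span_power span_gens)
    ultimately show ?case using mspan.rel by (simp add: mult.assoc)
  qed
qed

lemma span_UNIV: "f \<in> mspan"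
proof (induction f rule: free_algebra_induct)
  case one
  have "gw 0 = 1" by (simp add: gw_def zpow_def zero_prod_def)
  then show ?case using mspan.monomial[of 0 0 0] n_pos by simp
next
  case (gen s f)
  then show ?case by (cases s) (simp_all add: span_gens span_x span_y)
qed (auto intro: mspan.intros(2,3))

end

context H_parameters
begin

subsection \<open>The representation and its faithfulness\<close>

definition genE :: "hgen \<Rightarrow> 'k coords endo"
  where "genE s = (case s of GA \<Rightarrow> GE (1, 0, 0) | GAi \<Rightarrow> GE (-1, 0, 0) | GB \<Rightarrow> GE (0, 1, 0)
    | GBi \<Rightarrow> GE (0, -1, 0) | GC \<Rightarrow> GE (0, 0, 1) | GCi \<Rightarrow> GE (0, 0, -1) | GX \<Rightarrow> XE | GY \<Rightarrow> YE)"

definition Rep :: "(hgen, 'k) free_algebra \<Rightarrow> 'k coords endo" where "Rep = free_lift SE genE"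

lemma Rep_lift: "free_algebra_lift SE genE"
  by unfold_locales (simp_all add: SE_hom genE_def SE_GE SE_XE SE_YE split: hgen.split)

lemmas Rep_simps = free_algebra_lift.flift_simps[OF Rep_lift, folded Rep_def]

lemma Rep_gens: "Rep Fa = GE (1, 0, 0)" "Rep Fa' = GE (-1, 0, 0)" "Rep Fb = GE (0, 1, 0)" "Rep Fb' = GE (0, -1, 0)"
    "Rep Fc = GE (0, 0, 1)" "Rep Fc' = GE (0, 0, -1)" "Rep Fx = XE" "Rep Fy = YE"
  by (simp_all add: Rep_simps genE_def)

text \<open>The defect of the relation for \<open>y^n\<close>, the one relation not verified by
  direct computation with the operators.\<close>

definition "TE = YE ^ n - SE \<beta>2 * (GE (int (n * n1), 0, 0) - GE (0, 0, int n))"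

lemma GE_mult: "GE (i, j, k) * GE (i', j', k') = GE (i + i', j + j', k + k')"
  by (simp add: GE_hom[symmetric])

lemma GE_000: "GE (0, 0, 0) = 1"
  using GE_hom(2) by (simp add: zero_prod_def)

lemma Rep_relations:
  assumes "r \<in> Rels" "r \<noteq> Fy ^ n - fscalar \<beta>2 * (Fa ^ (n * n1) - Fc ^ n)"
  shows "Rep r = 0"
proof -
  have 1: "XE * GE (1, 0, 0) = SE q * GE (1, 0, 0) * XE" "YE * GE (1, 0, 0) = SE (inverse q) * GE (1, 0, 0) * YE"
    using XE_GE[of "(1, 0, 0)"] YE_GE[of "(1, 0, 0)"] by simp_all
  have 2: "XE * GE (0, j, k) = GE (0, j, k) * XE" "YE * GE (0, j, k) = GE (0, j, k) * YE" for j k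
    using XE_GE[of "(0, j, k)"] YE_GE[of "(0, j, k)"] by (simp_all add: SE_hom)
  have 3: "YE * XE = SE (inverse q ^ n1) * XE * YE + SE \<beta>3 * (GE (int (2 * n1), 0, 0) - GE (0, 1, 1))"
    using YE_XE by (simp add: p_def power_inverse)
  show ?thesis
    using assms unfolding H_relations_at_def Let_def
    by (elim insertE; simp add: Rep_simps genE_def GE_power GE_mult GE_000 1 2 3 XE_n)
qed

lemma Rep_TE: "Rep (Fy ^ n - fscalar \<beta>2 * (Fa ^ (n * n1) - Fc ^ n)) = TE"
  unfolding Rep_simps(1-7,9) Rep_gens GE_power TE_def by simp

lemma TE_commutes: "TE * Rep f = Rep f * TE"
proof -
  have SE: "SE k * TE = TE * SE k" for k
  proof (rule endo_eqI)
    fix v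
    have "SE k * YE ^ i = YE ^ i * SE k" for i
    proof (induction i)
      case (Suc i)
      have "SE k * YE ^ Suc i = YE * (SE k * YE ^ i)" by (simp add: mult.assoc[symmetric] SE_YE)
      then show ?case by (simp add: Suc mult.assoc)
    qed simp
    then show "app (SE k * TE) v = app (TE * SE k) v"
      unfolding TE_def right_diff_distrib left_diff_distrib
      by (simp add: app_simps app_SE app_GE opS_def opG_def fun_eq_iff mult_ac right_diff_distrib)
  qed
  have G: "TE * GE e = GE e * TE" for e
  proof -
    have "GE e' * GE e = GE e * GE e'" for e' by (simp add: GE_hom[symmetric] add.commute)
    then have "SE k * (GE e' * GE e) = GE e * (SE k * GE e')" for e' k by (simp add: SE_commutes)
    then show ?thesis
      unfolding TE_def right_diff_distrib left_diff_distrib mult.assoc YE_n_GE by simp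
  qed
  have X: "TE * XE = XE * TE"
  proof -
    have "GE (int (n * n1), 0, 0) * XE = XE * GE (int (n * n1), 0, 0)" "GE (0, 0, int n) * XE = XE * GE (0, 0, int n)"
      using XE_GE[of "(int (n * n1), 0, 0)"] XE_GE[of "(0, 0, int n)"] q_powi_nn1
      by (simp_all add: SE_hom del: of_nat_mult)
    then show ?thesis
      unfolding TE_def right_diff_distrib left_diff_distrib mult.assoc YE_n_XE by (simp add: SE_commutes del: of_nat_mult)
  qed
  have Y: "TE * YE = YE * TE"
  proof -
    have "GE (int (n * n1), 0, 0) * YE = YE * GE (int (n * n1), 0, 0)" "GE (0, 0, int n) * YE = YE * GE (0, 0, int n)"
      using YE_GE[of "(int (n * n1), 0, 0)"] YE_GE[of "(0, 0, int n)"] q_powi_nn1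
      by (simp_all add: SE_hom del: of_nat_mult)
    then show ?thesis
      unfolding TE_def right_diff_distrib left_diff_distrib mult.assoc
      by (simp add: SE_commutes power_commutes del: of_nat_mult)
  qed
  have gen_comm: "TE * genE s = genE s * TE" for s by (simp add: genE_def G X Y split: hgen.split)
  show ?thesis
  proof (induction f rule: free_algebra_induct)
    case (scalar k f)
    have "TE * (SE k * Rep f) = SE k * (TE * Rep f)" by (simp add: mult.assoc[symmetric] SE)
    then show ?case by (simp add: Rep_simps scalar mult.assoc)
  next
    case (gen s f)
    have "TE * (genE s * Rep f) = genE s * (TE * Rep f)" by (simp add: mult.assoc[symmetric] gen_comm)
    then show ?case by (simp add: Rep_simps gen mult.assoc)
  qed (simp_all add: Rep_simps algebra_simps)
qed

text \<open>The first block, which carries the left regular representation of the algebra.\<close>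

definition V0 :: "'k coords set"
  where "V0 = {v. \<forall>l m. \<not> (l < n \<and> m < n) \<longrightarrow> v l m = 0}"

definition unitv :: "nat \<Rightarrow> 'k laurent \<Rightarrow> nat \<Rightarrow> 'k coords"
  where "unitv l g m = (\<lambda>l' m'. if l' = l \<and> m' = m then g else 0)"

definition \<rho> :: "(hgen, 'k) free_algebra \<Rightarrow> 'k coords" where "\<rho> f = app (Rep f) (unitv 0 1 0)"

lemma \<rho>_add: "\<rho> (f + g) = \<rho> f + \<rho> g" and \<rho>_diff: "\<rho> (f - g) = \<rho> f - \<rho> g"
  and \<rho>_zero: "\<rho> 0 = 0" and \<rho>_mult: "\<rho> (f * g) = app (Rep f) (\<rho> g)"
  and \<rho>_scalar: "\<rho> (fscalar k * f) = opS k (\<rho> f)"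
  by (simp_all add: \<rho>_def Rep_simps app_simps app_SE)

lemma \<rho>_sum: "\<rho> (sum F S) = (\<Sum>i\<in>S. \<rho> (F i))"
  by (induction S rule: infinite_finite_induct) (simp_all add: \<rho>_add \<rho>_zero)

lemma opY_unitv: "Suc m < n \<Longrightarrow> opY (unitv 0 1 m) = unitv 0 1 (Suc m)"
  "opY (unitv 0 1 (n - 1)) = unitv 0 z2 0"
proof -
  have sh: "sh (unitv 0 1 m) l m' = (if l = 0 \<and> m' = Suc m then 1 else 0)" if "Suc m < n" for l m'
    using that by (cases m') (auto simp: sh_def unitv_def mod_Suc split: if_splits)
  show "opY (unitv 0 1 m) = unitv 0 1 (Suc m)" if m: "Suc m < n"
    unfolding opY_def sh[OF m] by (auto simp: \<tau>_hom fun_eq_iff unitv_def lconst_hom)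
  have sh: "sh (unitv 0 1 (n - 1)) l m' = (if l = 0 \<and> m' = 0 then z2 else 0)" for l m'
    using n_ge_2 by (cases m') (auto simp: sh_def unitv_def)
  show "opY (unitv 0 1 (n - 1)) = unitv 0 z2 0"
    unfolding opY_def sh by (auto simp: \<tau>_hom \<tau>_z2 fun_eq_iff unitv_def lconst_hom)
qed

lemma YE_power_unitv: "m < n \<Longrightarrow> app (YE ^ m) (unitv 0 1 0) = unitv 0 1 m"
  by (induction m) (simp_all add: app_simps app_YE opY_unitv)

lemma TE_unitv: "app TE (unitv 0 1 0) = 0"
proof -
  have "YE ^ n = YE * YE ^ (n - 1)" using n_pos power_eq_if[of YE n] by simp
  then have "app (YE ^ n) (unitv 0 1 0) = unitv 0 z2 0"
    using YE_power_unitv[of "n - 1"] opY_unitv(2) n_pos by (simp add: app_simps app_YE)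
  then show ?thesis
    by (auto simp: TE_def app_simps app_SE app_GE opS_def opG_def unitv_def z2_def fun_eq_iff lconst_hom)
qed

lemma opG_unitv: "opG e (unitv 0 1 m) = unitv 0 (mon e) m"
  by (auto simp: opG_def unitv_def fun_eq_iff lconst_hom)

lemma XE_power_unitv:
  assumes "l < n" shows "app (XE ^ l) (unitv 0 g m) = unitv l g m"
proof -
  have "l \<le> l' mod n \<and> l' - l = 0 \<longleftrightarrow> l' = l" for l'
    using assms mod_less_eq_dividend[of l' n] by auto
  then show ?thesis
    using assms by (auto simp: XE_power_app unitv_def fun_eq_iff)
qed

lemma Rep_zpow:
  assumes "\<And>i. Rep u ^ i = GE (int i * a, int i * b, int i * c)" "\<And>i. Rep u' ^ i = GE (- (int i * a), - (int i * b), - (int i * c))"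
  shows "Rep (zpow u u' i) = GE (i * a, i * b, i * c)"
  using assms(1)[of "nat i"] assms(2)[of "nat (- i)"] by (auto simp: zpow_def Rep_simps)

lemma Rep_gw: "Rep (gw e) = GE e"
proof -
  have "Rep (zpow Fa Fa' i) = GE (i, 0, 0)" "Rep (zpow Fb Fb' i) = GE (0, i, 0)" "Rep (zpow Fc Fc' i) = GE (0, 0, i)" for i
    using Rep_zpow[of Fa 1 0 0 Fa' i] Rep_zpow[of Fb 0 1 0 Fb' i] Rep_zpow[of Fc 0 0 1 Fc' i]
    by (simp_all add: Rep_gens GE_power)
  then show ?thesis by (simp add: gw_def Rep_simps(4) GE_mult)
qed

lemma \<rho>_monomial: "l < n \<Longrightarrow> m < n \<Longrightarrow> \<rho> (Fx ^ l * (gw e * Fy ^ m)) = unitv l (mon e) m"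
  by (simp add: \<rho>_def Rep_simps(4,5) Rep_gens Rep_gw app_simps app_GE YE_power_unitv opG_unitv XE_power_unitv)

definition \<iota> :: "'k laurent \<Rightarrow> (hgen, 'k) free_algebra" where "\<iota> = monoid_lift fscalar gw"

lemma \<iota>_lift: "additive_lift (fscalar :: 'k \<Rightarrow> (hgen, 'k) free_algebra)"
  by unfold_locales (rule fscalar_add)

text \<open>An inverse of \<open>\<rho>\<close>: exact on \<open>V0\<close>, and up to the relations
  on the free algebra.\<close>

definition assemble :: "'k coords \<Rightarrow> (hgen, 'k) free_algebra"
  where "assemble v = (\<Sum>l<n. \<Sum>m<n. Fx ^ l * (\<iota> (v l m) * Fy ^ m))"

lemma assemble_add: "assemble (u + v) = assemble u + assemble v"
  by (simp add: assemble_def \<iota>_def additive_lift.lift_add[OF \<iota>_lift] sum.distrib[symmetric] algebra_simps)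

lemma \<iota>_lconst: "\<iota> (lconst k * g) = fscalar k * \<iota> g"
proof -
  have *: "\<iota> (lconst k * (\<Sum>w\<in>S. Poly_Mapping.single w (F w))) = fscalar k * \<iota> (\<Sum>w\<in>S. Poly_Mapping.single w (F w))" for S F
    unfolding \<iota>_def sum_distrib_left additive_lift.lift_sum[OF \<iota>_lift]
    by (simp add: lconst_def mult_single additive_lift.lift_single[OF \<iota>_lift] fscalar_mult mult.assoc)
  from *[of "Poly_Mapping.lookup g" "Poly_Mapping.keys g"]
  show ?thesis unfolding poly_mapping_sum_single[symmetric] .
qed

lemma assemble_opS: "assemble (opS k v) = fscalar k * assemble v"
  by (simp add: assemble_def opS_def \<iota>_lconst sum_distrib_left mult.assoc fscalar_left_commute[of "Fx ^ _"])

lemma \<iota>_mon: "\<iota> (mon e) = gw e"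
  by (simp add: \<iota>_def mon_def additive_lift.lift_single[OF \<iota>_lift] fscalar_1)

lemma \<iota>_zero: "\<iota> 0 = 0"
  by (simp add: \<iota>_def additive_lift.lift_zero[OF \<iota>_lift])

lemma sum_delta2:
  fixes F :: "nat \<Rightarrow> nat \<Rightarrow> 'x::comm_monoid_add"
  shows "(\<Sum>l'<n. \<Sum>m'<n. if l' = l then if m' = m then F l' m' else 0 else 0)
    = (if l < n \<and> m < n then F l m else 0)"
proof -
  have "(\<Sum>m'<n. if l' = l then if m' = m then F l' m' else 0 else 0)
      = (if l' = l then if m < n then F l m else 0 else 0)" for l'
    by (cases "l' = l") simp_all
  then show ?thesis by simp
qed

lemma assemble_unitv:
  assumes "l < n" "m < n" shows "assemble (unitv l g m) = Fx ^ l * (\<iota> g * Fy ^ m)"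
proof -
  have "assemble (unitv l g m) = (\<Sum>l'<n. \<Sum>m'<n. if l' = l then if m' = m then Fx ^ l * (\<iota> g * Fy ^ m) else 0 else 0)"
    unfolding assemble_def unitv_def by (intro sum.cong refl) (auto simp: \<iota>_zero)
  also have "\<dots> = Fx ^ l * (\<iota> g * Fy ^ m)"
    using assms by (simp only: sum_delta2 simp_thms if_True)
  finally show ?thesis .
qed

lemma \<rho>_assemble: assumes "v \<in> V0" shows "\<rho> (assemble v) = v"
proof -
  have 1: "\<rho> (Fx ^ l * (\<iota> g * Fy ^ m)) = unitv l g m" if "l < n" "m < n" for l m g
  proof -
    have *: "\<rho> (Fx ^ l * (\<iota> (\<Sum>w\<in>S. Poly_Mapping.single w (F w)) * Fy ^ m)) = unitv l (\<Sum>w\<in>S. Poly_Mapping.single w (F w)) m"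
      for S F
    proof -
      have "\<rho> (Fx ^ l * (\<iota> (Poly_Mapping.single w k) * Fy ^ m)) = unitv l (Poly_Mapping.single w k) m" for w k
        using \<rho>_monomial[OF that, of w]
        by (simp add: single_eq_mon \<iota>_lconst \<iota>_mon mult.assoc fscalar_left_commute[of "Fx ^ _"] \<rho>_scalar)
           (auto simp: opS_def unitv_def fun_eq_iff)
      then have "\<rho> (Fx ^ l * (\<iota> (\<Sum>w\<in>S. Poly_Mapping.single w (F w)) * Fy ^ m)) = (\<Sum>w\<in>S. unitv l (Poly_Mapping.single w (F w)) m)"
        by (simp add: \<iota>_def additive_lift.lift_sum[OF \<iota>_lift] sum_distrib_right sum_distrib_left \<rho>_sum)
      also have "\<dots> = unitv l (\<Sum>w\<in>S. Poly_Mapping.single w (F w)) m"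
        by (induction S rule: infinite_finite_induct) (auto simp: unitv_def fun_eq_iff)
      finally show ?thesis .
    qed
    from *[of "Poly_Mapping.lookup g" "Poly_Mapping.keys g"]
    show ?thesis unfolding poly_mapping_sum_single[symmetric] .
  qed
  have "\<rho> (assemble v) = (\<Sum>l<n. \<Sum>m<n. unitv l (v l m) m)"
    unfolding assemble_def \<rho>_sum by (intro sum.cong refl 1) auto
  also have "\<dots> = v"
  proof (intro ext)
    fix l' m'
    have sum_app: "(\<Sum>i\<in>S. F i) x = (\<Sum>i\<in>S. F i x)" for S and F :: "nat \<Rightarrow> 'x \<Rightarrow> 'y::ab_group_add" and x
      by (induction S rule: infinite_finite_induct) simp_all
    have "(\<Sum>l<n. \<Sum>m<n. unitv l (v l m) m) l' m' = (\<Sum>l<n. \<Sum>m<n. if l = l' then if m = m' then v l m else 0 else 0)"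
      unfolding sum_app unitv_def by (intro sum.cong refl) auto
    also have "\<dots> = (if l' < n \<and> m' < n then v l' m' else 0)"
      by (rule sum_delta2)
    also have "\<dots> = v l' m'" using assms by (auto simp: V0_def)
    finally show "(\<Sum>l<n. \<Sum>m<n. unitv l (v l m) m) l' m' = v l' m'" .
  qed
  finally show ?thesis .
qed

lemma V0_Rep: assumes "v \<in> V0" shows "app (Rep f) v \<in> V0"
proof (induction f rule: free_algebra_induct)
  case (gen s f)
  let ?w = "app (Rep f) v"
  have w: "?w l m = 0" if "\<not> (l < n \<and> m < n)" for l m using gen that by (auto simp: V0_def)
  have G: "opG e ?w \<in> V0" for e by (auto simp: V0_def opG_def w)
  have "opX ?w l m = 0" if lm: "\<not> (l < n \<and> m < n)" for l m
  proof (cases "l mod n = 0")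
    case True
    have "\<not> (l + n - 1 < n \<and> m < n)" using lm n_pos by auto
    then show ?thesis using True by (simp add: opX_def w del: One_nat_def)
  next
    case False
    then have "\<not> (l - 1 < n \<and> m < n)" using lm by (cases "l = n") auto
    then show ?thesis using False by (simp add: opX_def w del: One_nat_def)
  qed
  then have X: "opX ?w \<in> V0" by (auto simp: V0_def)
  have "sh ?w l m = 0" if lm: "\<not> (l < n \<and> m < n)" for l m
  proof (cases "m mod n = 0")
    case True
    have "\<not> (l < n \<and> m + n - 1 < n)" using lm n_pos by auto
    then show ?thesis using True by (simp add: sh_def w del: One_nat_def)
  next
    case False
    then have "\<not> (l < n \<and> m - 1 < n)" using lm by (cases "m = n") auto
    then show ?thesis using False by (simp add: sh_def w del: One_nat_def)
  qed
  then have Y: "opY ?w \<in> V0" by (auto simp: V0_def opY_def \<tau>_hom w)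
  show ?case using G X Y
    by (auto simp: Rep_simps app_simps genE_def app_GE app_XE app_YE split: hgen.split)
qed (use assms in \<open>auto simp: Rep_simps app_simps app_SE opS_def V0_def\<close>)

lemma unitv_V0: "l < n \<Longrightarrow> m < n \<Longrightarrow> unitv l g m \<in> V0"
  by (auto simp: unitv_def V0_def)

lemma \<rho>_V0: "\<rho> f \<in> V0"
  unfolding \<rho>_def by (rule V0_Rep[OF unitv_V0]) (use n_pos in auto)

text \<open>Every vector of the block arises from the cyclic vector \<open>unitv 0 1 0\<close> by
  the action; \<open>TE\<close> moves past the action and kills that vector.\<close>

lemma TE_V0: assumes "v \<in> V0" shows "app TE v = 0"
proof -
  have "app TE v = app (TE * Rep (assemble v)) (unitv 0 1 0)"
    using \<rho>_assemble[OF assms] by (simp add: app_simps \<rho>_def)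
  also have "\<dots> = app (Rep (assemble v)) (app TE (unitv 0 1 0))" by (simp add: TE_commutes app_simps)
  finally show ?thesis by (simp add: TE_unitv app_0)
qed

lemma Rep_relation_ideal:
  assumes "f \<in> relation_ideal Rels" "v \<in> V0" shows "app (Rep f) v = 0"
proof -
  have "relation_ideal Rels \<subseteq> {f. \<forall>v\<in>V0. app (Rep f) v = 0}"
  proof (rule relation_ideal_least)
    show "Rels \<subseteq> {f. \<forall>v\<in>V0. app (Rep f) v = 0}"
      using Rep_relations Rep_TE TE_V0 by (force simp: app_simps)
  qed (auto simp: Rep_simps app_simps app_0 V0_Rep)
  then show ?thesis using assms by auto
qed

text \<open>Spanning meets independence: along the generation of \<open>mspan\<close>, every
  \<open>f\<close> is congruent to \<open>assemble (\<rho> f)\<close>, so vanishing coordinates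
  force \<open>f\<close> into the ideal.\<close>

theorem \<rho>_kernel: "\<rho> f = 0 \<longleftrightarrow> f \<in> relation_ideal Rels"
proof
  assume "f \<in> relation_ideal Rels"
  then show "\<rho> f = 0"
    unfolding \<rho>_def by (rule Rep_relation_ideal[OF _ unitv_V0]) (use n_pos in auto)
next
  have "f \<approx> assemble (\<rho> f)" using span_UNIV[of f]
  proof (induction rule: mspan.induct)
    case (monomial l m e)
    then show ?case by (simp add: \<rho>_monomial assemble_unitv \<iota>_mon)
  next
    case (add f g)
    show ?case unfolding \<rho>_add assemble_add using add.IH by (rule rel_eq_add)
  next
    case (scalar f k)
    show ?case unfolding \<rho>_scalar assemble_opS using scalar.IH by (rule rel_eq_lmult)
  next
    case (rel f g)
    have "\<rho> (g - f) = 0"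
      unfolding \<rho>_def by (rule Rep_relation_ideal[OF _ unitv_V0]) (use rel n_pos in \<open>auto simp: rel_eq_def\<close>)
    then have "\<rho> g = \<rho> f" by (simp add: \<rho>_diff)
    then show ?case using rel rel_eq_trans by metis
  qed
  moreover assume "\<rho> f = 0"
  moreover have "assemble 0 = 0" by (simp add: assemble_def \<iota>_zero)
  ultimately show "f \<in> relation_ideal Rels" by (simp add: rel_eq_def)
qed

end

section \<open>The regular sequence and the integrals\<close>

lemma laurent_induct [case_names add monomial]:
  assumes add: "\<And>u v. Q u \<Longrightarrow> Q v \<Longrightarrow> Q (u + v)" and mon: "\<And>k e. Q (lconst k * mon e)"
  shows "Q (u :: 'k::field laurent)"
proof -
  have "Q 0" using mon[of 0 0] by (simp add: lconst_hom)
  then have "Q (\<Sum>w\<in>S. Poly_Mapping.single w (F w))" for S and F :: "int \<times> int \<times> int \<Rightarrow> 'k"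
    by (induction S rule: infinite_finite_induct) (auto intro!: add mon simp: single_eq_mon)
  from this[of "Poly_Mapping.lookup u" "Poly_Mapping.keys u"]
  show ?thesis unfolding poly_mapping_sum_single[symmetric] .
qed

lemma lookup_mon_mult: "Poly_Mapping.lookup (mon e * u) w = Poly_Mapping.lookup u (w - e)"
proof (induction u rule: laurent_induct)
  case (add u v)
  then show ?case by (simp add: distrib_left lookup_add)
next
  case (monomial k e')
  have "mon e * (lconst k * mon e') = Poly_Mapping.single (e + e') k"
    by (simp add: mon_def lconst_def mult_single)
  moreover have "e + e' = w \<longleftrightarrow> e' = w - e" by (auto simp: algebra_simps)
  ultimately show ?case
    by (simp add: single_eq_mon[symmetric] lookup_single when_def)
qed

text \<open>If multiplication by the monomial fixes \<open>u\<close>, the support of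
  \<open>u\<close> is invariant under a translation of infinite order, so it is empty or
  infinite.\<close>

lemma mon_minus_1_regular:
  fixes u :: "'k::field laurent"
  assumes inj: "inj (\<lambda>k::nat. (int k * i, int k * j, int k * r))" and u: "(mon (i, j, r) - 1) * u = 0"
  shows "u = 0"
proof (rule ccontr)
  assume "u \<noteq> 0"
  then obtain w where w: "Poly_Mapping.lookup u w \<noteq> 0" by (metis lookup_zero poly_mapping_eqI)
  have "mon (i, j, r) * u = u" using u by (simp add: left_diff_distrib)
  then have step: "Poly_Mapping.lookup u (v - (i, j, r)) = Poly_Mapping.lookup u v" for v
    using lookup_mon_mult[of "(i, j, r)" u v] by simp
  let ?w = "\<lambda>k::nat. w - (int k * i, int k * j, int k * r)"
  have "Poly_Mapping.lookup u (?w k) = Poly_Mapping.lookup u w" for k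
  proof (induction k)
    case 0
    show ?case by (simp flip: zero_prod_def)
  next
    case (Suc k)
    have "?w (Suc k) = ?w k - (i, j, r)" by (cases w) (simp add: algebra_simps)
    then show ?case using Suc step[of "?w k"] by metis
  qed
  then have "range ?w \<subseteq> Poly_Mapping.keys u" using w by (auto simp: in_keys_iff)
  then have "finite (range ?w)" using finite_keys finite_subset by blast
  moreover have "inj ?w"
  proof (rule injI)
    fix k l assume "?w k = ?w l"
    then have "(int k * i, int k * j, int k * r) = (int l * i, int l * j, int l * r)"
      by (cases w) simp
    then show "k = l" using injD[OF inj] by blast
  qed
  ultimately show False using finite_imageD[of ?w UNIV] infinite_UNIV_nat by blast
qed

text \<open>A geometric sum for nonnegative \<open>k\<close>; for negative \<open>k\<close> a unit
  is factored out first.\<close>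

lemma mon_minus_1_dvd:
  "(mon (i, j, r) - 1 :: 'k::field laurent) dvd (mon (k * i, k * j, k * r) - 1)"
proof -
  let ?m = "mon (i, j, r) :: 'k laurent"
  have pow: "mon (int k * i, int k * j, int k * r) = ?m ^ k" for k
  proof (induction k)
    case 0
    show ?case using mon_hom(2) by (simp add: zero_prod_def)
  next
    case (Suc k)
    have "mon (int (Suc k) * i, int (Suc k) * j, int (Suc k) * r)
        = (mon ((i, j, r) + (int k * i, int k * j, int k * r)) :: 'k laurent)" by (simp add: algebra_simps)
    then show ?case by (simp only: Suc mon_hom power_Suc)
  qed
  have dvd: "?m - 1 dvd mon (int k * i, int k * j, int k * r) - 1" for k
    unfolding pow using power_diff_1_eq[of ?m k] by simp
  show ?thesis
  proof (cases "0 \<le> k")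
    case True
    then show ?thesis using dvd[of "nat k"] by simp
  next
    case False
    then have k: "int (nat (- k)) = - k" by simp
    have "mon (k * i, k * j, k * r) * mon (- k * i, - k * j, - k * r) = (1 :: 'k laurent)"
      using mon_hom(2) by (simp add: mon_hom(1)[symmetric] zero_prod_def)
    then have "mon (k * i, k * j, k * r) - 1 = - mon (k * i, k * j, k * r) * (mon (- k * i, - k * j, - k * r) - 1 :: 'k laurent)"
      by (simp add: algebra_simps)
    then show ?thesis using dvd[of "nat (- k)"] unfolding k by (metis dvd_mult)
  qed
qed

context H_parameters
begin

definition "tc = mon (0, 0, 1) - (1 :: 'k laurent)"
definition "tb = mon (0, 1, 0) - (1 :: 'k laurent)"
definition "ta = mon (int n, 0, 0) - (1 :: 'k laurent)"

lemma t_values: "\<pi>1 tc = 0" "\<pi>1 tb = tb" "\<pi>2 tc = 0" "\<pi>2 tb = 0" "\<pi>2 ta = ta"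
    "ev s tc = 0" "ev s tb = 0" "ev s ta = 0" "\<tau> tc = tc" "\<tau> tb = tb" "\<tau> ta = ta"
proof -
  have m: "mon (0, 0, 0) = (1 :: 'k laurent)" using mon_hom(2) by (simp add: zero_prod_def)
  have "q powi (s * int n) = 1" "q powi (- int n) = 1"
    using q_powi_mod[of n s] q_powi_mod[of n "-1"] by simp_all
  then show "\<pi>1 tc = 0" "\<pi>1 tb = tb" "\<pi>2 tc = 0" "\<pi>2 tb = 0" "\<pi>2 ta = ta"
    "ev s tc = 0" "ev s tb = 0" "ev s ta = 0" "\<tau> tc = tc" "\<tau> tb = tb" "\<tau> ta = ta"
    by (simp_all add: tc_def tb_def ta_def \<pi>1_hom \<pi>2_hom ev_hom \<tau>_hom lift_mon m lconst_hom)
qed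

lemma t_regular: "tc * u = 0 \<Longrightarrow> u = 0" "tb * u = 0 \<Longrightarrow> u = 0" "ta * u = 0 \<Longrightarrow> u = 0"
  unfolding tc_def tb_def ta_def
  using mon_minus_1_regular[of 0 0 1 u] mon_minus_1_regular[of 0 1 0 u] mon_minus_1_regular[of "int n" 0 0 u] n_pos
  by (auto simp: inj_on_def)

text \<open>With \<open>tb_dvd\<close> below: what a specialisation changes is a multiple of the
  element that it sends to zero. It is enough to see this on monomials.\<close>

lemma tc_dvd: "tc dvd (u - \<pi>1 u)"
proof (induction u rule: laurent_induct)
  case (add u v)
  have "u + v - \<pi>1 (u + v) = (u - \<pi>1 u) + (v - \<pi>1 v)" by (simp add: \<pi>1_hom)
  then show ?case using dvd_add[OF add] by (simp only:)
next
  case (monomial k e)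
  obtain i j r where e: "e = (i, j, r)" by (cases e)
  have "mon (i, j, r) = mon (i, j, 0) * (mon (0, 0, r) :: 'k laurent)" by (simp add: mon_hom(1)[symmetric])
  then have "lconst k * mon (i, j, r) - lconst k * mon (i, j, 0) = lconst k * mon (i, j, 0) * (mon (0, 0, r) - 1)"
    by (simp add: algebra_simps)
  moreover have "\<pi>1 (lconst k * mon e) = lconst k * mon (i, j, 0)"
    by (simp add: e \<pi>1_hom lift_lconst lift_mon)
  ultimately have "lconst k * mon e - \<pi>1 (lconst k * mon e) = lconst k * mon (i, j, 0) * (mon (0, 0, r) - 1)"
    by (simp only: e)
  then show ?case using dvd_mult[OF mon_minus_1_dvd[of 0 0 1 r]] by (simp add: tc_def)
qed

lemma tb_dvd: "tb dvd (\<pi>1 u - \<pi>2 u)"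
proof (induction u rule: laurent_induct)
  case (add u v)
  have "\<pi>1 (u + v) - \<pi>2 (u + v) = (\<pi>1 u - \<pi>2 u) + (\<pi>1 v - \<pi>2 v)" by (simp add: \<pi>1_hom \<pi>2_hom)
  then show ?case using dvd_add[OF add] by (simp only:)
next
  case (monomial k e)
  obtain i j r where e: "e = (i, j, r)" by (cases e)
  have "mon (i, j, 0) = mon (i, 0, 0) * (mon (0, j, 0) :: 'k laurent)" by (simp add: mon_hom(1)[symmetric])
  then have "lconst k * mon (i, j, 0) - lconst k * mon (i, 0, 0) = lconst k * mon (i, 0, 0) * (mon (0, j, 0) - 1)"
    by (simp add: algebra_simps)
  moreover have "\<pi>1 (lconst k * mon e) = lconst k * mon (i, j, 0)" "\<pi>2 (lconst k * mon e) = lconst k * mon (i, 0, 0)"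
    by (simp_all add: e \<pi>1_hom \<pi>2_hom lift_lconst lift_mon)
  ultimately have "\<pi>1 (lconst k * mon e) - \<pi>2 (lconst k * mon e) = lconst k * mon (i, 0, 0) * (mon (0, j, 0) - 1)"
    by (simp only: e)
  then show ?case using dvd_mult[OF mon_minus_1_dvd[of 0 1 0 j]] by (simp add: tb_def)
qed

text \<open>Orthogonality of the characters of the cyclic group of order \<open>n\<close>.\<close>

lemma sum_q_powi: "(\<Sum>s<n. q powi (int s * i)) = (if int n dvd i then of_nat n else 0)"
proof -
  have s: "q powi (int s * i) = (q powi i) ^ s" for s by (simp add: power_int_mult mult.commute)
  have "(q powi i) ^ n = 1" using q_powi_mod[of n i] s[of n] by (simp add: mult.commute)
  moreover have "q powi i = 1 \<longleftrightarrow> int n dvd i"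
  proof -
    have "q powi i = 1 \<longleftrightarrow> q ^ nat \<bar>i\<bar> = 1" by (cases "0 \<le> i") (auto simp: power_int_def power_inverse)
    also have "\<dots> \<longleftrightarrow> int n dvd i" unfolding q_power_eq_1 by (metis dvd_abs_iff int_dvd_int_iff int_nat_eq abs_ge_zero)
    finally show ?thesis .
  qed
  ultimately show ?thesis
    using geometric_sum[of "q powi i" n] unfolding s by auto
qed

text \<open>Discrete Fourier inversion: modulo \<open>(a\<^sup>n - 1, b - 1, c - 1)\<close> a Laurent polynomial is determined by
  its values at \<open>a = q\<^sup>s\<close>, \<open>b = c = 1\<close>.\<close>

lemma fourier_inversion:
  "\<exists>w1 w2 w3. u - (\<Sum>s<n. lconst (ev (int s) u) *
      (\<Sum>i<n. lconst (q powi (- int s * int i) / of_nat n) * mon (int i, 0, 0))) = tc * w1 + tb * w2 + ta * w3"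
    (is "\<exists>w1 w2 w3. u - (\<Sum>s<n. lconst (ev (int s) u) * ?e s) = _")
proof (induction u rule: laurent_induct)
  case (add u v)
  then obtain w1 w2 w3 x1 x2 x3 where
    u: "u - (\<Sum>s<n. lconst (ev (int s) u) * ?e s) = tc * w1 + tb * w2 + ta * w3" and
    v: "v - (\<Sum>s<n. lconst (ev (int s) v) * ?e s) = tc * x1 + tb * x2 + ta * x3" by blast
  have "(\<Sum>s<n. lconst (ev (int s) (u + v)) * ?e s)
      = (\<Sum>s<n. lconst (ev (int s) u) * ?e s) + (\<Sum>s<n. lconst (ev (int s) v) * ?e s)"
    by (simp only: ev_hom(2) lconst_hom(1) distrib_right sum.distrib)
  then have "u + v - (\<Sum>s<n. lconst (ev (int s) (u + v)) * ?e s)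
      = (u - (\<Sum>s<n. lconst (ev (int s) u) * ?e s)) + (v - (\<Sum>s<n. lconst (ev (int s) v) * ?e s))"
    by (simp only: add_diff_add)
  also have "\<dots> = tc * (w1 + x1) + tb * (w2 + x2) + ta * (w3 + x3)"
    unfolding u v by (simp add: algebra_simps)
  finally have "u + v - (\<Sum>s<n. lconst (ev (int s) (u + v)) * ?e s)
      = tc * (w1 + x1) + tb * (w2 + x2) + ta * (w3 + x3)" .
  then show ?case by blast
next
  case (monomial k e)
  obtain i j r where e: "e = (i, j, r)" by (cases e)
  \<comment> \<open>Modulo \<open>a^n - 1\<close> the exponent of \<open>a\<close> matters only
    modulo \<open>n\<close>, and the double sum picks out exactly this residue.\<close>
  define i0 where "i0 = nat (i mod int n)"
  have i0: "i0 < n" "int i0 = i mod int n" using n_pos by (simp_all add: i0_def nat_less_iff)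
  have "(\<Sum>s<n. lconst (ev (int s) (lconst k * mon e)) * ?e s)
      = (\<Sum>s<n. \<Sum>i'<n. lconst (k / of_nat n * q powi (int s * (i - int i'))) * mon (int i', 0, 0))"
  proof (intro sum.cong refl)
    fix s
    have "k * q powi (int s * i) * (q powi (- int s * int i') / of_nat n)
        = k / of_nat n * q powi (int s * (i - int i'))" for i'
      by (simp add: right_diff_distrib power_int_diff power_int_minus field_simps)
    then show "lconst (ev (int s) (lconst k * mon e)) * ?e s
        = (\<Sum>i'<n. lconst (k / of_nat n * q powi (int s * (i - int i'))) * mon (int i', 0, 0))"
      by (simp only: e ev_hom lift_lconst lift_mon fst_conv sum_distrib_left mult.assoc[symmetric] lconst_hom(2)[symmetric])
  qed
  also have "\<dots> = (\<Sum>i'<n. lconst (k / of_nat n * (\<Sum>s<n. q powi (int s * (i - int i')))) * mon (int i', 0, 0))"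
  proof -
    have "lconst (sum F S) = (\<Sum>s\<in>S. lconst (F s))" for F :: "nat \<Rightarrow> 'k" and S
      by (induction S rule: infinite_finite_induct) (simp_all add: lconst_hom)
    then show ?thesis
      by (subst sum.swap) (simp add: sum_distrib_left sum_distrib_right)
  qed
  also have "\<dots> = (\<Sum>i'<n. if i' = i0 then lconst k * mon (int i', 0, 0) else 0)"
  proof (intro sum.cong refl)
    fix i' assume "i' \<in> {..<n}"
    then have "int n dvd i - int i' \<longleftrightarrow> i' = i0"
      using i0 n_pos by (metis lessThan_iff mod_eq_dvd_iff mod_pos_pos_trivial of_nat_0_le_iff of_nat_eq_iff of_nat_less_iff)
    then show "lconst (k / of_nat n * (\<Sum>s<n. q powi (int s * (i - int i')))) * mon (int i', 0, 0)
        = (if i' = i0 then lconst k * mon (int i', 0, 0) else 0)"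
      using n_pos by (simp add: sum_q_powi lconst_hom)
  qed
  also have "\<dots> = lconst k * mon (int i0, 0, 0)" using i0 by simp
  finally have 1: "(\<Sum>s<n. lconst (ev (int s) (lconst k * mon e)) * ?e s) = lconst k * mon (int i0, 0, 0)" .
  \<comment> \<open>Telescoping: the exponent of \<open>c\<close> is removed, then that of
    \<open>b\<close>, then that of \<open>a\<close> is reduced to its residue.\<close>
  obtain w1 where w1: "lconst k * mon e - lconst k * mon (i, j, 0) = tc * w1"
    using tc_dvd[of "lconst k * mon e"] by (auto simp: e \<pi>1_hom lift_lconst lift_mon dvd_def)
  obtain w2 where w2: "lconst k * mon (i, j, 0) - lconst k * mon (i, 0, 0) = tb * w2"
    using tb_dvd[of "lconst k * mon e"] by (auto simp: e \<pi>1_hom \<pi>2_hom lift_lconst lift_mon dvd_def)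
  have "ta dvd (mon ((i div int n) * int n, 0, 0) - 1)"
    using mon_minus_1_dvd[of "int n" 0 0 "i div int n"] by (simp add: ta_def)
  moreover have "mon (i, 0, 0) = mon (int i0, 0, 0) * (mon ((i div int n) * int n, 0, 0) :: 'k laurent)"
    by (simp add: mon_hom(1)[symmetric] i0)
  then have "lconst k * mon (i, 0, 0) - lconst k * mon (int i0, 0, 0)
      = lconst k * mon (int i0, 0, 0) * (mon ((i div int n) * int n, 0, 0) - 1)"
    by (simp add: algebra_simps)
  ultimately have "ta dvd lconst k * mon (i, 0, 0) - lconst k * mon (int i0, 0, 0)"
    by (simp only: dvd_mult)
  then obtain w3 where w3: "lconst k * mon (i, 0, 0) - lconst k * mon (int i0, 0, 0) = ta * w3"
    by (auto simp: dvd_def)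
  have "lconst k * mon e - lconst k * mon (int i0, 0, 0) = tc * w1 + tb * w2 + ta * w3"
    unfolding w1[symmetric] w2[symmetric] w3[symmetric] by simp
  then show ?case unfolding 1 by blast
qed

text \<open>The ideals generated by \<open>tc\<close>, by \<open>tc\<close> and \<open>tb\<close>,
  and by all three elements, given as kernels so that membership and regularity can be tested by a
  homomorphism. That they are no larger is \<open>L_decompose\<close>.\<close>

definition "L1 = {u. \<pi>1 u = 0}"
definition "L2 = {u. \<pi>2 u = 0}"
definition "L3 = {u. \<forall>s. ev s u = 0}"

text \<open>\<open>y\<close> twists coefficients by \<open>\<tau>\<close>, so
  \<open>\<tau>\<close>-stability is what makes coordinates in \<open>I\<close> a condition
  invariant under the action.\<close>

definition stable_ideal :: "'k laurent set \<Rightarrow> bool"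
  where "stable_ideal I \<longleftrightarrow> 0 \<in> I \<and> (\<forall>u\<in>I. \<forall>v\<in>I. u + v \<in> I) \<and> (\<forall>u\<in>I. \<forall>g. g * u \<in> I) \<and> (\<forall>u\<in>I. \<tau> u \<in> I)"

lemma \<tau>_commute: "\<pi>1 (\<tau> u) = \<tau> (\<pi>1 u)" "\<pi>2 (\<tau> u) = \<tau> (\<pi>2 u)" "ev s (\<tau> u) = ev (s - 1) u"
proof (induction u rule: laurent_induct)
  case (monomial k e)
  obtain i j r where e: "e = (i, j, r)" by (cases e)
  case 1 show ?case by (simp add: e \<pi>1_hom \<tau>_hom lift_lconst lift_mon)
  case 2 show ?case by (simp add: e \<pi>2_hom \<tau>_hom lift_lconst lift_mon)
  case 3 show ?case
    by (simp add: e ev_hom \<tau>_hom lift_lconst lift_mon power_int_add[symmetric] algebra_simps)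
qed (simp_all add: \<pi>1_hom \<pi>2_hom ev_hom \<tau>_hom)

lemma stable_ideals: "stable_ideal {0}" "stable_ideal L1" "stable_ideal L2" "stable_ideal L3"
  by (auto simp: stable_ideal_def L1_def L2_def L3_def \<pi>1_hom \<pi>2_hom ev_hom \<tau>_hom \<tau>_commute)

lemma L_decompose:
  "u \<in> L1 \<Longrightarrow> \<exists>w. u - tc * w = 0" "u \<in> L2 \<Longrightarrow> \<exists>w. u - tb * w \<in> L1" "u \<in> L3 \<Longrightarrow> \<exists>w. u - ta * w \<in> L2"
proof -
  show "u \<in> L1 \<Longrightarrow> \<exists>w. u - tc * w = 0" using tc_dvd[of u] by (auto simp: L1_def dvd_def)
next
  assume u: "u \<in> L2"
  obtain w1 where w1: "u - \<pi>1 u = tc * w1" using tc_dvd[of u] by (auto simp: dvd_def)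
  obtain w2 where w2: "\<pi>1 u = tb * w2" using tb_dvd[of u] u by (auto simp: L2_def dvd_def)
  have "u - tb * w2 = tc * w1" using w1 w2 by simp
  then have "u - tb * w2 \<in> L1" by (simp add: L1_def \<pi>1_hom(1) t_values)
  then show "\<exists>w. u - tb * w \<in> L1" ..
next
  assume u: "u \<in> L3"
  obtain w1 w2 w3 where "u = tc * w1 + tb * w2 + ta * w3"
    using fourier_inversion[of u] u by (auto simp: L3_def lconst_hom)
  then have "u - ta * w3 \<in> L2" by (simp add: L2_def \<pi>2_hom t_values)
  then show "\<exists>w. u - ta * w \<in> L2" ..
qed

lemma L_regular: "tb * u \<in> L1 \<Longrightarrow> u \<in> L1" "ta * u \<in> L2 \<Longrightarrow> u \<in> L2"
  using t_regular(2)[of "\<pi>1 u"] t_regular(3)[of "\<pi>2 u"]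
  by (simp_all add: L1_def L2_def \<pi>1_hom(1) \<pi>2_hom(1) t_values)

lemma L_sub: "L1 \<subseteq> L2" "L2 \<subseteq> L3"
proof -
  show "L1 \<subseteq> L2"
  proof
    fix u assume "u \<in> L1"
    then obtain w where "u - tc * w = 0" using L_decompose(1) by blast
    then have "u = tc * w" by simp
    then show "u \<in> L2" by (simp add: L2_def \<pi>2_hom t_values)
  qed
  show "L2 \<subseteq> L3"
  proof
    fix u assume "u \<in> L2"
    then obtain w where "u - tb * w \<in> L1" using L_decompose(2) by blast
    then obtain w' where "u - tb * w - tc * w' = 0" using L_decompose(1) by blast
    then have "u = tb * w + tc * w'" by (simp add: algebra_simps)
    then show "u \<in> L3" by (simp add: L3_def ev_hom t_values)
  qed
qed

lemma L_t: "tc * u \<in> L1" "tb * u \<in> L2" "ta * u \<in> L3"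
  by (simp_all add: L1_def L2_def L3_def \<pi>1_hom \<pi>2_hom ev_hom t_values)

lemma stable_genE:
  assumes I: "stable_ideal I" and v: "\<And>l m. v l m \<in> I"
  shows "app (genE s) v l m \<in> I"
proof -
  have mult: "g * u \<in> I" if "u \<in> I" for g u using I that by (auto simp: stable_ideal_def)
  have "sh v l m \<in> I" for l m using v mult by (auto simp: sh_def)
  then have "opY v l m \<in> I" using I v mult by (auto simp: opY_def stable_ideal_def)
  moreover have "opX v l m \<in> I" "opG e v l m \<in> I" for e using v mult by (auto simp: opX_def opG_def)
  ultimately show ?thesis by (simp add: genE_def app_GE app_XE app_YE split: hgen.split)
qed

lemma stable_Rep:
  assumes I: "stable_ideal I" and v: "\<And>l m. v l m \<in> I"
  shows "app (Rep f) v l m \<in> I"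
proof (induction f arbitrary: l m rule: free_algebra_induct)
  case (add f g)
  then show ?case using I by (simp add: Rep_simps app_simps stable_ideal_def)
next
  case (scalar k f)
  then show ?case using I by (simp add: Rep_simps app_simps app_SE opS_def stable_ideal_def)
next
  case (gen s f)
  then show ?case using stable_genE[OF I] by (simp add: Rep_simps app_simps)
qed (use v in \<open>simp add: Rep_simps app_simps\<close>)

text \<open>Source of the centrality of the regular sequence: its elements act by multiplying all
  coordinates with a \<open>\<tau>\<close>-fixed polynomial, and such multiplications commute with
  every generator.\<close>

lemma Rep_\<tau>_linear:
  assumes "\<tau> t = t"
  shows "app (Rep f) (\<lambda>l m. t * v l m) l m = t * app (Rep f) v l m"
proof (induction f arbitrary: l m rule: free_algebra_induct)
  case (gen s f)
  then have IH: "app (Rep f) (\<lambda>l m. t * v l m) = (\<lambda>l m. t * app (Rep f) v l m)" by (simp add: fun_eq_iff)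
  have "app (genE s) (\<lambda>l m. t * w l m) l m = t * app (genE s) w l m" for w
    using assms
    by (simp add: genE_def app_GE app_XE app_YE opG_def opX_def opY_def sh_simp \<tau>_hom algebra_simps split: hgen.split)
  then show ?case by (simp add: Rep_simps app_simps IH)
qed (simp_all add: Rep_simps app_simps app_SE opS_def algebra_simps)

section \<open>Integrals of the last quotient in coordinates\<close>

definition integral_vector :: "'k coords \<Rightarrow> bool"
  where "integral_vector v \<longleftrightarrow> (\<forall>f l m s. ev s (app (Rep f) v l m) = free_counit f * ev s (v l m))"

lemma counit_lift: "free_algebra_lift id (H_counit_gen :: hgen \<Rightarrow> 'k)"
  by unfold_locales simp_all

lemmas counit_simps = free_algebra_lift.flift_simps[OF counit_lift, folded free_counit_def]

text \<open>Congruence modulo \<open>L3\<close> is equality under every \<open>ev s\<close>, so this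
  is the integral condition modulo \<open>L3\<close>. Generators suffice: the error made by a
  shorter word lies in \<open>L3\<close>, and the next generator keeps it there.\<close>

lemma integral_vectorI:
  assumes "\<And>g l m s. ev s (app (genE g) v l m) = H_counit_gen g * ev s (v l m)"
  shows "integral_vector v"
  unfolding integral_vector_def
proof (intro allI)
  fix f l m s
  show "ev s (app (Rep f) v l m) = free_counit f * ev s (v l m)"
  proof (induction f arbitrary: l m s rule: free_algebra_induct)
    case (gen g f)
    let ?w = "app (Rep f) v - opS (free_counit f) v"
    have "?w l m \<in> L3" for l m using gen by (simp add: L3_def ev_hom opS_def lift_lconst)
    then have "app (genE g) ?w l m \<in> L3" by (rule stable_genE[OF stable_ideals(4)])
    moreover have "app (genE g) ?w l m = app (genE g) (app (Rep f) v) l m - lconst (free_counit f) * app (genE g) v l m"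
    proof -
      have "app (genE g) (opS k v) = opS k (app (genE g) v)" for k
        using arg_cong[OF free_algebra_lift.unit_comm[OF Rep_lift, of k g], of "\<lambda>E. app E v"]
        by (simp add: app_simps app_SE)
      then show ?thesis
        using app_add[of "genE g" "app (Rep f) v" "- opS (free_counit f) v"]
        by (simp add: app_uminus opS_def)
    qed
    ultimately show ?case
      by (simp add: Rep_simps app_simps counit_simps L3_def ev_hom lift_lconst assms)
  qed (simp_all add: Rep_simps app_simps app_SE opS_def counit_simps ev_hom lift_lconst algebra_simps)
qed

text \<open>\<open>n\<close> times the idempotent \<open>e\<close> of the overview: the
  specialisation \<open>ev s\<close> sees it exactly for \<open>s = -1\<close> modulo
  \<open>n\<close>.\<close>

definition eL :: "'k laurent" where "eL = (\<Sum>i<n. lconst (q ^ i) * mon (int i, 0, 0))"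

lemma ev_eL: "ev s eL = (if int n dvd s + 1 then of_nat n else 0)"
proof -
  have "ev s eL = (\<Sum>i<n. q ^ i * q powi (s * int i))" by (simp add: eL_def ev_hom lift_lconst lift_mon)
  also have "\<dots> = (\<Sum>i<n. q powi (int i * (s + 1)))"
    by (intro sum.cong refl) (simp add: power_int_add distrib_left mult.commute)
  finally show ?thesis by (simp add: sum_q_powi)
qed

definition integral0 :: "'k coords" where "integral0 = unitv (n - 1) eL (n - 1)"

lemma ev_z: "ev s z1 = 0" "ev s z2 = 0"
  using q_powi_nn1 by (simp_all add: z1_def z2_def ev_hom lift_lconst lift_mon)

lemma q_powi_dvd:
  assumes "int n dvd i" shows "q powi (i * j) = 1"
proof -
  obtain k where "i = int n * k" using assms by (elim dvdE)
  then have "i * j = k * j * int n" by simp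
  then show ?thesis using q_powi_mod[of n "k * j"] by (simp only: dvd_refl)
qed

text \<open>Applied to the integral, \<open>y\<close> leaves a term with \<open>x^(n-2)\<close> and
  coefficient \<open>gam (n - 2)\<close>. At \<open>a = q^(-1)\<close>, \<open>b = c = 1\<close> the
  contributions of \<open>a^(2 n1)\<close> and of \<open>b c\<close> cancel.\<close>

lemma ev_gam:
  assumes "int n dvd s + 1" shows "ev s (gam (n - 2)) = 0"
proof -
  have n: "Suc (n - 2) = n - 1" "Suc (n - 1) = n" using n_ge_2 by simp_all
  have pn: "p ^ (n - 1) * p = 1" using p_n n(2) by (metis power_Suc2)
  then have pn': "p ^ (n - 1) = inverse p" by (simp add: field_simps)
  \<comment> \<open>From \<open>qnum p n = 0\<close>, with the top power \<open>p^(n-1)\<close>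
    split off.\<close>
  have q1: "qnum p (n - 1) = - inverse p"
    using qnum_Suc'[of p "n - 1"] qnum_p_eq_0[of n] pn' unfolding n by (simp add: eq_neg_iff_add_eq_0)
  have q2: "qnum (inverse p) (n - 1) = - p"
    using qnum_Suc'[of "inverse p" "n - 1"] qnum_ip_eq_0[of n] pn' unfolding n by (simp add: eq_neg_iff_add_eq_0 power_inverse)
  have "q powi (s * int (2 * n1)) = q powi ((s + 1) * int (2 * n1)) * q powi (- int (2 * n1))"
    by (simp add: power_int_add[symmetric] algebra_simps)
  also have "\<dots> = inverse p ^ 2"
  proof -
    have "q powi (- int (2 * n1)) = inverse p ^ 2"
      by (simp add: p_def power_int_minus power_inverse power_mult[symmetric] mult_ac flip: of_nat_mult)
    then show ?thesis by (simp only: q_powi_dvd[OF assms] mult_1_left)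
  qed
  finally have q3: "q powi (s * int (2 * n1)) = inverse p ^ 2" .
  have "inverse p ^ (2 * (n - 2)) * inverse p ^ 2 = inverse p ^ (2 * (n - 1))"
  proof -
    have "2 * (n - 2) + 2 = 2 * (n - 1)" using n_ge_2 by simp
    then show ?thesis by (simp only: power_add[symmetric])
  qed
  also have "\<dots> = (inverse p ^ (n - 1)) ^ 2" by (simp only: power_mult[symmetric] mult.commute)
  also have "\<dots> = p ^ 2" by (simp add: power_inverse pn' del: One_nat_def)
  finally have q4: "inverse p ^ (2 * (n - 2)) * inverse p ^ 2 = p ^ 2" .
  have "ev s (gam (n - 2)) = \<beta>3 * (- inverse p * (inverse p ^ (2 * (n - 2)) * inverse p ^ 2) + p)"
    unfolding gam_def n by (simp only: ev_hom lift_lconst lift_mon fst_conv q3 q1 q2) (simp add: mult.assoc)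
  also have "\<dots> = 0" unfolding q4 by (simp add: power2_eq_square)
  finally show ?thesis .
qed

text \<open>Both \<open>x\<close> and \<open>y\<close> push the top monomial over the edge, where
  \<open>z1\<close> and \<open>z2\<close> vanish under every \<open>ev s\<close>; the remaining term
  of \<open>y\<close> is \<open>ev_gam\<close>. For \<open>a\<close>, the factor from passing
  \<open>x^(n-1)\<close> cancels its value \<open>q^(-1)\<close> on \<open>eL\<close>.\<close>

lemma integral_vector_integral0: "integral_vector integral0"
proof (rule integral_vectorI)
  fix g l m s
  have G: "ev s (opG e integral0 l m) = ev s (integral0 l m)" for e
  proof (cases "l = n - 1 \<and> m = n - 1 \<and> int n dvd s + 1")
    case True
    have "q powi (- (fst e * int (n - 1))) * q powi (s * fst e) = q powi ((s + 1 - int n) * fst e)"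
      using n_pos by (simp add: power_int_add[symmetric] of_nat_diff algebra_simps)
    also have "\<dots> = 1" using True by (intro q_powi_dvd) simp
    finally show ?thesis
      using True by (simp add: opG_def ev_hom lift_lconst lift_mon integral0_def unitv_def del: of_nat_diff)
  qed (auto simp: opG_def ev_hom integral0_def unitv_def ev_eL)
  have X: "ev s (opX integral0 l m) = 0"
  proof (cases "l mod n = 0")
    case False
    then have "l - 1 \<noteq> n - 1" using n_pos by (cases l) auto
    then show ?thesis using False by (simp add: opX_def integral0_def unitv_def ev_hom)
  qed (simp add: opX_def ev_hom ev_z)
  have sh: "ev s' (sh integral0 l m) = 0" for s'
  proof (cases "m mod n = 0")
    case False
    then have "m - 1 \<noteq> n - 1" using n_pos by (cases m) auto
    then show ?thesis using False by (simp add: sh_def integral0_def unitv_def ev_hom)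
  qed (simp add: sh_def ev_hom ev_z)
  have "ev s (gam l * integral0 (Suc l) m) = 0"
  proof (cases "Suc l = n - 1 \<and> int n dvd s + 1")
    case True
    then have "Suc l = n - 1" ..
    then have "l = n - 2" by arith
    then show ?thesis using ev_gam True by (simp add: ev_hom)
  qed (auto simp: ev_hom integral0_def unitv_def ev_eL)
  then have Y: "ev s (opY integral0 l m) = 0"
    by (simp add: opY_def ev_hom(2) ev_hom(1)[of s "lconst _"] \<tau>_commute sh)
  show "ev s (app (genE g) integral0 l m) = H_counit_gen g * ev s (integral0 l m)"
    by (cases g) (simp_all add: genE_def app_GE app_XE app_YE G X Y)
qed

lemma ev_cong: assumes "int n dvd s - s'" shows "ev s u = ev s' u"
proof (induction u rule: laurent_induct)
  case (monomial k e)
  have "q powi (s * fst e) = q powi ((s - s') * fst e) * q powi (s' * fst e)"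
    by (simp add: power_int_add[symmetric] algebra_simps)
  then show ?case using q_powi_dvd[OF assms] by (simp add: ev_hom lift_lconst lift_mon)
qed (simp add: ev_hom)

text \<open>Since \<open>x\<close> moves \<open>l\<close> to \<open>l + 1\<close> and must give
  zero, only \<open>l = n - 1\<close> survives; there \<open>y\<close> does the same for
  \<open>m\<close>. Finally \<open>a\<close> scales the corner by \<open>q^(s+1)\<close> under
  \<open>ev s\<close>, which must be \<open>1\<close>.\<close>

lemma integral_vector_unique:
  assumes v: "integral_vector v" "v \<in> V0"
  shows "\<exists>k. \<forall>l m s. ev s (v l m) = k * ev s (integral0 l m)"
proof (intro exI allI)
  fix l m s
  have int: "ev s (app (Rep f) v l m) = free_counit f * ev s (v l m)" for f l m s
    using v by (simp add: integral_vector_def)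
  have 1: "ev s (v l m) = 0" if "l \<noteq> n - 1" for l m s
  proof (cases "l < n")
    case True
    have "ev s (opX v (Suc l) m) = 0"
      using int[where f = Fx and l = "Suc l" and m = m and s = s] by (simp add: Rep_gens app_XE counit_simps)
    moreover have "Suc l mod n = Suc l" using True that by simp
    ultimately show ?thesis by (simp add: opX_def)
  qed (use v in \<open>simp add: V0_def ev_hom\<close>)
  have 2: "ev s (v (n - 1) m) = 0" if "m \<noteq> n - 1" for m s
  proof (cases "m < n")
    case True
    \<comment> \<open>Evaluation at \<open>s + 1\<close> compensates the shift by
      \<open>\<tau>\<close>. In row \<open>n - 1\<close> the \<open>gam\<close> term reads row
      \<open>n\<close>, which is zero in \<open>V0\<close>.\<close>
    have "ev (s + 1) (opY v (n - 1) (Suc m)) = 0"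
      using int[where f = Fy and l = "n - 1" and m = "Suc m" and s = "s + 1"] by (simp add: Rep_gens app_YE counit_simps)
    moreover have "Suc m mod n = Suc m" using True that by simp
    moreover have "v (Suc (n - 1)) (Suc m) = 0" using v n_pos by (simp add: V0_def)
    ultimately have "inverse p ^ (n - 1) * ev s (v (n - 1) m) = 0"
      by (simp add: opY_def sh_def ev_hom lift_lconst \<tau>_commute)
    then show ?thesis by simp
  qed (use v in \<open>simp add: V0_def ev_hom\<close>)
  have 3: "ev s (v (n - 1) (n - 1)) = 0" if "\<not> int n dvd s + 1"
  proof -
    have "q powi (s + 1) \<noteq> 1"
    proof
      assume "q powi (s + 1) = 1"
      then have "(\<Sum>i<n. q powi (int i * (s + 1))) = of_nat n"
        by (simp add: power_int_mult mult.commute[of "int _"])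
      then show False using that n_pos by (simp add: sum_q_powi)
    qed
    moreover have "q powi (- int (n - 1)) * q powi s = q powi (s + 1)"
    proof -
      have "q powi (- int (n - 1)) * q powi s = q powi (s + 1) * q powi (- 1 * int n)"
        using n_pos by (simp add: power_int_add[symmetric] of_nat_diff algebra_simps)
      then show ?thesis using q_powi_mod[of n "- 1"] by simp
    qed
    moreover have "q powi (- int (n - 1)) * q powi s * ev s (v (n - 1) (n - 1)) = ev s (v (n - 1) (n - 1))"
      using int[where f = Fa and l = "n - 1" and m = "n - 1" and s = s]
      by (simp add: Rep_gens app_GE counit_simps opG_def ev_hom lift_lconst lift_mon)
    ultimately show ?thesis by simp
  qed
  have 4: "ev s (v (n - 1) (n - 1)) = ev (- 1) (v (n - 1) (n - 1))" if "int n dvd s + 1"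
    by (rule ev_cong) (use that in simp)
  show "ev s (v l m) = ev (- 1) (v (n - 1) (n - 1)) / of_nat n * ev s (integral0 l m)"
  proof (cases "l = n - 1 \<and> m = n - 1")
    case True
    then show ?thesis using 3 4 n_pos by (auto simp: integral0_def unitv_def ev_eL)
  next
    case False
    then have "ev s (v l m) = 0" using 1 2 by (cases "l = n - 1") auto
    then show ?thesis using False by (auto simp: integral0_def unitv_def ev_hom)
  qed
qed

lemma integral0_nonzero: "ev (- 1) (integral0 (n - 1) (n - 1)) \<noteq> 0"
  using n_pos by (simp add: integral0_def unitv_def ev_eL)

end

context ring
begin

text \<open>\<open>I' = I + t R\<close> with \<open>t\<close> central inherits stability on the
  right.\<close>

lemma right_ideal_extension:
  assumes ext: "regular_extension I t I'" and I: "\<And>x r. x \<in> I \<Longrightarrow> r \<in> carrier R \<Longrightarrow> x \<otimes> r \<in> I"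
    and x: "x \<in> I'" and r: "r \<in> carrier R"
  shows "x \<otimes> r \<in> I'"
proof -
  note D = regular_extensionD[OF ext]
  obtain s where s: "s \<in> carrier R" "x \<ominus> t \<otimes> s \<in> I" using D(7)[OF x] by blast
  have xc: "x \<in> carrier R" using D(2) x by (auto simp: left_ideal_def)
  have "(x \<ominus> t \<otimes> s) \<otimes> r \<in> I'" using I[OF s(2) r] D(3) by blast
  moreover have "t \<otimes> (s \<otimes> r) \<in> I'" using D(6) s r by simp
  ultimately have "(x \<ominus> t \<otimes> s) \<otimes> r \<oplus> t \<otimes> (s \<otimes> r) \<in> I'" using D(2) by (simp add: left_ideal_def)
  also have "(x \<ominus> t \<otimes> s) \<otimes> r \<oplus> t \<otimes> (s \<otimes> r) = (x \<ominus> t \<otimes> s \<oplus> t \<otimes> s) \<otimes> r"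
    using xc D(4) s r by (simp add: l_distr m_assoc)
  also have "\<dots> = x \<otimes> r" using xc D(4) s by (simp add: add_minus_cancel)
  finally show ?thesis .
qed

end

section \<open>The regular sequence and the integral inside the algebra\<close>

locale H_quotient = H_parameters n n1 q \<beta>1 \<beta>2 \<beta>3 + presentation A \<theta> "H_relations n n1 q \<beta>1 \<beta>2 \<beta>3"
  for n n1 :: nat and q \<beta>1 \<beta>2 \<beta>3 :: "'k::field_char_0" and A :: "'a ring" (structure)
    and \<theta> :: "(hgen, 'k) free_algebra \<Rightarrow> 'a" +
  fixes \<epsilon> :: "'a \<Rightarrow> 'k"
  assumes counit: "\<epsilon> (\<theta> f) = free_counit f"
begin

sublocale augmented_ring A "\<lambda>k. \<theta> (fscalar k)" \<epsilon>
proof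
  fix r s k l assume r: "r \<in> carrier A"
  obtain f where f: "r = \<theta> f" using \<theta>_surj[OF r] by blast
  show "\<theta> (fscalar k) \<otimes> r = r \<otimes> \<theta> (fscalar k)"
    unfolding f \<theta>_mult[symmetric] fscalar_central[of k f] ..
  assume s: "s \<in> carrier A"
  obtain g where g: "s = \<theta> g" using \<theta>_surj[OF s] by blast
  show "\<epsilon> (r \<oplus> s) = \<epsilon> r + \<epsilon> s" "\<epsilon> (r \<otimes> s) = \<epsilon> r * \<epsilon> s"
    by (simp_all add: f g \<theta>_add[symmetric] \<theta>_mult[symmetric] counit counit_simps)
qed (simp_all add: fscalar_add fscalar_mult fscalar_1 \<theta>_add \<theta>_mult \<theta>_one counit counit_simps)

lemma \<theta>_eq_iff_\<rho>: "\<theta> f = \<theta> g \<longleftrightarrow> \<rho> f = \<rho> g"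
  unfolding \<theta>_eq_iff \<rho>_kernel[symmetric] \<rho>_diff by simp

definition cset :: "'k laurent set \<Rightarrow> 'a set"
  where "cset I = \<theta> ` {f. \<forall>l m. \<rho> f l m \<in> I}"

lemma \<theta>_in_cset: "\<theta> f \<in> cset I \<longleftrightarrow> (\<forall>l m. \<rho> f l m \<in> I)"
  by (auto simp: cset_def \<theta>_eq_iff_\<rho> image_iff)

lemma cset_zero: "cset {0} = {\<zero>}"
proof -
  have "(\<forall>l m. \<rho> f l m \<in> {0}) \<longleftrightarrow> \<theta> f = \<zero>" for f
    unfolding \<theta>_kernel \<rho>_kernel[symmetric] by (simp add: fun_eq_iff)
  then show ?thesis unfolding cset_def using \<theta>_zero by force
qed

lemma left_ideal_cset:
  assumes I: "stable_ideal I" shows "left_ideal (cset I)"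
  unfolding left_ideal_def
proof (intro conjI ballI)
  show "cset I \<subseteq> carrier A" by (auto simp: cset_def)
  have "\<theta> 0 \<in> cset I" using I by (simp add: \<theta>_in_cset \<rho>_zero stable_ideal_def)
  then show "\<zero> \<in> cset I" by (simp add: \<theta>_zero)
next
  fix x y assume "x \<in> cset I" "y \<in> cset I"
  then obtain f g where "x = \<theta> f" "y = \<theta> g" "\<forall>l m. \<rho> f l m \<in> I" "\<forall>l m. \<rho> g l m \<in> I"
    by (auto simp: cset_def)
  then show "x \<oplus> y \<in> cset I"
    using I by (simp add: \<theta>_add[symmetric] \<theta>_in_cset \<rho>_add stable_ideal_def)
next
  fix r x assume r: "r \<in> carrier A" and "x \<in> cset I"
  then obtain f where f: "x = \<theta> f" "\<And>l m. \<rho> f l m \<in> I" by (auto simp: cset_def)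
  obtain g where g: "r = \<theta> g" using \<theta>_surj[OF r] by blast
  show "r \<otimes> x \<in> cset I"
    unfolding f g \<theta>_mult[symmetric] \<theta>_in_cset \<rho>_mult using stable_Rep[OF I, of "\<rho> f"] f by blast
qed

text \<open>The monomials form a basis and \<open>tf\<close> multiplies each coordinate by
  \<open>t\<close>, so every condition is a condition on single coordinates.\<close>

lemma regular_extension_cset:
  assumes I: "stable_ideal I" and I': "stable_ideal I'" and sub: "I \<subseteq> I'"
    and tI': "\<And>u. t * u \<in> I'" and dec: "\<And>u. u \<in> I' \<Longrightarrow> \<exists>w. u - t * w \<in> I"
    and reg: "\<And>u. t * u \<in> I \<Longrightarrow> u \<in> I" and \<tau>t: "\<tau> t = t"
    and tf: "\<And>v. app (Rep tf) v = (\<lambda>l m. t * v l m)"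
  shows "regular_extension (cset I) (\<theta> tf) (cset I')"
  unfolding regular_extension_def
proof (intro conjI ballI impI)
  show "left_ideal (cset I)" "left_ideal (cset I')" using I I' by (simp_all add: left_ideal_cset)
  show "cset I \<subseteq> cset I'" using sub by (auto simp: cset_def)
  show "\<theta> tf \<in> carrier A" by simp
next
  fix r assume "r \<in> carrier A"
  then obtain g where g: "r = \<theta> g" using \<theta>_surj by blast
  have "\<rho> (tf * g) = \<rho> (g * tf)"
    unfolding \<rho>_mult tf using Rep_\<tau>_linear[OF \<tau>t, of g "unitv 0 1 0"]
    by (simp add: fun_eq_iff \<rho>_def tf)
  then show "\<theta> tf \<otimes> r = r \<otimes> \<theta> tf" by (simp add: g \<theta>_mult[symmetric] \<theta>_eq_iff_\<rho>)
  show "\<theta> tf \<otimes> r \<in> cset I'"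
    by (simp add: g \<theta>_mult[symmetric] \<theta>_in_cset \<rho>_mult tf tI')
  show "r \<in> cset I" if "\<theta> tf \<otimes> r \<in> cset I"
    using that reg by (simp add: g \<theta>_mult[symmetric] \<theta>_in_cset \<rho>_mult tf)
next
  fix x assume "x \<in> cset I'"
  then obtain f where f: "x = \<theta> f" "\<And>l m. \<rho> f l m \<in> I'" by (auto simp: cset_def)
  \<comment> \<open>The value \<open>0\<close> off the support of \<open>\<rho> f\<close> keeps
    \<open>w\<close> in \<open>V0\<close>, so that the chosen quotients assemble to an element of
    the algebra.\<close>
  define w where "w l m = (if \<rho> f l m = 0 then 0 else SOME w. \<rho> f l m - t * w \<in> I)" for l m
  have w: "\<rho> f l m - t * w l m \<in> I" for l m
    using someI_ex[OF dec[OF f(2)[of l m]]] I by (simp add: w_def stable_ideal_def)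
  have "w \<in> V0" using \<rho>_V0[of f] by (simp add: V0_def w_def)
  then have "\<theta> (f - tf * assemble w) \<in> cset I"
    using w by (simp add: \<theta>_in_cset \<rho>_diff \<rho>_mult tf \<rho>_assemble)
  then show "\<exists>r\<in>carrier A. x \<ominus> \<theta> tf \<otimes> r \<in> cset I"
    by (intro bexI[of _ "\<theta> (assemble w)"]) (simp_all add: f \<theta>_diff \<theta>_mult)
qed

lemma Rep_t:
  "app (Rep (Fc - 1)) v = (\<lambda>l m. tc * v l m)" "app (Rep (Fb - 1)) v = (\<lambda>l m. tb * v l m)"
  "app (Rep (Fa ^ n - 1)) v = (\<lambda>l m. ta * v l m)"
proof -
  have "q powi (- (int n * int l)) = 1" for l
    using q_powi_mod[of n "- int l"] by (simp add: mult.commute)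
  then show "app (Rep (Fc - 1)) v = (\<lambda>l m. tc * v l m)" "app (Rep (Fb - 1)) v = (\<lambda>l m. tb * v l m)"
    "app (Rep (Fa ^ n - 1)) v = (\<lambda>l m. ta * v l m)"
    by (simp_all add: Rep_simps(3,5,7) Rep_gens GE_power app_simps app_GE opG_def tc_def tb_def ta_def
        fun_eq_iff lconst_hom algebra_simps)
qed

lemma extensions:
  "regular_extension {\<zero>} (\<theta> (Fc - 1)) (cset L1)" "regular_extension (cset L1) (\<theta> (Fb - 1)) (cset L2)"
  "regular_extension (cset L2) (\<theta> (Fa ^ n - 1)) (cset L3)"
proof -
  have "regular_extension (cset {0}) (\<theta> (Fc - 1)) (cset L1)"
  proof (rule regular_extension_cset[OF stable_ideals(1,2) _ L_t(1) _ _ t_values(9) Rep_t(1)])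
    show "{0} \<subseteq> L1" by (simp add: L1_def \<pi>1_hom)
    show "\<exists>w. u - tc * w \<in> {0}" if "u \<in> L1" for u using L_decompose(1)[OF that] by simp
    show "u \<in> {0}" if "tc * u \<in> {0}" for u using t_regular(1)[of u] that by simp
  qed
  then show "regular_extension {\<zero>} (\<theta> (Fc - 1)) (cset L1)" by (simp add: cset_zero)
  show "regular_extension (cset L1) (\<theta> (Fb - 1)) (cset L2)"
    by (rule regular_extension_cset[OF stable_ideals(2,3) L_sub(1) L_t(2) L_decompose(2) L_regular(1) t_values(10) Rep_t(2)])
  show "regular_extension (cset L2) (\<theta> (Fa ^ n - 1)) (cset L3)"
    by (rule regular_extension_cset[OF stable_ideals(3,4) L_sub(2) L_t(3) L_decompose(3) L_regular(2) t_values(11) Rep_t(3)])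
qed

lemma right_ideal_cset: "x \<in> cset L3 \<Longrightarrow> r \<in> carrier A \<Longrightarrow> x \<otimes> r \<in> cset L3"
proof -
  have 0: "x \<otimes> r \<in> {\<zero>}" if "x \<in> {\<zero>}" "r \<in> carrier A" for x r using that by simp
  note 1 = right_ideal_extension[OF extensions(1) 0]
  note 2 = right_ideal_extension[OF extensions(2) 1]
  show "x \<in> cset L3 \<Longrightarrow> r \<in> carrier A \<Longrightarrow> x \<otimes> r \<in> cset L3"
    using right_ideal_extension[OF extensions(3) 2] .
qed

lemmas L3_ideal = left_ideal_cset[OF stable_ideals(4)]

lemma left_cong_L3: "left_cong (cset L3) (\<theta> f) (\<theta> g) \<longleftrightarrow> (\<forall>l m s. ev s (\<rho> f l m) = ev s (\<rho> g l m))"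
  by (auto simp: left_cong_def \<theta>_diff[symmetric] \<theta>_in_cset \<rho>_diff L3_def ev_hom)

lemma left_integral_L3: "left_integral (cset L3) (\<theta> f) \<longleftrightarrow> integral_vector (\<rho> f)"
proof -
  have "left_integral (cset L3) (\<theta> f) \<longleftrightarrow>
      (\<forall>g. left_cong (cset L3) (\<theta> (g * f)) (\<theta> (fscalar (free_counit g) * f)))"
  proof -
    have "(\<forall>r\<in>carrier A. Q r) \<longleftrightarrow> (\<forall>g. Q (\<theta> g))" for Q
      using \<theta>_surj \<theta>_closed by metis
    then show ?thesis unfolding left_integral_def by (simp add: \<theta>_mult counit)
  qed
  also have "\<dots> \<longleftrightarrow> integral_vector (\<rho> f)"
    unfolding left_cong_L3 integral_vector_def \<rho>_mult by (simp add: \<rho>_scalar Rep_simps app_SE opS_def ev_hom lift_lconst)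
  finally show ?thesis .
qed

definition int_elem :: "(hgen, 'k) free_algebra"
  where "int_elem = Fx ^ (n - 1) * (\<iota> eL * Fy ^ (n - 1))"

lemma \<rho>_int_elem: "\<rho> int_elem = integral0"
  using assemble_unitv[of "n - 1" "n - 1" eL] \<rho>_assemble[OF unitv_V0[of "n - 1" "n - 1" eL]] n_pos
  by (simp add: int_elem_def integral0_def)

lemma scommute_eL:
  assumes u: "u \<in> {Fa, Fb, Fc}" shows "scommute Rels 1 u (\<iota> eL)"
proof -
  have e: "u * gw w \<approx> gw w * u" for w
    using scommute_gw[of 1 u w] scommute_group[of u] u by (auto simp: scommute_def fscalar_1)
  have "u * (\<Sum>i\<in>S. fscalar (k i) * gw (w i)) \<approx> (\<Sum>i\<in>S. fscalar (k i) * gw (w i)) * u" for S :: "nat set" and k w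
  proof (induction S rule: infinite_finite_induct)
    case (insert i S)
    then show ?case
      using rel_eq_add[OF rel_eq_lmult[OF e[of "w i"], of "fscalar (k i)"] insert.IH]
      by (simp add: distrib_left distrib_right mult.assoc fscalar_left_commute[of u])
  qed simp_all
  moreover have "\<iota> eL = (\<Sum>i<n. fscalar (q ^ i) * gw (int i, 0, 0))"
    unfolding eL_def
    by (simp add: \<iota>_def additive_lift.lift_sum[OF \<iota>_lift] \<iota>_lconst[unfolded \<iota>_def] \<iota>_mon[unfolded \<iota>_def])
  ultimately show ?thesis by (simp add: scommute_def fscalar_1)
qed

text \<open>Both \<open>x\<^sup>n\<^sup>-\<^sup>1\<close> and \<open>y\<^sup>n\<^sup>-\<^sup>1\<close> commute with \<open>a\<close> up to a scalar, and the two scalars cancel.\<close>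

lemma int_elem_a: "scommute Rels 1 int_elem Fa"
proof -
  have "scommute Rels (q ^ (n - 1) * (1 * inverse q ^ (n - 1))) int_elem Fa"
    unfolding int_elem_def
    by (intro scommute_mult_left scommute_sym1[OF scommute_eL] scommute_power_left scommute_gens) simp
  moreover have "q ^ (n - 1) * (1 * inverse q ^ (n - 1)) = 1" by (simp add: power_inverse)
  ultimately show ?thesis by simp
qed

abbreviation \<Lambda> where "\<Lambda> \<equiv> \<theta> int_elem"

lemma \<Lambda>_integral: "left_integral (cset L3) \<Lambda>"
  by (simp add: left_integral_L3 \<rho>_int_elem integral_vector_integral0)

lemma \<Lambda>_nonzero: "\<Lambda> \<notin> cset L3"
  using integral0_nonzero by (auto simp: \<theta>_in_cset \<rho>_int_elem L3_def)

lemma \<Lambda>_unique: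
  assumes "left_integral (cset L3) \<Gamma>" shows "\<exists>k. left_cong (cset L3) \<Gamma> (\<theta> (fscalar k) \<otimes> \<Lambda>)"
proof -
  obtain f where f: "\<Gamma> = \<theta> f" using assms \<theta>_surj by (auto simp: left_integral_def)
  obtain k where "\<forall>l m s. ev s (\<rho> f l m) = k * ev s (integral0 l m)"
    using integral_vector_unique[of "\<rho> f"] assms \<rho>_V0 by (auto simp: f left_integral_L3)
  then have "left_cong (cset L3) (\<theta> f) (\<theta> (fscalar k * int_elem))"
    by (simp add: left_cong_L3 \<rho>_scalar \<rho>_int_elem opS_def ev_hom lift_lconst)
  then show ?thesis by (auto simp: f \<theta>_mult)
qed

lemma cong_mult_right:
  "left_cong (cset L3) x y \<Longrightarrow> r \<in> carrier A \<Longrightarrow> left_cong (cset L3) (x \<otimes> r) (y \<otimes> r)"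
  by (rule left_cong_mult_right) (auto intro: right_ideal_cset)

text \<open>Right multiplication by \<open>x\<close> maps the line of integrals to itself; since it multiplies the weight of
  the integral under \<open>a\<close> by \<open>q \<noteq> 1\<close>, it is zero, and likewise for \<open>y\<close>.\<close>

lemma \<Lambda>_right:
  assumes "r \<in> carrier A" shows "left_cong (cset L3) (\<Lambda> \<otimes> r) (\<theta> (fscalar (\<epsilon> r)) \<otimes> \<Lambda>)"
proof -
  \<comment> \<open>\<open>k\<close> is the scalar by which right multiplication by \<open>f\<close>
    acts on the class of the integral. Such pairs are closed under sums and products, so generators
    suffice.\<close>
  let ?good = "\<lambda>f k. left_cong (cset L3) (\<theta> (int_elem * f)) (\<theta> (fscalar k * int_elem))"
  note trans = left_cong_trans[OF L3_ideal] and sym = left_cong_sym[OF L3_ideal]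
  have int_left: "left_cong (cset L3) (\<theta> (g * int_elem)) (\<theta> (fscalar (free_counit g) * int_elem))" for g
    using \<Lambda>_integral unfolding left_integral_def by (simp add: \<theta>_mult counit[symmetric])
  have mult: "?good (f * g) (k * l)" if "?good f k" "?good g l" for f g k l
  proof -
    have "left_cong (cset L3) (\<theta> (int_elem * f) \<otimes> \<theta> g) (\<theta> (fscalar k * int_elem) \<otimes> \<theta> g)"
      using cong_mult_right[OF that(1)] by simp
    then have 1: "left_cong (cset L3) (\<theta> (int_elem * (f * g))) (\<theta> (fscalar k * (int_elem * g)))"
      by (simp add: \<theta>_mult[symmetric] mult.assoc)
    have "left_cong (cset L3) (\<theta> (fscalar k) \<otimes> \<theta> (int_elem * g)) (\<theta> (fscalar k) \<otimes> \<theta> (fscalar l * int_elem))"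
      using left_cong_mult[OF L3_ideal that(2)] by simp
    then have 2: "left_cong (cset L3) (\<theta> (fscalar k * (int_elem * g))) (\<theta> (fscalar (k * l) * int_elem))"
      by (simp add: \<theta>_mult[symmetric] mult.assoc fscalar_mult)
    show ?thesis by (rule trans[OF 1 2])
  qed
  have add: "?good (f + g) (k + l)" if "?good f k" "?good g l" for f g k l
    using left_cong_add[OF L3_ideal that]
    by (simp add: \<theta>_add[symmetric] fscalar_add distrib_left distrib_right)
  have scalar: "?good (fscalar k) k" for k
    by (simp add: fscalar_central[of k] left_cong_refl[OF L3_ideal])
  \<comment> \<open>For an element commuting with the integral, the right action is the left one,
    which is known to be the counit.\<close>
  have central: "?good f (free_counit f)" if "f * int_elem \<approx> int_elem * f" for f
  proof -
    have "\<theta> (f * int_elem) = \<theta> (int_elem * f)" using that unfolding \<theta>_eq_iff rel_eq_def .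
    then show ?thesis using int_left[of f] by simp
  qed
  have inv: "?good f' 1" if "?good f 1" "f * f' \<approx> 1" for f f'
  proof -
    have "left_cong (cset L3) (\<theta> (int_elem * f) \<otimes> \<theta> f') (\<theta> (fscalar 1 * int_elem) \<otimes> \<theta> f')"
      using cong_mult_right[OF that(1)] by simp
    moreover have "\<theta> (int_elem * f) \<otimes> \<theta> f' = \<theta> int_elem"
      using rel_eq_lmult[OF that(2), of int_elem] unfolding \<theta>_mult[symmetric] \<theta>_eq_iff rel_eq_def
      by (simp add: mult.assoc)
    ultimately show ?thesis using sym by (simp add: fscalar_1 \<theta>_mult[symmetric])
  qed
  have a: "?good Fa 1"
  proof -
    have "Fa * int_elem \<approx> int_elem * Fa" using int_elem_a by (simp add: scommute_def fscalar_1 rel_eq_sym)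
    from central[OF this] show ?thesis by (simp add: counit_simps)
  qed
  have bc: "?good u 1" if "u = Fb \<or> u = Fc" for u
  proof -
    have x: "scommute Rels 1 u Fx" and y: "scommute Rels 1 u Fy" using scommute_gens that by auto
    have "scommute Rels 1 u (\<iota> eL)" using that by (intro scommute_eL) auto
    then have "scommute Rels (1 ^ (n - 1) * (1 * 1 ^ (n - 1))) u int_elem"
      unfolding int_elem_def by (intro scommute_mult_right scommute_power_right x y)
    then have "u * int_elem \<approx> int_elem * u" by (simp add: scommute_def fscalar_1)
    from central[OF this] show ?thesis using that by (auto simp: counit_simps)
  qed
  have nilp: "?good u 0" if u: "scommute Rels s u Fa" "s \<noteq> 1" for u s
  proof -
    have "left_integral (cset L3) (\<theta> (int_elem * u))"
      unfolding left_integral_def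
    proof (intro conjI ballI)
      fix r assume r: "r \<in> carrier A"
      have "left_cong (cset L3) (r \<otimes> \<Lambda>) (\<theta> (fscalar (\<epsilon> r)) \<otimes> \<Lambda>)"
        using \<Lambda>_integral r by (simp add: left_integral_def)
      from cong_mult_right[OF this, of "\<theta> u"] show "left_cong (cset L3) (r \<otimes> \<theta> (int_elem * u)) (\<theta> (fscalar (\<epsilon> r)) \<otimes> \<theta> (int_elem * u))"
        using r by (simp add: \<theta>_mult m_assoc)
    qed simp
    then obtain k where k: "?good u k" using \<Lambda>_unique by (auto simp: \<theta>_mult)
    have 1: "?good (u * Fa) (k * 1)" by (rule mult[OF k a])
    have 2: "?good (fscalar s * (Fa * u)) (s * (1 * k))" by (intro mult scalar k a)
    have "\<theta> (int_elem * (u * Fa)) = \<theta> (int_elem * (fscalar s * (Fa * u)))"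
      using rel_eq_lmult[of Rels "u * Fa" "fscalar s * (Fa * u)" int_elem] u unfolding \<theta>_eq_iff scommute_def rel_eq_def
      by simp
    then have 3: "left_cong (cset L3) (\<theta> (fscalar k * int_elem)) (\<theta> (fscalar (s * k) * int_elem))"
      using trans[OF sym[OF 1]] 2 by simp
    \<comment> \<open>Compared at the corner coordinate and at \<open>s = -1\<close>, where the
      integral does not vanish.\<close>
    have "k * ev (- 1) eL = s * k * ev (- 1) eL"
      using 3[unfolded left_cong_L3, rule_format, of "-1" "n - 1" "n - 1"]
      by (simp add: \<rho>_scalar \<rho>_int_elem opS_def ev_hom lift_lconst integral0_def unitv_def)
    then have "k = 0" using u(2) n_pos by (simp add: ev_eL)
    then show ?thesis using k by simp
  qed
  have q1: "q \<noteq> 1" using q_power_eq_1[of 1] n_ge_2 by auto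
  have x: "?good Fx 0" by (rule nilp[OF scommute_gens(4) q1])
  have y: "?good Fy 0" by (rule nilp[OF scommute_gens(5)]) (use q1 in simp)
  have gens: "?good (fgen s) (H_counit_gen s)" for s
    using a bc x y inv[OF a relations(1)] inv[OF bc relations(3)] inv[OF bc relations(5)] by (cases s) auto
  have "?good f (free_counit f)" for f
  proof (induction f rule: free_algebra_induct)
    case one
    show ?case using scalar[of 1] by (simp add: fscalar_1 counit_simps)
  next
    case (add f g)
    then show ?case using \<open>\<And>f g k l. ?good f k \<Longrightarrow> ?good g l \<Longrightarrow> ?good (f + g) (k + l)\<close> by (simp add: counit_simps)
  next
    case (scalar k f)
    then show ?case using mult[OF \<open>\<And>k. ?good (fscalar k) k\<close>] by (simp add: counit_simps)
  next
    case (gen s f)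
    then show ?case using mult[OF gens] by (simp add: counit_simps)
  qed
  moreover obtain f where "r = \<theta> f" using \<theta>_surj[OF assms] by blast
  ultimately show ?thesis by (simp add: \<theta>_mult counit)
qed

sublocale unimodular: unimodular_ring A "\<lambda>k. \<theta> (fscalar k)" \<epsilon> "\<theta> (Fc - 1)" "\<theta> (Fb - 1)" "\<theta> (Fa ^ n - 1)"
  "cset L1" "cset L2" "cset L3" \<Lambda>
  using extensions right_ideal_cset \<Lambda>_integral \<Lambda>_nonzero \<Lambda>_unique \<Lambda>_right
  by unfold_locales (simp_all add: counit counit_simps)

end

section \<open>The coproduct forces \<open>n\<close> and \<open>n\<^sub>1\<close> to be coprime\<close>

text \<open>\<open>gauss r l l'\<close> is the Gaussian binomial coefficient \<open>(l + l' choose l)\<close> at \<open>r\<close>.\<close>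

fun gauss :: "'k::field \<Rightarrow> nat \<Rightarrow> nat \<Rightarrow> 'k"
  where
    "gauss r 0 l' = 1"
  | "gauss r (Suc l) 0 = 1"
  | "gauss r (Suc l) (Suc l') = r ^ Suc l' * gauss r l (Suc l') + gauss r (Suc l) l'"

lemma gauss_0: "gauss r l 0 = 1"
  by (cases l) simp_all

text \<open>The factorial formula for Gaussian binomials with denominators cleared, since
  \<open>r^j - 1\<close> may be zero. The two identities go together because each inductive step
  uses both.\<close>

lemma gauss_ratio:
  "gauss r (Suc l) l' * (r ^ Suc l - 1) = gauss r l l' * (r ^ Suc (l + l') - 1) \<and>
   gauss r l (Suc l') * (r ^ Suc l' - 1) = gauss r l l' * (r ^ Suc (l + l') - 1)"
proof (induction "l + l'" arbitrary: l l')
  case 0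
  then show ?case by (simp add: gauss_0)
next
  case (Suc N)
  have F: "gauss r (Suc l) l' * (r ^ Suc l - 1) = gauss r l l' * (r ^ Suc (l + l') - 1)"
  proof (cases l')
    case 0
    then show ?thesis by (simp add: gauss_0)
  next
    case (Suc k)
    have N: "N = l + k" using \<open>Suc N = l + l'\<close> Suc by simp
    note IH = Suc.hyps(1)[OF N]
    have "gauss r (Suc l) (Suc k) * (r ^ Suc l - 1)
        = r ^ Suc k * gauss r l (Suc k) * (r ^ Suc l - 1) + gauss r (Suc l) k * (r ^ Suc l - 1)"
      by (simp only: gauss.simps distrib_right)
    also have "\<dots> = r ^ Suc k * gauss r l (Suc k) * (r ^ Suc l - 1) + gauss r l (Suc k) * (r ^ Suc k - 1)"
      using IH by simp
    also have "\<dots> = gauss r l (Suc k) * (r ^ Suc (l + Suc k) - 1)"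
      by (simp add: algebra_simps power_add)
    finally show ?thesis using Suc by simp
  qed
  have G: "gauss r l (Suc l') * (r ^ Suc l' - 1) = gauss r l l' * (r ^ Suc (l + l') - 1)"
  proof (cases l)
    case 0
    then show ?thesis by simp
  next
    case (Suc k)
    have N: "N = k + l'" using \<open>Suc N = l + l'\<close> Suc by simp
    note IH = Suc.hyps(1)[OF N]
    have "gauss r (Suc k) (Suc l') * (r ^ Suc l' - 1)
        = r ^ Suc l' * (gauss r k (Suc l') * (r ^ Suc l' - 1)) + gauss r (Suc k) l' * (r ^ Suc l' - 1)"
      by (simp only: gauss.simps distrib_right mult.assoc)
    also have "\<dots> = r ^ Suc l' * (gauss r (Suc k) l' * (r ^ Suc k - 1)) + gauss r (Suc k) l' * (r ^ Suc l' - 1)"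
      using IH by simp
    also have "\<dots> = gauss r (Suc k) l' * (r ^ Suc (Suc k + l') - 1)"
      by (simp add: algebra_simps power_add)
    finally show ?thesis using Suc by simp
  qed
  show ?case using F G by blast
qed

text \<open>A case of the quantum Lucas theorem: at a root of unity of order \<open>m\<close> the
  Gaussian binomial \<open>((k+1) m choose m)\<close> is the ordinary number
  \<open>k + 1\<close>.\<close>

lemma gauss_root_of_unity:
  fixes r :: "'k::field"
  assumes m: "0 < m" and root: "\<And>j. r ^ j = 1 \<longleftrightarrow> m dvd j"
  shows "gauss r m (k * m) = of_nat (Suc k)"
proof -
  have rm: "r ^ m = 1" using root by simp
  have ne: "r ^ j \<noteq> 1" if "0 < j" "j < m" for j using root[of j] that by (auto dest: dvd_imp_le)
  have periodic: "gauss r l (l' + m) = gauss r l l'" if "l < m" for l l'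
    using that
  proof (induction l)
    case (Suc l)
    have "r ^ Suc (l + (l' + m)) = r ^ Suc (l + l') * r ^ m" by (simp add: power_add)
    then have "gauss r (Suc l) (l' + m) * (r ^ Suc l - 1) = gauss r (Suc l) l' * (r ^ Suc l - 1)"
      using Suc gauss_ratio[of r l "l' + m"] gauss_ratio[of r l l'] rm by simp
    then show ?case using ne[of "Suc l"] Suc.prems by simp
  qed simp
  obtain m' where m': "m = Suc m'" using m by (cases m) auto
  \<comment> \<open>The numerator of this coefficient contains \<open>r^m - 1\<close>, while its
    denominators stay below order \<open>m\<close>.\<close>
  have vanish: "gauss r m' (Suc j) = 0" if "Suc j < m" for j
    using that
  proof (induction j)
    case 0
    have "gauss r m' (Suc 0) * (r ^ Suc 0 - 1) = 0"
      using gauss_ratio[of r m' 0] rm by (simp add: m')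
    then show ?case using ne[of "Suc 0"] 0 by simp
  next
    case (Suc j)
    then have "gauss r m' (Suc (Suc j)) * (r ^ Suc (Suc j) - 1) = 0"
      using gauss_ratio[of r m' "Suc j"] by simp
    then show ?case using ne[of "Suc (Suc j)"] Suc.prems by simp
  qed
  have one: "gauss r m j = 1" if "j < m" for j
    using that
  proof (induction j)
    case (Suc j)
    then show ?case using vanish[of j] by (simp add: m' del: power_Suc)
  qed (simp add: gauss_0)
  \<comment> \<open>Any \<open>m\<close> consecutive second arguments contain one multiple of
    \<open>m\<close>, and only there does Pascal's rule add something, namely
    \<open>1\<close>.\<close>
  have shift: "gauss r m (l' + m) = gauss r m l' + 1" for l'
  proof (induction l')
    case 0
    have "gauss r m m = r ^ m * gauss r m' m + gauss r m m'" by (simp add: m' del: power_Suc)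
    then show ?case using one[of m'] periodic[of m' 0] rm by (simp add: m' gauss_0)
  next
    case (Suc l')
    have "r ^ Suc (l' + m) = r ^ Suc l'" by (simp add: power_add rm)
    moreover have "gauss r m (Suc l' + m) = r ^ Suc (l' + m) * gauss r m' (Suc l' + m) + gauss r m (l' + m)"
      by (simp add: m' del: power_Suc)
    moreover have "gauss r m (Suc l') = r ^ Suc l' * gauss r m' (Suc l') + gauss r m l'"
      by (simp add: m' del: power_Suc)
    ultimately show ?case using Suc periodic[of m' "Suc l'"] by (simp add: m' del: power_Suc gauss.simps)
  qed
  show ?thesis
  proof (induction k)
    case (Suc k)
    then show ?case using shift[of "k * m"] by (simp add: add.commute)
  qed (simp add: gauss_0)
qed

text \<open>The Verma module with basis \<open>x\<^sup>l\<close>, \<open>l < n\<close>, of highest weight \<open>a = b = c = 1\<close>, again repeated in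
  blocks.  Every generator acts as a weighted shift \<open>v l \<mapsto> w l * v (h l)\<close>.\<close>

locale verma =
  fixes n n1 :: nat and q \<beta>1 \<beta>2 \<beta>3 :: "'k::field_char_0"
  assumes n_ge_2: "n \<ge> 2" and primitive: "primitive_root_of_unity n q"
begin

definition "p = q ^ n1"

lemma q_n: "q ^ n = 1" using primitive by (simp add: primitive_root_of_unity_def)

lemma q_nz [simp]: "q \<noteq> 0" using q_n n_ge_2 by (metis power_0_left zero_neq_one not_numeral_le_zero)

lemma p_nz [simp]: "p \<noteq> 0" by (simp add: p_def)

lemma p_n: "p ^ n = 1"
  using q_n by (simp add: p_def power_mult[symmetric] mult.commute[of n1]) (simp add: power_mult)

text \<open>\<open>gam\<close> specialised to \<open>a = b = c = 1\<close>.\<close>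

definition gv :: "nat \<Rightarrow> 'k"
  where "gv l = \<beta>3 * (qnum p (Suc l) * inverse p ^ (2 * l) - qnum (inverse p) (Suc l))"

lemma power_dvd_1: "n dvd l \<Longrightarrow> p ^ l = 1" "n dvd l \<Longrightarrow> q ^ l = 1"
  using p_n q_n by (auto simp: power_mult elim!: dvdE)

lemma gv_Suc: "gv (Suc l) = inverse p * gv l + \<beta>3 * (inverse p ^ (2 * Suc l) - 1)"
  unfolding gv_def qnum_step[OF p_nz] qnum.simps(2)[of "inverse p" "Suc l"]
  by (simp add: algebra_simps del: qnum.simps)

text \<open>Coprimality is still to be proved here, so \<open>p = 1\<close> must be allowed; the two
  terms of \<open>gv\<close> then coincide.\<close>

lemma gv_one: "p = 1 \<Longrightarrow> gv l = 0"
  by (simp add: gv_def del: qnum.simps)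

lemma gv_block: assumes "n dvd Suc l" shows "gv l = 0"
proof (cases "p = 1")
  case False
  have "qnum p (Suc l) = 0" "qnum (inverse p) (Suc l) = 0"
    using qnum_closed[of p "Suc l"] qnum_closed[of "inverse p" "Suc l"] False power_dvd_1(1)[OF assms]
    by (simp_all add: power_inverse del: qnum.simps power_Suc)
  then show ?thesis by (simp add: gv_def del: qnum.simps)
qed (rule gv_one)

lemma gv_start: assumes "n dvd l" shows "gv l = 0"
proof (cases "p = 1")
  case False
  have "qnum p l = 0" "qnum (inverse p) l = 0"
    using qnum_closed[of p l] qnum_closed[of "inverse p" l] False power_dvd_1(1)[OF assms]
    by (simp_all add: power_inverse)
  moreover have "inverse p ^ (2 * l) = 1" "p ^ l = 1" "inverse p ^ l = 1"
    using power_dvd_1(1)[of "2 * l"] power_dvd_1(1)[of l] assms by (simp_all add: power_inverse)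
  ultimately show ?thesis unfolding gv_def qnum_Suc' by simp
qed (rule gv_one)

fun weight :: "hgen \<Rightarrow> nat \<Rightarrow> 'k"
  where
    "weight GA l = inverse q ^ l"
  | "weight GAi l = q ^ l"
  | "weight GX l = (if l mod n = 0 then 0 else 1)"
  | "weight GY l = gv l"
  | "weight _ l = 1"

fun shift :: "hgen \<Rightarrow> nat \<Rightarrow> nat"
  where
    "shift GX l = l - 1"
  | "shift GY l = Suc l"
  | "shift _ l = l"

definition vE :: "hgen \<Rightarrow> (nat \<Rightarrow> 'k) endo"
  where "vE s = Endo (\<lambda>v l. weight s l * v (shift s l))"

definition vS :: "'k \<Rightarrow> (nat \<Rightarrow> 'k) endo"
  where "vS k = Endo (\<lambda>v l. k * v l)"

lemma app_vE: "app (vE s) v = (\<lambda>l. weight s l * v (shift s l))"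
  and app_vS: "app (vS k) v = (\<lambda>l. k * v l)"
  by (simp_all add: vE_def vS_def app_Endo fun_eq_iff distrib_left)

section \<open>The tensor square of the Verma module, as functions of two indices\<close>

definition lift1 :: "(nat \<Rightarrow> 'k) endo \<Rightarrow> (nat \<Rightarrow> nat \<Rightarrow> 'k) endo"
  where "lift1 E = Endo (\<lambda>v l l'. app E (\<lambda>i. v i l') l)"

definition lift2 :: "(nat \<Rightarrow> 'k) endo \<Rightarrow> (nat \<Rightarrow> nat \<Rightarrow> 'k) endo"
  where "lift2 E = Endo (\<lambda>v l. app E (v l))"

lemma app_lift1: "app (lift1 E) v = (\<lambda>l l'. app E (\<lambda>i. v i l') l)"
proof -
  have "app E (\<lambda>i. (u + v) i l') l = app E (\<lambda>i. u i l') l + app E (\<lambda>i. v i l') l" for u v :: "nat \<Rightarrow> nat \<Rightarrow> 'k" and l l'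
    using app_add[of E "\<lambda>i. u i l'" "\<lambda>i. v i l'"] by (simp add: plus_fun_def)
  then show ?thesis by (simp add: lift1_def app_Endo fun_eq_iff)
qed

lemma app_lift2: "app (lift2 E) v = (\<lambda>l. app E (v l))"
  by (simp add: lift2_def app_Endo app_add fun_eq_iff)

lemma lift_hom:
  "lift1 (E + F) = lift1 E + lift1 F" "lift1 (E - F) = lift1 E - lift1 F" "lift1 (E * F) = lift1 E * lift1 F"
  "lift1 1 = 1" "lift1 0 = 0"
  "lift2 (E + F) = lift2 E + lift2 F" "lift2 (E - F) = lift2 E - lift2 F" "lift2 (E * F) = lift2 E * lift2 F"
  "lift2 1 = 1" "lift2 0 = 0"
  by (rule endo_eqI; simp add: app_simps app_lift1 app_lift2 fun_eq_iff)+

lemma lift_power: "lift1 (E ^ k) = lift1 E ^ k" "lift2 (E ^ k) = lift2 E ^ k"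
  by (induction k) (simp_all add: lift_hom)

lemma lift_commute: "lift1 (vE s) * lift2 (vE t) = lift2 (vE t) * lift1 (vE s)"
  by (rule endo_eqI) (simp add: app_simps app_lift1 app_lift2 app_vE fun_eq_iff)

lemma lift_vS: "lift2 (vS k) = lift1 (vS k)"
  by (rule endo_eqI) (simp add: app_lift1 app_lift2 app_vS fun_eq_iff)

lemma app_vE_GA_power: "app (vE GA ^ k) v = (\<lambda>l. inverse q ^ (l * k) * v l)"
  by (induction k) (simp_all add: app_simps app_vE fun_eq_iff power_add mult_ac)

lemma vE_trivial: "vE GB = 1" "vE GBi = 1" "vE GC = 1" "vE GCi = 1"
  by (rule endo_eqI; simp add: app_simps app_vE)+

lemma vE_GA_n: "vE GA ^ (n * n1) = 1"
proof (rule endo_eqI)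
  fix v
  have "inverse q ^ (l * (n * n1)) = 1" for l using power_dvd_1(2)[of "l * (n * n1)"] by (simp add: power_inverse)
  then show "app (vE GA ^ (n * n1)) v = app 1 v" by (simp add: app_vE_GA_power app_simps)
qed

text \<open>The right side of the relation for \<open>x^n\<close> acts as zero,
  \<open>a^(n n1)\<close> and \<open>b^n\<close> both being the identity, so \<open>x^n\<close> has
  to vanish whatever \<open>\<beta>1\<close> is. The same holds for \<open>y^n\<close> and
  \<open>\<beta>2\<close>.\<close>

lemma vE_GX_n: "vE GX ^ n = 0"
proof (rule endo_eqI)
  fix v :: "nat \<Rightarrow> 'k"
  have *: "app (vE GX ^ k) v l = (if k \<le> l mod n then v (l - k) else 0)" for k l
  proof (induction k arbitrary: l)
    case (Suc k)
    show ?case using Suc mod_minus_1[of l n] by (auto simp: app_simps app_vE)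
  qed (simp add: app_simps)
  have "\<not> n \<le> l mod n" for l using n_ge_2 by (simp add: not_le)
  then show "app (vE GX ^ n) v = app 0 v" by (simp add: * app_simps fun_eq_iff)
qed

lemma vE_GY_n: "vE GY ^ n = 0"
proof (rule endo_eqI)
  fix v :: "nat \<Rightarrow> 'k"
  have *: "app (vE GY ^ k) v l = (\<Prod>j<k. gv (l + j)) * v (l + k)" for k l
  proof (induction k arbitrary: l)
    case (Suc k)
    have "app (vE GY ^ Suc k) v l = gv l * ((\<Prod>j<k. gv (Suc l + j)) * v (Suc l + k))"
      by (simp add: app_simps app_vE Suc)
    then show ?case by (simp add: prod.lessThan_Suc_shift mult.assoc del: prod.lessThan_Suc power_Suc)
  qed (simp add: app_simps)
  have "(\<Prod>j<n. gv (l + j)) = 0" for l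
  proof (rule prod_zero)
    \<comment> \<open>Among \<open>n\<close> consecutive positions one ends a block, and there
      \<open>gv\<close> vanishes.\<close>
    let ?j = "n - 1 - l mod n"
    have "l + ?j + 1 = n * (l div n) + n"
    proof -
      have "l mod n < n" using n_ge_2 by simp
      moreover have "n * (l div n) + l mod n = l" by simp
      ultimately show ?thesis by linarith
    qed
    then have "Suc (l + ?j) = n * Suc (l div n)" by simp
    then have "n dvd Suc (l + ?j)" by (metis dvd_triv_left)
    then show "\<exists>j\<in>{..<n}. gv (l + j) = 0" using n_ge_2 gv_block by (intro bexI[of _ ?j]) auto
  qed simp
  then show "app (vE GY ^ n) v = app 0 v" by (simp add: * app_simps fun_eq_iff)
qed

lemma vE_relations:
  "vE GA * vE GAi = 1" "vE GAi * vE GA = 1"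
  "vE GX * vE GA = vS q * vE GA * vE GX" "vE GY * vE GA = vS (inverse q) * vE GA * vE GY"
  "vE GY * vE GX = vS (inverse q ^ n1) * vE GX * vE GY + vS \<beta>3 * (vE GA ^ (2 * n1) - 1)"
proof -
  show "vE GA * vE GAi = 1" "vE GAi * vE GA = 1"
    by (rule endo_eqI; simp add: app_simps app_vE fun_eq_iff power_inverse)+
  show "vE GY * vE GA = vS (inverse q) * vE GA * vE GY"
    by (rule endo_eqI) (simp add: app_simps app_vE app_vS fun_eq_iff mult_ac)
  show "vE GX * vE GA = vS q * vE GA * vE GX"
  proof (rule endo_eqI)
    fix v :: "nat \<Rightarrow> 'k"
    have "inverse q ^ (l - 1) = q * inverse q ^ l" if "l mod n \<noteq> 0" for l
      using that by (cases l) simp_all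
    then show "app (vE GX * vE GA) v = app (vS q * vE GA * vE GX) v"
      by (auto simp: app_simps app_vE app_vS fun_eq_iff)
  qed
  show "vE GY * vE GX = vS (inverse q ^ n1) * vE GX * vE GY + vS \<beta>3 * (vE GA ^ (2 * n1) - 1)"
  proof (rule endo_eqI)
    fix v :: "nat \<Rightarrow> 'k"
    have pw: "inverse q ^ (l * (2 * n1)) = inverse p ^ (2 * l)" for l
      by (simp add: p_def power_inverse power_mult[symmetric] mult_ac)
    have ip: "inverse q ^ n1 = inverse p" by (simp add: p_def power_inverse)
    have L: "app (vE GY * vE GX) v l = gv l * v l" for l
      using gv_block[of l] by (auto simp: app_simps app_vE dvd_eq_mod_eq_0)
    have R: "app (vS (inverse q ^ n1) * vE GX * vE GY + vS \<beta>3 * (vE GA ^ (2 * n1) - 1)) v l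
        = gv l * v l" for l
    proof (cases "l mod n = 0")
      case True
      then have d: "n dvd l" by auto
      have "inverse p ^ (2 * l) = 1" using power_dvd_1(1)[of "2 * l"] d by (simp add: power_inverse)
      then show ?thesis
        using True by (simp add: app_simps app_vE app_vS app_vE_GA_power pw gv_start[OF d] del: power_inverse)
    next
      case False
      then obtain l' where l: "l = Suc l'" by (cases l) auto
      show ?thesis
        using False unfolding app_simps app_vE app_vS app_vE_GA_power pw ip plus_fun_apply minus_apply
        by (simp add: l gv_Suc algebra_simps)
    qed
    show "app (vE GY * vE GX) v = app (vS (inverse q ^ n1) * vE GX * vE GY + vS \<beta>3 * (vE GA ^ (2 * n1) - 1)) v"
      unfolding fun_eq_iff L R by simp
  qed
qed

definition gHH :: "hgen + hgen \<Rightarrow> (nat \<Rightarrow> nat \<Rightarrow> 'k) endo"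
  where "gHH = case_sum (\<lambda>s. lift1 (vE s)) (\<lambda>s. lift2 (vE s))"

lemma vS_hom: "vS (k + l) = vS k + vS l" "vS (k * l) = vS k * vS l" "vS 1 = 1"
  by (rule endo_eqI; simp add: app_simps app_vS fun_eq_iff algebra_simps)+

lemma vS_comm: "vS k * vE s = vE s * vS k"
  by (rule endo_eqI) (simp add: app_simps app_vS app_vE fun_eq_iff)

lemma lift_HH: "free_algebra_lift (\<lambda>k. lift1 (vS k)) gHH"
proof
  fix k and s :: "hgen + hgen"
  show "lift1 (vS k) * gHH s = gHH s * lift1 (vS k)"
    by (cases s) (simp_all add: gHH_def vS_comm lift_hom(3,8)[symmetric] lift_vS[symmetric],
      simp_all add: vS_comm lift_hom(3)[symmetric] lift_vS)
qed (simp_all add: vS_hom lift_hom)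

definition "RepHH = free_lift (\<lambda>k. lift1 (vS k)) gHH"

lemmas RepHH_simps = free_algebra_lift.flift_simps[OF lift_HH, folded RepHH_def]

lemma RepHH_relations:
  assumes "r \<in> HH_relations n n1 q \<beta>1 \<beta>2 \<beta>3" shows "RepHH r = 0"
proof -
  have 1: "RepHH r = 0" if "r \<in> H_relations_at n n1 q \<beta>1 \<beta>2 \<beta>3 (\<lambda>s. fgen (Inl s))" for r
    using that unfolding H_relations_at_def Let_def
    by (elim insertE; simp add: RepHH_simps gHH_def lift_hom(1-5)[symmetric] lift_power(1)[symmetric]
        vE_trivial vE_relations vE_GA_n vE_GX_n vE_GY_n)
  have 2: "RepHH r = 0" if "r \<in> H_relations_at n n1 q \<beta>1 \<beta>2 \<beta>3 (\<lambda>s. fgen (Inr s))" for r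
    using that unfolding H_relations_at_def Let_def
    by (elim insertE; simp add: RepHH_simps gHH_def lift_vS[symmetric] lift_hom(6-10)[symmetric] lift_power(2)[symmetric]
        vE_trivial vE_relations vE_GA_n vE_GX_n vE_GY_n)
  have 3: "RepHH (fgen (Inl s) * fgen (Inr t) - fgen (Inr t) * fgen (Inl s)) = 0" for s t
    by (simp add: RepHH_simps gHH_def lift_commute)
  show ?thesis using assms 1 2 3 unfolding HH_relations_def by blast
qed

text \<open>The coproduct of \<open>x\<close> acting on the tensor square, with \<open>b\<close>
  acting as the identity.\<close>

definition "Dx = lift1 (vE GX) * lift2 (vE GA ^ n1) + lift2 (vE GX)"

lemma app_Dx: "app Dx v l l' = (if l mod n = 0 then 0 else inverse p ^ l' * v (l - 1) l') +
    (if l' mod n = 0 then 0 else v l (l' - 1))"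
proof -
  have "inverse q ^ (l' * n1) = inverse p ^ l'"
    by (simp add: p_def power_inverse power_mult[symmetric] mult.commute)
  then show ?thesis
    by (simp add: Dx_def app_simps app_lift1 app_lift2 app_vE app_vE_GA_power del: power_inverse)
qed

text \<open>The coproduct of the relation for \<open>x^n\<close> must act as zero. Its group-like
  terms act as the identity and cancel, which leaves the \<open>n\<close>-th power of the coproduct
  of \<open>x\<close>.\<close>

lemma Hopf_Dx:
  assumes "H_is_Hopf_algebra n n1 q \<beta>1 \<beta>2 \<beta>3" shows "Dx ^ n = 0"
proof -
  have cl: "free_algebra_lift fscalar (H_comult_gen n1 :: hgen \<Rightarrow> (hgen + hgen, 'k) free_algebra)"
    by unfold_locales (rule fscalar_add fscalar_mult fscalar_1 fscalar_central)+
  note comult_simps = free_algebra_lift.flift_simps[OF cl, folded free_comult_def]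
  let ?r = "fgen GX ^ n - fscalar \<beta>1 * (fgen GA ^ (n * n1) - fgen GB ^ n)"
  have "?r \<in> H_relations n n1 q \<beta>1 \<beta>2 \<beta>3" by (simp add: H_relations_at_def Let_def)
  then have "free_comult n1 ?r \<in> relation_ideal (HH_relations n n1 q \<beta>1 \<beta>2 \<beta>3)"
    using assms by (simp add: H_is_Hopf_algebra_def)
  then have "RepHH (free_comult n1 ?r) = 0"
    using free_algebra_lift.flift_relation_ideal[OF lift_HH, where S = "HH_relations n n1 q \<beta>1 \<beta>2 \<beta>3"]
      RepHH_relations by (simp add: RepHH_def)
  moreover have "(lift1 (vE GA) * lift2 (vE GA)) ^ k = lift1 (vE GA ^ k) * lift2 (vE GA ^ k)" for k
  proof (rule endo_eqI)
    fix v :: "nat \<Rightarrow> nat \<Rightarrow> 'k"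
    have "app ((lift1 (vE GA) * lift2 (vE GA)) ^ k) v l l' = inverse q ^ (l * k) * (inverse q ^ (l' * k) * v l l')" for l l'
      by (induction k arbitrary: l l') (simp_all add: app_simps app_lift1 app_lift2 app_vE power_add mult_ac)
    then show "app ((lift1 (vE GA) * lift2 (vE GA)) ^ k) v = app (lift1 (vE GA ^ k) * lift2 (vE GA ^ k)) v"
      by (simp add: app_simps app_lift1 app_lift2 app_vE_GA_power fun_eq_iff)
  qed
  ultimately show ?thesis
    by (simp add: comult_simps RepHH_simps gHH_def Dx_def lift_power vE_GA_n[folded power_mult] vE_trivial lift_hom
        flip: lift_power(2))
      (simp add: vE_GA_n lift_hom)?
qed

text \<open>The quantum binomial theorem for the two summands of \<open>Dx\<close>, read off on the
  highest weight vector of the tensor square. The bounds keep the indices inside the first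
  block.\<close>

lemma Dx_power:
  "l < n \<Longrightarrow> l' < n \<Longrightarrow>
    app (Dx ^ N) (\<lambda>l l'. if l = 0 \<and> l' = 0 then 1 else 0) l l' = (if l + l' = N then gauss (inverse p) l l' else 0)"
proof (induction N arbitrary: l l')
  case 0
  then show ?case by (auto simp: app_simps)
next
  case (Suc N)
  let ?w = "app (Dx ^ N) (\<lambda>l l'. if l = 0 \<and> l' = 0 then 1 else 0)"
  have "app (Dx ^ Suc N) (\<lambda>l l'. if l = 0 \<and> l' = 0 then 1 else 0) l l'
      = (if l = 0 then 0 else inverse p ^ l' * ?w (l - 1) l') + (if l' = 0 then 0 else ?w l (l' - 1))"
    using Suc.prems by (simp add: app_simps app_Dx)
  also have "\<dots> = (if l = 0 then 0 else inverse p ^ l' * (if l - 1 + l' = N then gauss (inverse p) (l - 1) l' else 0)) +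
      (if l' = 0 then 0 else (if l + (l' - 1) = N then gauss (inverse p) l (l' - 1) else 0))"
    using Suc.prems by (simp add: Suc.IH)
  also have "\<dots> = (if l + l' = Suc N then gauss (inverse p) l l' else 0)"
    by (cases l; cases l') (auto simp: gauss_0 simp del: power_Suc)
  finally show ?case .
qed

text \<open>If \<open>g = gcd n n1\<close> exceeds \<open>1\<close>, then \<open>p\<close> has order
  \<open>m = n div g < n\<close>, and the coefficient at \<open>(m, n - m)\<close> in the
  \<open>n\<close>-th power of \<open>Dx\<close> is a Gaussian binomial equal to \<open>g\<close>,
  which is nonzero in characteristic zero.\<close>

lemma Hopf_coprime:
  assumes "H_is_Hopf_algebra n n1 q \<beta>1 \<beta>2 \<beta>3" shows "coprime n n1"
proof (rule ccontr)
  assume nc: "\<not> coprime n n1"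
  define g where "g = gcd n n1"
  define m where "m = n div g"
  have g: "g \<noteq> 0" "g \<noteq> 1" using nc n_ge_2 by (auto simp: g_def coprime_iff_gcd_eq_1)
  have nm: "n = g * m" by (simp add: m_def g_def)
  then have m: "0 < m" using n_ge_2 by (cases m) auto
  obtain k where k: "n1 = g * k" "coprime m k"
  proof
    show "n1 = g * (n1 div g)" by (simp add: g_def)
    show "coprime m (n1 div g)" using n_ge_2 unfolding m_def g_def by (intro div_gcd_coprime) auto
  qed
  have root: "inverse p ^ j = 1 \<longleftrightarrow> m dvd j" for j
  proof -
    have "inverse p ^ j = 1 \<longleftrightarrow> q ^ (n1 * j) = 1" by (simp add: p_def power_inverse power_mult)
    also have "\<dots> \<longleftrightarrow> g * m dvd g * (k * j)"
      using primitive_root_power_eq_1_iff[OF primitive] by (simp add: nm[symmetric] k mult.assoc)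
    also have "\<dots> \<longleftrightarrow> m dvd j" using g k(2) by (simp add: coprime_dvd_mult_right_iff)
    finally show ?thesis .
  qed
  obtain g' where g': "g = Suc (Suc g')" using g by (metis One_nat_def not0_implies_Suc)
  have sum: "m + Suc g' * m = n" using nm g' by simp
  have "m < n" "Suc g' * m < n" using m sum by (simp_all add: sum[symmetric])
  then have "app (Dx ^ n) (\<lambda>l l'. if l = 0 \<and> l' = 0 then 1 else 0) m (Suc g' * m) = gauss (inverse p) m (Suc g' * m)"
    using Dx_power[of m "Suc g' * m" n] sum by simp
  also have "\<dots> = of_nat (Suc (Suc g'))" by (rule gauss_root_of_unity[OF m root])
  finally show False using Hopf_Dx[OF assms] by (simp add: app_simps del: of_nat_Suc)
qed

end

section \<open>The opposite algebra\<close>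

text \<open>Reversing words and interchanging \<open>x \<leftrightarrow> y\<close>, \<open>b \<leftrightarrow> c\<close> identifies the opposite algebra of \<open>H\<^sub>\<beta>\<close> with
  the algebra for the parameters \<open>(\<beta>\<^sub>2, \<beta>\<^sub>1, \<beta>\<^sub>3)\<close>, so right integrals need no separate computation.\<close>

fun swap_gen :: "hgen \<Rightarrow> hgen"
  where
    "swap_gen GA = GA" | "swap_gen GAi = GAi" | "swap_gen GB = GC" | "swap_gen GBi = GCi"
  | "swap_gen GC = GB" | "swap_gen GCi = GBi" | "swap_gen GX = GY" | "swap_gen GY = GX"

definition anti :: "(hgen, 'k::field) free_algebra \<Rightarrow> (hgen, 'k) free_algebra"
  where "anti = free_antilift fscalar (\<lambda>s. fgen (swap_gen s))"

lemma fscalar_lift: "additive_lift (fscalar :: 'k::field \<Rightarrow> ('x, 'k) free_algebra)"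
  by unfold_locales (rule fscalar_add)

lemma anti_add: "anti (f + g) = anti f + anti g" and anti_diff: "anti (f - g) = anti f - anti g"
  and anti_0: "anti 0 = 0"
  by (simp_all add: anti_def free_antilift_eq_monoid_lift additive_lift.lift_add[OF fscalar_lift]
      additive_lift.lift_diff[OF fscalar_lift] additive_lift.lift_zero[OF fscalar_lift])

lemma anti_single:
  "anti (Poly_Mapping.single w k) = fscalar k * prod_list (map (\<lambda>s. fgen (swap_gen s)) (rev (letters w)))"
  by (simp add: anti_def free_antilift_eq_monoid_lift additive_lift.lift_single[OF fscalar_lift])

lemma anti_scalar_mult: "anti (fscalar k * f) = fscalar k * anti f"
proof -
  have "anti (fscalar k * (\<Sum>w\<in>S. Poly_Mapping.single w (F w))) = fscalar k * anti (\<Sum>w\<in>S. Poly_Mapping.single w (F w))" for S F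
    by (induction S rule: infinite_finite_induct)
       (simp_all add: anti_0 anti_add distrib_left, simp add: fscalar_def mult_single anti_single mult.assoc[symmetric])
  from this[of "Poly_Mapping.lookup f" "Poly_Mapping.keys f"]
  show ?thesis unfolding poly_mapping_sum_single[symmetric] .
qed

lemma anti_gen_mult: "anti (fgen s * f) = anti f * fgen (swap_gen s)"
proof -
  have "anti (fgen s * (\<Sum>w\<in>S. Poly_Mapping.single w (F w))) = anti (\<Sum>w\<in>S. Poly_Mapping.single w (F w)) * fgen (swap_gen s)" for S F
    by (induction S rule: infinite_finite_induct)
       (simp_all add: anti_0 anti_add distrib_left distrib_right,
        simp add: fgen_def mult_single anti_single plus_fword_def mult.assoc)
  from this[of "Poly_Mapping.lookup f" "Poly_Mapping.keys f"]
  show ?thesis unfolding poly_mapping_sum_single[symmetric] .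
qed

lemma anti_1: "anti 1 = 1"
proof -
  have "letters (0 :: hgen fword) = []" by (simp add: zero_fword_def)
  then show ?thesis using anti_single[of 0 1] by (simp add: fscalar_1)
qed

lemma anti_mult: "anti (f * g) = anti g * anti f"
  by (induction f rule: free_algebra_induct)
     (simp_all add: anti_1 anti_add anti_scalar_mult anti_gen_mult distrib_left distrib_right mult.assoc
       fscalar_left_commute[of "anti g"])

lemma anti_gen: "anti (fgen s) = fgen (swap_gen s)"
  using anti_gen_mult[of s 1] by (simp add: anti_1)

lemma anti_scalar: "anti (fscalar k) = fscalar k"
  using anti_scalar_mult[of k 1] by (simp add: anti_1)

lemma anti_power: "anti (f ^ k) = anti f ^ k"
  by (induction k) (simp_all add: anti_1 anti_mult power_commutes)

lemma swap_swap: "swap_gen (swap_gen s) = s"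
  by (cases s) simp_all

lemma anti_anti: "anti (anti f) = f"
  by (induction f rule: free_algebra_induct)
     (simp_all add: anti_1 anti_add anti_mult anti_gen anti_scalar swap_swap)

section \<open>Presentations of the algebra and of its opposite\<close>

context H_parameters
begin

text \<open>The commutation relations in the shape in which \<open>anti\<close> produces them, with
  the scalars on the right.\<close>

lemma relation_memberships:
  "u \<in> {Fa, Fb, Fc} \<Longrightarrow> v \<in> {Fa, Fb, Fc} \<Longrightarrow> u * v - v * u \<in> relation_ideal Rels"
  "Fa * Fy - Fy * (Fa * fscalar q) \<in> relation_ideal Rels"
  "Fa * Fx - Fx * (Fa * fscalar (inverse q)) \<in> relation_ideal Rels"
  "Fx * Fb - Fb * Fx \<in> relation_ideal Rels" "Fx * Fc - Fc * Fx \<in> relation_ideal Rels"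
  "Fy * Fb - Fb * Fy \<in> relation_ideal Rels" "Fy * Fc - Fc * Fy \<in> relation_ideal Rels"
proof -
  show "u \<in> {Fa, Fb, Fc} \<Longrightarrow> v \<in> {Fa, Fb, Fc} \<Longrightarrow> u * v - v * u \<in> relation_ideal Rels"
    using scommute_group[of u v] by (simp add: scommute_def rel_eq_def fscalar_1)
  have "scommute Rels q Fa Fy" using scommute_sym[OF scommute_gens(5)] by simp
  then show "Fa * Fy - Fy * (Fa * fscalar q) \<in> relation_ideal Rels"
    by (simp add: scommute_def rel_eq_def fscalar_central mult.assoc)
  have "scommute Rels (inverse q) Fa Fx" using scommute_sym[OF scommute_gens(4)] by simp
  then show "Fa * Fx - Fx * (Fa * fscalar (inverse q)) \<in> relation_ideal Rels"
    by (simp add: scommute_def rel_eq_def fscalar_central mult.assoc)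
  show "Fx * Fb - Fb * Fx \<in> relation_ideal Rels" "Fx * Fc - Fc * Fx \<in> relation_ideal Rels"
    "Fy * Fb - Fb * Fy \<in> relation_ideal Rels" "Fy * Fc - Fc * Fy \<in> relation_ideal Rels"
    using scommute_gens(6-9)[THEN scommute_sym1] by (simp_all add: scommute_def rel_eq_def fscalar_1)
qed

text \<open>Reversal undoes the exchange of \<open>x\<close> and \<open>y\<close> in the products
  \<open>y x\<close> and \<open>x y\<close>, and \<open>b c\<close> is preserved up to order, so
  this relation goes to itself; the relations for \<open>x^n\<close> and \<open>y^n\<close> are
  interchanged, and with them \<open>\<beta>1\<close> and \<open>\<beta>2\<close>.\<close>

lemma anti_relations:
  assumes "r \<in> H_relations n n1 q \<beta>2 \<beta>1 \<beta>3" shows "anti r \<in> relation_ideal Rels"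
proof -
  define K where "K = relation_ideal Rels"
  note J = relations(1-6)[unfolded rel_eq_def, folded K_def] relation_memberships[folded K_def]
  have yx: "Fy * Fx - Fx * (Fy * fscalar (inverse q ^ n1)) - (Fa ^ (2 * n1) - Fb * Fc) * fscalar \<beta>3 \<in> K"
  proof -
    have "Fy * Fx - Fx * (Fy * fscalar (inverse q ^ n1)) - (Fa ^ (2 * n1) - Fb * Fc) * fscalar \<beta>3
        = Fy * Fx - (fscalar (inverse p) * (Fx * Fy) + fscalar \<beta>3 * (Fa ^ (2 * n1) - Fb * Fc))"
      by (simp add: fscalar_central[of _ "Fx * Fy"] fscalar_central[of _ "Fa ^ (2 * n1) - Fb * Fc"]
          mult.assoc p_def power_inverse)
    then show ?thesis using relations(7)[unfolded rel_eq_def, folded K_def] by (simp only:)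
  qed
  have pw: "Fx ^ n - (Fa ^ (n * n1) - Fb ^ n) * fscalar \<beta>1 \<in> K"
    "Fy ^ n - (Fa ^ (n * n1) - Fc ^ n) * fscalar \<beta>2 \<in> K"
    using relations(8,9)[unfolded rel_eq_def, folded K_def] by (simp_all add: fscalar_central)
  show ?thesis
    unfolding K_def[symmetric] using assms unfolding H_relations_at_def Let_def
    by (elim insertE; simp add: anti_diff anti_mult anti_gen anti_1 anti_power anti_scalar J yx pw)
qed

lemma anti_relation_ideal:
  assumes "f \<in> relation_ideal (H_relations n n1 q \<beta>2 \<beta>1 \<beta>3)" shows "anti f \<in> relation_ideal Rels"
proof -
  have "relation_ideal (H_relations n n1 q \<beta>2 \<beta>1 \<beta>3) \<subseteq> {f. anti f \<in> relation_ideal Rels}"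
    by (rule relation_ideal_least)
       (use anti_relations in \<open>auto simp: anti_0 anti_add anti_mult relation_ideal_0 relation_ideal_add
          relation_ideal_lmult relation_ideal_rmult\<close>)
  then show ?thesis using assms by auto
qed

lemma counit_relation_ideal:
  assumes "f \<in> relation_ideal Rels" shows "free_counit f = 0"
proof -
  have "free_counit r = 0" if "r \<in> Rels" for r
    using that unfolding H_relations_at_def Let_def
    by (elim insertE) (use n_pos in \<open>simp_all add: counit_simps zero_power\<close>)
  then show ?thesis
    using free_algebra_lift.flift_relation_ideal[OF counit_lift, of Rels f] assms
    by (simp add: free_counit_def)
qed

lemma free_counit_anti: "free_counit (anti f) = (free_counit f :: 'k)"
proof (induction f rule: free_algebra_induct)
  case (gen s f)
  then show ?case by (cases s) (simp_all add: anti_gen_mult counit_simps)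
qed (simp_all add: anti_1 anti_add anti_scalar_mult counit_simps)

abbreviation "HA \<equiv> H_alg n n1 q \<beta>1 \<beta>2 \<beta>3"
abbreviation "proj \<equiv> (\<lambda>f. relation_ideal Rels +>\<^bsub>ring_of_type_algebra\<^esub> f)"

lemma H_counit_proj: "H_counit (proj f) = free_counit f"
proof -
  have "proj f = (\<lambda>j. j + f) ` relation_ideal Rels"
    by (auto simp: a_r_coset_def' ring_of_type_algebra_def)
  then have "free_counit ` proj f = {free_counit f}"
    using relation_ideal_0[of Rels] by (force simp: image_image counit_simps counit_relation_ideal)
  then show ?thesis by (simp add: H_counit_def)
qed

lemma H_presentation: "presentation HA proj Rels"
  unfolding H_alg_def by (rule presentation_quotient)

lemma H_quotient_left: "H_quotient n n1 q \<beta>1 \<beta>2 \<beta>3 HA proj H_counit"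
  by (intro H_quotient.intro H_quotient_axioms.intro H_parameters_axioms H_presentation H_counit_proj)

lemma ring_opposite: "ring R \<Longrightarrow> ring (opposite_ring R)"
proof -
  assume "ring R"
  then interpret ring R .
  have "abelian_group (opposite_ring R)"
    by (rule abelian_groupI) (auto simp: opposite_ring_def a_ac intro: bexI[of _ "\<ominus>\<^bsub>R\<^esub> _"] l_neg)
  then show ?thesis
    by (rule ringI) (unfold_locales, auto simp: opposite_ring_def m_assoc l_distr r_distr)
qed

text \<open>Composing the projection with the involution \<open>anti\<close> turns it into a
  homomorphism to the opposite ring, and \<open>anti\<close> matches the two relation ideals in both
  directions.\<close>

lemma H_quotient_right:
  "H_quotient n n1 q \<beta>2 \<beta>1 \<beta>3 (opposite_ring HA) (\<lambda>f. proj (anti f)) H_counit"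
proof -
  interpret P: presentation HA proj Rels by (rule H_presentation)
  interpret S: H_parameters n n1 q \<beta>2 \<beta>1 \<beta>3
    using n_ge_2 primitive coprime by unfold_locales
  have op: "carrier (opposite_ring HA) = carrier HA" "add (opposite_ring HA) = add HA"
    "one (opposite_ring HA) = one HA" "ring.zero (opposite_ring HA) = ring.zero HA"
    "\<And>r s. r \<otimes>\<^bsub>opposite_ring HA\<^esub> s = s \<otimes>\<^bsub>HA\<^esub> r"
    by (simp_all add: opposite_ring_def)
  have "presentation (opposite_ring HA) (\<lambda>f. proj (anti f)) S.Rels"
  proof (rule presentation.intro[OF ring_opposite[OF P.ring_axioms]], unfold_locales)
    fix f g
    show "proj (anti f) \<in> carrier (opposite_ring HA)" using P.\<theta>_closed by (simp add: op)
    show "proj (anti (f + g)) = proj (anti f) \<oplus>\<^bsub>opposite_ring HA\<^esub> proj (anti g)"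
      using P.\<theta>_add by (simp add: op anti_add)
    show "proj (anti (f * g)) = proj (anti f) \<otimes>\<^bsub>opposite_ring HA\<^esub> proj (anti g)"
      using P.\<theta>_mult by (simp add: op anti_mult)
    show "proj (anti 1) = \<one>\<^bsub>opposite_ring HA\<^esub>" using P.\<theta>_one by (simp add: op anti_1)
    show "proj (anti f) = \<zero>\<^bsub>opposite_ring HA\<^esub> \<longleftrightarrow> f \<in> relation_ideal S.Rels"
      unfolding op P.\<theta>_kernel using anti_relation_ideal S.anti_relation_ideal[of "anti f"] by (auto simp: anti_anti)
  next
    fix r assume "r \<in> carrier (opposite_ring HA)"
    then obtain f where "r = proj f" using P.\<theta>_surj by (auto simp: op)
    then have "r = proj (anti (anti f))" by (simp add: anti_anti)
    then show "\<exists>f. r = proj (anti f)" by blast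
  qed
  then show ?thesis
    by (intro H_quotient.intro H_quotient_axioms.intro S.H_parameters_axioms)
       (simp_all add: H_counit_proj free_counit_anti)
qed

end

lemma bimodule_isomorphic_trans:
  assumes "bimodule_isomorphic R M N" "bimodule_isomorphic R N L"
  shows "bimodule_isomorphic R M L"
proof -
  obtain \<phi> where \<phi>: "bij_betw \<phi> (carrier M) (carrier N)"
    "\<forall>x\<in>carrier M. \<forall>y\<in>carrier M. \<phi> (x \<oplus>\<^bsub>M\<^esub> y) = \<phi> x \<oplus>\<^bsub>N\<^esub> \<phi> y"
    "\<forall>r\<in>carrier R. \<forall>x\<in>carrier M. \<phi> (r \<odot>\<^bsub>M\<^esub> x) = r \<odot>\<^bsub>N\<^esub> \<phi> x"
    "\<forall>r\<in>carrier R. \<forall>x\<in>carrier M. \<phi> (rsmult M x r) = rsmult N (\<phi> x) r"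
    using assms(1) unfolding bimodule_isomorphic_def by blast
  obtain \<psi> where \<psi>: "bij_betw \<psi> (carrier N) (carrier L)"
    "\<forall>x\<in>carrier N. \<forall>y\<in>carrier N. \<psi> (x \<oplus>\<^bsub>N\<^esub> y) = \<psi> x \<oplus>\<^bsub>L\<^esub> \<psi> y"
    "\<forall>r\<in>carrier R. \<forall>x\<in>carrier N. \<psi> (r \<odot>\<^bsub>N\<^esub> x) = r \<odot>\<^bsub>L\<^esub> \<psi> x"
    "\<forall>r\<in>carrier R. \<forall>x\<in>carrier N. \<psi> (rsmult N x r) = rsmult L (\<psi> x) r"
    using assms(2) unfolding bimodule_isomorphic_def by blast
  have "\<phi> x \<in> carrier N" if "x \<in> carrier M" for x using \<phi>(1) that by (rule bij_betwE[THEN bspec])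
  then show ?thesis
    unfolding bimodule_isomorphic_def
    by (intro exI[of _ "\<psi> \<circ> \<phi>"] conjI bij_betw_trans[OF \<phi>(1) \<psi>(1)]) (simp_all add: \<phi>(2-) \<psi>(2-))
qed

theorem corollary2p6:
  fixes n n1 :: nat
    and q \<beta>1 \<beta>2 \<beta>3 :: "'k :: {alg_closed_field, field_char_0}"
    and P :: "nat \<Rightarrow> ('k H_elem, 'p) module" and d :: "nat \<Rightarrow> 'p \<Rightarrow> 'p" and aug :: "'p \<Rightarrow> 'k"
    and Q :: "nat \<Rightarrow> ('k H_elem, 'q) module" and d' :: "nat \<Rightarrow> 'q \<Rightarrow> 'q" and aug' :: "'q \<Rightarrow> 'k"
  defines "H \<equiv> H_alg n n1 q \<beta>1 \<beta>2 \<beta>3"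
    and "\<eta> \<equiv> H_unit n n1 q \<beta>1 \<beta>2 \<beta>3"
  assumes "n \<ge> 2"
    and "primitive_root_of_unity n q"
    and "1 \<le> n1" and "n1 \<le> n" and "\<not> 2 dvd gcd n n1"
    and "H_is_Hopf_algebra n n1 q \<beta>1 \<beta>2 \<beta>3"
    and "projective_resolution H (trivial_module H_counit) P d aug"
    and "projective_resolution (opposite_ring H) (trivial_module H_counit) Q d' aug'"
  shows "bimodule_isomorphic H (Ext_right_trivial H \<eta> H_counit 3 Q d')
                               (Ext_left_trivial H \<eta> H_counit 3 P d) \<and>
         bimodule_isomorphic H (Ext_left_trivial H \<eta> H_counit 3 P d)
                               (trivial_bimodule H_counit)"
proof -
  interpret verma n n1 q \<beta>1 \<beta>2 \<beta>3 using assms by unfold_locales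
  \<comment> \<open>Coprimality of \<open>n\<close> and \<open>n1\<close> is extracted from the Hopf
    structure.\<close>
  interpret Hp: H_parameters n n1 q \<beta>1 \<beta>2 \<beta>3
    using assms Hopf_coprime by unfold_locales
  have \<eta>: "\<eta> = (\<lambda>k. Hp.proj (fscalar k))"
    by (simp add: \<eta>_def H_unit_def presented_unit_def fun_eq_iff)
  interpret L: H_quotient n n1 q \<beta>1 \<beta>2 \<beta>3 H Hp.proj H_counit
    unfolding H_def by (rule Hp.H_quotient_left)
  interpret R: H_quotient n n1 q \<beta>2 \<beta>1 \<beta>3 "opposite_ring H" "\<lambda>f. Hp.proj (anti f)" H_counit
    unfolding H_def by (rule Hp.H_quotient_right)
  have left: "bimodule_isomorphic H (Ext_left_trivial H \<eta> H_counit 3 P d) (trivial_bimodule H_counit)"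
    "bimodule_isomorphic H (trivial_bimodule H_counit) (Ext_left_trivial H \<eta> H_counit 3 P d)"
    unfolding Ext_left_trivial_def \<eta>
    using L.unimodular.Ext3_bimodule_trivial(1,2)[OF assms(9) refl] by simp_all
  \<comment> \<open>Left multiplication in \<open>H\<close> is right multiplication in the opposite
    ring, so the two actions appear in exchanged roles, as in the third claim.\<close>
  have "bimodule_isomorphic H (Ext_right_trivial H \<eta> H_counit 3 Q d') (trivial_bimodule H_counit)"
    unfolding Ext_right_trivial_def \<eta>
    using R.unimodular.Ext3_bimodule_trivial(3)[OF assms(10), of H]
    by (simp add: opposite_ring_def anti_scalar)
  then show ?thesis using left bimodule_isomorphic_trans by blast
qed

end
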